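(* Let $S_{\boldsymbol\lambda}$ be a weighted shift on a directed tree $\mathscr T=(V,E)$ with weights $\boldsymbol\lambda=\{\lambda_v\}_{v\in V^\circ}\subseteq\mathbb C$ such that $\mathscr E_V\subseteq\mathscr Q(S_{\boldsymbol\lambda})$. Then the following conditions are equivalent: (i) $S_{\boldsymbol\lambda}$ is subnormal; (ii) $\{\|S_{\boldsymbol\lambda}^n e_u\|^2\}_{n=0}^\infty$ is a Stieltjes moment sequence for every $u\in V$; (iii) there exist a system $\{\mu_v\}_{v\in V}$ of Borel probability measures on $\mathbb R_+$ and a system $\{\varepsilon_v\}_{v\in V}$ of nonnegative real numbers such that for every $u\in V$, $$\mu_u(\sigma)=\sum_{v\in \mathrm{Chi}(u)}|\lambda_v|^2\int_\sigma \frac1s\,d\mu_v(s)+\varepsilon_u\,\delta_0(\sigma)\quad\text{for every Borel set }\sigma\subseteq\mathbb R_+ .$$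
   Context: A directed graph is a pair $\mathscr T=(V,E)$, where $V$ is a nonempty set (vertices) and $E\subseteq\{(u,v)\in V\times V: u\neq v\}$ (edges). A vertex $v$ is a root if there is no $u\in V$ with $(u,v)\in E$; $V^\circ$ is the set of non-root vertices. $\mathscr T$ is a directed tree if it is connected (as an undirected graph), has no circuits (no distinct $u_1,\dots,u_n$, $n\ge2$, with $(u_j,u_{j+1})\in E$ for $1\le j<n$ and $(u_n,u_1)\in E$), and each $v\in V^\circ$ has a parent, i.e. a unique vertex $\mathrm{par}(v)$ with $(\mathrm{par}(v),v)\in E$. A directed tree has at most one root, denoted $\mathrm{root}$. $\mathrm{Chi}(u)=\{v\in V:(u,v)\in E\}$. $\ell^2(V)$ is the Hilbert space of square summable complex functions on $V$, $e_u$ is the characteristic function of $\{u\}$, and $\mathscr E_V$ is the linear span of $\{e_u:u\in V\}$. The weighted shift $S_{\boldsymbol\lambda}$ on $\mathscr T$ with weights $\{\lambda_v\}_{v\in V^\circ}$ is the operator in $\ell^2(V)$ with domain $\{f\in\ell^2(V):\Lambda f\in\ell^2(V)\}$ and $S_{\boldsymbol\lambda}f=\Lambda f$, where $(\Lambda f)(v)=\lambda_v f(\mathrm{par}(v))$ for $v\in V^\circ$ and $(\Lambda f)(\mathrm{root})=0$. For an operator $A$ in a Hilbert space, $\mathcal D^\infty(A)=\bigcap_{n\ge0}\mathcal D(A^n)$, and $\mathscr Q(A)$ is the set of quasi-analytic vectors of $A$, i.e. of all $f\in\mathcal D^\infty(A)$ such that $\sum_{n=1}^\infty \|A^nf\|^{-1/n}=\infty$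 (with $\frac10=\infty$). A densely defined operator $S$ in a complex Hilbert space $\mathcal H$ is subnormal if there are a complex Hilbert space $\mathcal K\supseteq\mathcal H$ (isometric embedding) and a normal (possibly unbounded) operator $N$ in $\mathcal K$ such that $Sh=Nh$ for all $h\in\mathcal D(S)$. A real sequence $\{t_n\}_{n=0}^\infty$ is a Stieltjes moment sequence if there is a positive Borel measure $\mu$ on $\mathbb R_+=[0,\infty)$ with $t_n=\int_0^\infty s^n\,d\mu(s)$ for all $n\ge0$. Conventions: $\delta_0$ is the Borel probability measure on $\mathbb R_+$ concentrated at $0$; $\frac10=\infty$, $0\cdot\infty=0$; empty sums are $0$; $\int_0^\infty$ is integration over $\mathbb R_+$. *)

theory Defs
  imports "HOL-Probability.Probability"
begin

section \<open>Complex Hilbert spaces\<close>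

text \<open>
  The complex inner product is linear in the first argument.  The norm is the one of
  \<^class>\<open>real_inner\<close>, whose inner product is required to be the real part of the complex one;
  hence the square of the norm of \<open>x\<close> is \<open>cinner x x\<close>.
\<close>

class complex_inner = real_inner +
  fixes scaleC :: "complex \<Rightarrow> 'a \<Rightarrow> 'a" (infixr "*\<^sub>C" 75)
    and cinner :: "'a \<Rightarrow> 'a \<Rightarrow> complex"
  assumes scaleC_add_right: "c *\<^sub>C (x + y) = c *\<^sub>C x + c *\<^sub>C y"
    and scaleC_add_left: "(c + d) *\<^sub>C x = c *\<^sub>C x + d *\<^sub>C x"
    and scaleC_scaleC: "c *\<^sub>C (d *\<^sub>C x) = (c * d) *\<^sub>C x"
    and scaleC_of_real: "complex_of_real r *\<^sub>C x = r *\<^sub>R x"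
    and cinner_commute: "cinner x y = cnj (cinner y x)"
    and cinner_add_left: "cinner (x + y) z = cinner x z + cinner y z"
    and cinner_scaleC_left: "cinner (c *\<^sub>C x) y = c * cinner x y"
    and inner_eq_Re_cinner: "inner x y = Re (cinner x y)"

class chilbert_space = complex_inner + complete_space

lemma vector_space_scaleC: "vector_space (scaleC :: complex \<Rightarrow> 'a::complex_inner \<Rightarrow> 'a)"
proof
  show "1 *\<^sub>C x = x" for x :: 'a
    using scaleC_of_real[of 1 x] by simp
qed (simp_all add: scaleC_add_right scaleC_add_left scaleC_scaleC)

lemma cinner_self: "cinner x x = complex_of_real ((norm x)\<^sup>2)"
proof -
  have "Im (cinner x x) = 0"
    using arg_cong[OF cinner_commute[of x x], of Im] by simp
  then show ?thesis
    by (simp add: complex_eq_iff inner_eq_Re_cinner[symmetric] power2_norm_eq_inner)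
qed


section \<open>Square summable functions\<close>

typedef 'v ell2 = "{f :: 'v \<Rightarrow> complex. (\<lambda>v. (cmod (f v))\<^sup>2) summable_on UNIV}"
  morphisms ell2_fun Abs_ell2
  by (rule exI[of _ "\<lambda>_. 0"]) simp

setup_lifting type_definition_ell2

lemma square_summable: "(\<lambda>v. (cmod (ell2_fun f v))\<^sup>2) summable_on UNIV"
  using ell2_fun[of f] by simp

lemma square_summable_add:
  assumes "(\<lambda>v. (cmod (f v))\<^sup>2) summable_on UNIV" "(\<lambda>v. (cmod (g v))\<^sup>2) summable_on UNIV"
  shows "(\<lambda>v. (cmod (f v + g v))\<^sup>2) summable_on UNIV"
proof (rule summable_on_comparison_test)
  show "(\<lambda>v. 2 * (cmod (f v))\<^sup>2 + 2 * (cmod (g v))\<^sup>2) summable_on UNIV"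
    by (intro summable_on_add summable_on_cmult_right assms)
  fix v
  have "(cmod (f v + g v))\<^sup>2 \<le> (cmod (f v) + cmod (g v))\<^sup>2"
    by (intro power_mono norm_triangle_ineq) auto
  also have "\<dots> \<le> 2 * (cmod (f v))\<^sup>2 + 2 * (cmod (g v))\<^sup>2"
    using zero_le_power2[of "cmod (f v) - cmod (g v)"] by (simp add: power2_sum power2_diff)
  finally show "(cmod (f v + g v))\<^sup>2 \<le> 2 * (cmod (f v))\<^sup>2 + 2 * (cmod (g v))\<^sup>2" .
qed auto

lemma square_summable_scale:
  assumes "(\<lambda>v. (cmod (f v))\<^sup>2) summable_on UNIV"
  shows "(\<lambda>v. (cmod (c * f v))\<^sup>2) summable_on UNIV"
  using summable_on_cmult_right[OF assms, of "(cmod c)\<^sup>2"]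
  by (simp add: norm_mult power_mult_distrib)

lemma product_summable:
  assumes "(\<lambda>v. (cmod (f v))\<^sup>2) summable_on UNIV" "(\<lambda>v. (cmod (g v))\<^sup>2) summable_on UNIV"
  shows "(\<lambda>v. f v * cnj (g v)) summable_on UNIV"
proof (rule abs_summable_summable, rule summable_on_comparison_test)
  show "(\<lambda>v. (cmod (f v))\<^sup>2 + (cmod (g v))\<^sup>2) summable_on UNIV"
    by (intro summable_on_add assms)
  fix v
  have "0 \<le> (cmod (f v) - cmod (g v))\<^sup>2 + (cmod (f v))\<^sup>2 + (cmod (g v))\<^sup>2"
    by simp
  then show "norm (f v * cnj (g v)) \<le> (cmod (f v))\<^sup>2 + (cmod (g v))\<^sup>2"
    by (simp add: norm_mult power2_diff)
qed auto

lemma Re_infsum_mult_cnj: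
  assumes "(\<lambda>v. (cmod (f v))\<^sup>2) summable_on UNIV"
  shows "Re (\<Sum>\<^sub>\<infinity>v. f v * cnj (f v)) = (\<Sum>\<^sub>\<infinity>v. (cmod (f v))\<^sup>2)"
  using infsum_Re[OF product_summable[OF assms assms]]
  by (simp add: cmod_power2 flip: power2_eq_square)

instantiation ell2 :: (type) complex_inner
begin

lift_definition zero_ell2 :: "'a ell2" is "\<lambda>_. 0"
  by simp

lift_definition plus_ell2 :: "'a ell2 \<Rightarrow> 'a ell2 \<Rightarrow> 'a ell2" is "\<lambda>f g v. f v + g v"
  by (rule square_summable_add)

lift_definition uminus_ell2 :: "'a ell2 \<Rightarrow> 'a ell2" is "\<lambda>f v. - f v"
  by simp

lift_definition minus_ell2 :: "'a ell2 \<Rightarrow> 'a ell2 \<Rightarrow> 'a ell2" is "\<lambda>f g v. f v - g v"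
proof -
  fix f g :: "'a \<Rightarrow> complex"
  assume "(\<lambda>v. (cmod (f v))\<^sup>2) summable_on UNIV" "(\<lambda>v. (cmod (g v))\<^sup>2) summable_on UNIV"
  then show "(\<lambda>v. (cmod (f v - g v))\<^sup>2) summable_on UNIV"
    using square_summable_add[of f "\<lambda>v. - g v"] by simp
qed

lift_definition scaleC_ell2 :: "complex \<Rightarrow> 'a ell2 \<Rightarrow> 'a ell2" is "\<lambda>c f v. c * f v"
  by (rule square_summable_scale)

lift_definition scaleR_ell2 :: "real \<Rightarrow> 'a ell2 \<Rightarrow> 'a ell2" is "\<lambda>r f v. complex_of_real r * f v"
  by (rule square_summable_scale)

lift_definition cinner_ell2 :: "'a ell2 \<Rightarrow> 'a ell2 \<Rightarrow> complex"
  is "\<lambda>f g. \<Sum>\<^sub>\<infinity>v. f v * cnj (g v)" .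

definition inner_ell2 :: "'a ell2 \<Rightarrow> 'a ell2 \<Rightarrow> real"
  where "inner_ell2 f g = Re (cinner f g)"

definition norm_ell2 :: "'a ell2 \<Rightarrow> real"
  where "norm_ell2 f = sqrt (inner f f)"

definition dist_ell2 :: "'a ell2 \<Rightarrow> 'a ell2 \<Rightarrow> real"
  where "dist_ell2 f g = norm (f - g)"

definition sgn_ell2 :: "'a ell2 \<Rightarrow> 'a ell2"
  where "sgn_ell2 f = inverse (norm f) *\<^sub>R f"

definition uniformity_ell2 :: "('a ell2 \<times> 'a ell2) filter"
  where "uniformity_ell2 = (INF e\<in>{0<..}. principal {(f, g). dist f g < e})"

definition open_ell2 :: "'a ell2 set \<Rightarrow> bool"
  where "open_ell2 U \<longleftrightarrow> (\<forall>f\<in>U. \<forall>\<^sub>F (f', g) in uniformity. f' = f \<longrightarrow> g \<in> U)"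

instance
proof
  fix f g h :: "'a ell2" and c d :: complex and r s :: real and U :: "'a ell2 set"
  show "f + g + h = f + (g + h)" "f + g = g + f" "0 + f = f" "- f + f = 0" "f - g = f + - g"
    by (transfer; simp add: algebra_simps)+
  show "r *\<^sub>R (f + g) = r *\<^sub>R f + r *\<^sub>R g" "(r + s) *\<^sub>R f = r *\<^sub>R f + s *\<^sub>R f"
    "r *\<^sub>R s *\<^sub>R f = (r * s) *\<^sub>R f" "1 *\<^sub>R f = f"
    by (transfer; simp add: algebra_simps)+
  show "c *\<^sub>C (f + g) = c *\<^sub>C f + c *\<^sub>C g" "(c + d) *\<^sub>C f = c *\<^sub>C f + d *\<^sub>C f"
    "c *\<^sub>C d *\<^sub>C f = (c * d) *\<^sub>C f" "complex_of_real r *\<^sub>C f = r *\<^sub>R f"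
    by (transfer; simp add: algebra_simps)+
  show "sgn f = inverse (norm f) *\<^sub>R f"
    by (rule sgn_ell2_def)
  show "dist f g = norm (f - g)"
    by (rule dist_ell2_def)
  show "uniformity = (INF e\<in>{0<..}. principal {(f, g :: 'a ell2). dist f g < e})"
    by (rule uniformity_ell2_def)
  show "open U \<longleftrightarrow> (\<forall>f\<in>U. \<forall>\<^sub>F (f', g) in uniformity. f' = f \<longrightarrow> g \<in> U)"
    by (rule open_ell2_def)
  show "inner f g = Re (cinner f g)"
    by (rule inner_ell2_def)
  show "norm f = sqrt (inner f f)"
    by (rule norm_ell2_def)
  show cc: "cinner f g = cnj (cinner g f)" for f g :: "'a ell2"
    by transfer (simp flip: infsum_cnj add: mult.commute)
  show ca: "cinner (f + g) h = cinner f h + cinner g h" for f g h :: "'a ell2"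
    by transfer (simp add: distrib_right infsum_add product_summable)
  show cs: "cinner (c *\<^sub>C f) g = c * cinner f g" for c and f g :: "'a ell2"
    by transfer (simp add: mult.assoc infsum_cmult_right product_summable)
  show "inner f g = inner g f"
    unfolding inner_ell2_def by (subst cc) simp
  show "inner (f + g) h = inner f h + inner g h"
    unfolding inner_ell2_def by (simp add: ca)
  have "r *\<^sub>R f = complex_of_real r *\<^sub>C f"
    by transfer simp
  then show "inner (r *\<^sub>R f) g = r * inner f g"
    unfolding inner_ell2_def by (simp add: cs)
  have self: "inner f f = (\<Sum>\<^sub>\<infinity>v. (cmod (ell2_fun f v))\<^sup>2)"
    unfolding inner_ell2_def cinner_ell2.rep_eq by (rule Re_infsum_mult_cnj[OF square_summable])
  show "0 \<le> inner f f"
    unfolding self by (intro infsum_nonneg) simp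
  show "inner f f = 0 \<longleftrightarrow> f = 0"
  proof
    assume "inner f f = 0"
    then have "(cmod (ell2_fun f v))\<^sup>2 = 0" for v
      unfolding self
      using nonneg_infsum_le_0D[of "\<lambda>v. (cmod (ell2_fun f v))\<^sup>2" UNIV v] square_summable[of f]
      by simp
    then show "f = 0"
      by transfer auto
  next
    assume "f = 0"
    then show "inner f f = 0"
      unfolding self by (simp add: zero_ell2.rep_eq)
  qed
qed

end

lemma norm_ell2_square: "(norm f)\<^sup>2 = (\<Sum>\<^sub>\<infinity>v. (cmod (ell2_fun f v))\<^sup>2)"
  unfolding power2_norm_eq_inner[of f] inner_ell2_def cinner_ell2.rep_eq
  by (rule Re_infsum_mult_cnj[OF square_summable])

lemma sum_le_norm_ell2_square:
  assumes "finite F"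
  shows "(\<Sum>v\<in>F. (cmod (ell2_fun f v))\<^sup>2) \<le> (norm f)\<^sup>2"
  unfolding norm_ell2_square
  by (intro finite_sum_le_infsum square_summable assms) auto

lemma norm_ell2_fun_le: "cmod (ell2_fun f v) \<le> norm f"
  using sum_le_norm_ell2_square[of "{v}" f] by (simp add: power2_le_iff_abs_le)

instance ell2 :: (type) chilbert_space
proof
  fix X :: "nat \<Rightarrow> 'a ell2"
  assume "Cauchy X"
  have "Cauchy (\<lambda>n. ell2_fun (X n) v)" for v
  proof (rule CauchyI)
    fix e :: real
    assume "0 < e"
    then obtain M where "\<forall>m\<ge>M. \<forall>n\<ge>M. norm (X m - X n) < e"
      using CauchyD[OF \<open>Cauchy X\<close>] by blast
    moreover have "norm (ell2_fun (X m) v - ell2_fun (X n) v) \<le> norm (X m - X n)" for m n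
      using norm_ell2_fun_le[of "X m - X n" v] by (simp add: minus_ell2.rep_eq)
    ultimately show "\<exists>M. \<forall>m\<ge>M. \<forall>n\<ge>M. norm (ell2_fun (X m) v - ell2_fun (X n) v) < e"
      by (meson le_less_trans)
  qed
  then have "\<exists>l. (\<lambda>n. ell2_fun (X n) v) \<longlonglongrightarrow> l" for v
    by (simp add: Cauchy_convergent convergentD)
  then obtain l where l: "\<And>v. (\<lambda>n. ell2_fun (X n) v) \<longlonglongrightarrow> l v"
    by metis
  have bound: "(\<Sum>v\<in>F. (cmod (ell2_fun (X m) v - l v))\<^sup>2) \<le> e\<^sup>2"
    if "finite F" and M: "\<forall>m\<ge>M. \<forall>n\<ge>M. norm (X m - X n) < e" and "m \<ge> M" for F M e m
  proof (rule LIMSEQ_le_const2)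
    show "(\<lambda>n. \<Sum>v\<in>F. (cmod (ell2_fun (X m) v - ell2_fun (X n) v))\<^sup>2)
        \<longlonglongrightarrow> (\<Sum>v\<in>F. (cmod (ell2_fun (X m) v - l v))\<^sup>2)"
      by (intro tendsto_intros l)
    have "(\<Sum>v\<in>F. (cmod (ell2_fun (X m) v - ell2_fun (X n) v))\<^sup>2) \<le> e\<^sup>2" if "n \<ge> M" for n
    proof -
      have "norm (X m - X n) \<le> e"
        using M that \<open>m \<ge> M\<close> less_imp_le by blast
      then have "(norm (X m - X n))\<^sup>2 \<le> e\<^sup>2"
        by (simp add: power_mono)
      then show ?thesis
        using sum_le_norm_ell2_square[OF \<open>finite F\<close>, of "X m - X n"]
        by (simp add: minus_ell2.rep_eq)
    qed
    then show "\<exists>N. \<forall>n\<ge>N. (\<Sum>v\<in>F. (cmod (ell2_fun (X m) v - ell2_fun (X n) v))\<^sup>2) \<le> e\<^sup>2"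
      by blast
  qed
  have diff: "(\<lambda>v. (cmod (ell2_fun (X m) v - l v))\<^sup>2) summable_on UNIV"
    if "\<forall>m\<ge>M. \<forall>n\<ge>M. norm (X m - X n) < e" and "m \<ge> M" for M e m
    using bound[OF _ that] by (intro nonneg_bdd_above_summable_on bdd_aboveI2[where M = "e\<^sup>2"]) auto
  obtain M where M: "\<forall>m\<ge>M. \<forall>n\<ge>M. norm (X m - X n) < 1"
    using CauchyD[OF \<open>Cauchy X\<close>, of 1] by auto
  have "(\<lambda>v. (cmod (ell2_fun (X M) v + - (ell2_fun (X M) v - l v)))\<^sup>2) summable_on UNIV"
    by (intro square_summable_add square_summable)
      (simp only: norm_minus_cancel diff[OF M order_refl])
  then have "(\<lambda>v. (cmod (l v))\<^sup>2) summable_on UNIV"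
    by simp
  then have L: "ell2_fun (Abs_ell2 l) = l"
    by (simp add: Abs_ell2_inverse)
  have "X \<longlonglongrightarrow> Abs_ell2 l"
  proof (rule LIMSEQ_I)
    fix r :: real
    assume "0 < r"
    then obtain N where N: "\<forall>m\<ge>N. \<forall>n\<ge>N. norm (X m - X n) < r / 2"
      using CauchyD[OF \<open>Cauchy X\<close>, of "r / 2"] by auto
    have "norm (X n - Abs_ell2 l) < r" if "n \<ge> N" for n
    proof -
      have "(norm (X n - Abs_ell2 l))\<^sup>2 \<le> (r / 2)\<^sup>2"
        unfolding norm_ell2_square minus_ell2.rep_eq L
        by (rule infsum_le_finite_sums[OF diff[OF N that] bound[OF _ N that]])
      then have "norm (X n - Abs_ell2 l) \<le> r / 2"
        by (rule power2_le_imp_le) (use \<open>0 < r\<close> in simp)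
      then show ?thesis
        using \<open>0 < r\<close> by simp
    qed
    then show "\<exists>N. \<forall>n\<ge>N. norm (X n - Abs_ell2 l) < r"
      by blast
  qed
  then show "convergent X"
    by (rule convergentI)
qed

lift_definition unit_vec :: "'v \<Rightarrow> 'v ell2" is "\<lambda>u v. if v = u then 1 else 0"
proof -
  fix u :: 'v
  have "(\<lambda>v. (cmod (if v = u then 1 else 0))\<^sup>2) summable_on UNIV
      \<longleftrightarrow> (\<lambda>v. (cmod (if v = u then 1 else 0))\<^sup>2) summable_on {u}"
    by (rule summable_on_cong_neutral) auto
  then show "(\<lambda>v. (cmod (if v = u then 1 else 0))\<^sup>2) summable_on UNIV"
    by simp
qed

definition unit_vec_span :: "'v ell2 set"
  where "unit_vec_span = module.span scaleC (range unit_vec)"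


section \<open>Operators in Hilbert spaces\<close>

text \<open>
  An unbounded operator \<open>A\<close> is identified with its graph.  Thus the domain of \<open>A\<close> is
  \<open>Domain A\<close>, the operator ``first \<open>A\<close>, then \<open>B\<close>'' with its natural domain is \<open>A O B\<close>,
  and \<open>A ^^ n\<close> is the \<open>n\<close>-th power with its natural domain (\<open>A ^^ 0 = Id\<close>).
\<close>

type_synonym 'h operator = "('h \<times> 'h) set"

definition linear_operator :: "'h::complex_inner operator \<Rightarrow> bool"
  where "linear_operator A \<longleftrightarrow>
    single_valued A \<and> (0, 0) \<in> A \<and>
    (\<forall>f f' g g'. (f, f') \<in> A \<longrightarrow> (g, g') \<in> A \<longrightarrow> (f + g, f' + g') \<in> A) \<and>
    (\<forall>c f f'. (f, f') \<in> A \<longrightarrow> (c *\<^sub>C f, c *\<^sub>C f') \<in> A)"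

definition op_apply :: "'h operator \<Rightarrow> 'h \<Rightarrow> 'h"
  where "op_apply A f = (THE g. (f, g) \<in> A)"

definition densely_defined :: "'h::complex_inner operator \<Rightarrow> bool"
  where "densely_defined A \<longleftrightarrow> closure (Domain A) = UNIV"

definition adjoint_op :: "'h::complex_inner operator \<Rightarrow> 'h operator"
  where "adjoint_op A = {(g, g'). \<forall>(f, f') \<in> A. cinner f' g = cinner f g'}"

text \<open>A closed operator is one whose graph is closed; the last conjunct says \<open>N\<^sup>* N = N N\<^sup>*\<close>.\<close>

definition normal_operator :: "'h::chilbert_space operator \<Rightarrow> bool"
  where "normal_operator N \<longleftrightarrow>
    linear_operator N \<and> densely_defined N \<and> closed N \<and>
    N O adjoint_op N = adjoint_op N O N"

text \<open>
  The type argument is the Hilbert space in which the normal extension acts; the space of \<open>S\<close>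
  is embedded in it by the linear isometry \<open>J\<close>.  Subnormality of an operator in \<open>'v ell2\<close>
  means \<open>subnormal_in TYPE('k)\<close> for some \<open>'k\<close>.  A quantifier over types is not available, but
  \<open>'k = ('v \<times> nat) ell2\<close> is always large enough: the smallest subspace that reduces the normal
  extension and contains the range of \<open>J\<close> has dimension at most that of this space, and one may
  add the zero operator on a further orthogonal summand.
\<close>

definition subnormal_in :: "'k::chilbert_space itself \<Rightarrow> 'h::chilbert_space operator \<Rightarrow> bool"
  where "subnormal_in _ S \<longleftrightarrow>
    linear_operator S \<and> densely_defined S \<and>
    (\<exists>(J :: 'h \<Rightarrow> 'k) (N :: 'k operator).
      Vector_Spaces.linear scaleC scaleC J \<and> (\<forall>h. norm (J h) = norm h) \<and>
      normal_operator N \<and> (\<forall>(h, h') \<in> S. (J h, J h') \<in> N))"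

definition smooth_vectors :: "'h operator \<Rightarrow> 'h set"
  where "smooth_vectors A = (\<Inter>n. Domain (A ^^ n))"

text \<open>The terms of the series are extended nonnegative reals, in which \<open>1 / 0 = \<infinity>\<close>.\<close>

definition quasi_analytic_vectors :: "'h::complex_inner operator \<Rightarrow> 'h set"
  where "quasi_analytic_vectors A =
    {f \<in> smooth_vectors A.
      (\<Sum>n. 1 / ennreal (root (Suc n) (norm (op_apply (A ^^ Suc n) f)))) = \<infinity>}"


section \<open>Directed trees and weighted shifts\<close>

text \<open>The vertex set is the set of all elements of the type \<^typ>\<open>'v\<close>.\<close>

definition is_root :: "('v \<times> 'v) set \<Rightarrow> 'v \<Rightarrow> bool"
  where "is_root E v \<longleftrightarrow> (\<nexists>u. (u, v) \<in> E)"

definition circuit :: "('v \<times> 'v) set \<Rightarrow> 'v list \<Rightarrow> bool"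
  where "circuit E us \<longleftrightarrow>
    2 \<le> length us \<and> distinct us \<and>
    (\<forall>j. Suc j < length us \<longrightarrow> (us ! j, us ! Suc j) \<in> E) \<and> (last us, hd us) \<in> E"

definition directed_tree :: "('v \<times> 'v) set \<Rightarrow> bool"
  where "directed_tree E \<longleftrightarrow>
    irrefl E \<and>
    (\<forall>u v. (u, v) \<in> (E \<union> E\<inverse>)\<^sup>*) \<and>
    (\<nexists>us. circuit E us) \<and>
    (\<forall>v. \<not> is_root E v \<longrightarrow> (\<exists>!u. (u, v) \<in> E))"

definition par :: "('v \<times> 'v) set \<Rightarrow> 'v \<Rightarrow> 'v"
  where "par E v = (THE u. (u, v) \<in> E)"

definition Chi :: "('v \<times> 'v) set \<Rightarrow> 'v \<Rightarrow> 'v set"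
  where "Chi E u = {v. (u, v) \<in> E}"

text \<open>Only the weights at non-root vertices matter.\<close>

definition shift_map :: "('v \<times> 'v) set \<Rightarrow> ('v \<Rightarrow> complex) \<Rightarrow> ('v \<Rightarrow> complex) \<Rightarrow> 'v \<Rightarrow> complex"
  where "shift_map E w f v = (if is_root E v then 0 else w v * f (par E v))"

text \<open>
  Since \<open>g\<close> ranges over the square summable functions, the domain consists of those \<open>f\<close>
  for which \<open>shift_map E w f\<close> is square summable.
\<close>

definition weighted_shift :: "('v \<times> 'v) set \<Rightarrow> ('v \<Rightarrow> complex) \<Rightarrow> 'v ell2 operator"
  where "weighted_shift E w = {(f, g). ell2_fun g = shift_map E w (ell2_fun f)}"


section \<open>Measures on the nonnegative half-line\<close>

abbreviation borel_nonneg :: "real measure"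
  where "borel_nonneg \<equiv> restrict_space borel {0..}"

definition stieltjes_moment_seq :: "(nat \<Rightarrow> real) \<Rightarrow> bool"
  where "stieltjes_moment_seq t \<longleftrightarrow>
    (\<exists>\<mu>. sets \<mu> = sets borel_nonneg \<and> (\<forall>n. has_bochner_integral \<mu> (\<lambda>s. s ^ n) (t n)))"

text \<open>
  All values are extended nonnegative reals, with \<open>1 / 0 = \<infinity>\<close> and \<open>0 * \<infinity> = 0\<close>;
  \<open>return borel_nonneg 0\<close> is the Dirac measure at \<open>0\<close>.
\<close>

definition consistent_system ::
    "('v \<times> 'v) set \<Rightarrow> ('v \<Rightarrow> complex) \<Rightarrow> ('v \<Rightarrow> real measure) \<Rightarrow> ('v \<Rightarrow> real) \<Rightarrow> bool"
  where "consistent_system E w \<mu> \<epsilon> \<longleftrightarrow>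
    (\<forall>u. \<forall>\<sigma> \<in> sets borel_nonneg.
      emeasure (\<mu> u) \<sigma> =
        (\<Sum>\<^sub>\<infinity>v\<in>Chi E u. ennreal ((cmod (w v))\<^sup>2) * (\<integral>\<^sup>+s\<in>\<sigma>. 1 / ennreal s \<partial>\<mu> v))
        + ennreal (\<epsilon> u) * emeasure (return borel_nonneg 0) \<sigma>)"

end

theory Submission
  imports Defs
begin

text \<open>
  Write \<open>S\<close> for the weighted shift, \<open>e\<^sub>u\<close> for the unit vector at the vertex \<open>u\<close>, and \<open>|w\<^sub>v|\<^sup>2\<close>
  for the squared modulus of a weight.  Multiplying the consistency condition by \<open>s\<close> removes the
  factor \<open>1/s\<close> and the atom at \<open>0\<close>.  What remains is the density equation
  \<open>s d\<mu>\<^sub>u(s) = \<Sum>v\<in>Chi u. |w\<^sub>v|\<^sup>2 d\<mu>\<^sub>v(s)\<close> for all \<open>u\<close>; conversely \<open>\<epsilon>\<^sub>u\<close> can be read off as the mass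
  of \<open>\<mu>\<^sub>u\<close> at \<open>0\<close> (\<open>consistent_system_iff_density\<close>).  The condition enters the proof only in this form.

  From a normal extension to moments.  If \<open>S\<close> has a normal extension \<open>N\<close>, then \<open>\<parallel>S\<^sup>n e\<^sub>u\<parallel> = \<parallel>N\<^sup>n x\<parallel>\<close> for
  the image \<open>x\<close> of \<open>e\<^sub>u\<close>, in whatever Hilbert space \<open>N\<close> acts.  The bounded operator
  \<open>R = (1 + N\<^sup>* N)\<^sup>-\<^sup>1\<close> satisfies \<open>0 \<le> R \<le> 1\<close>, and the numbers
  \<open>\<langle>R\<^sup>k (1 - R)\<^sup>l y, y\<rangle>\<close> solve the Hausdorff moment problem on \<open>[0, 1]\<close>, which yields a measure
  \<open>\<mu>\<^sub>y\<close> for every vector \<open>y\<close>.  Normality makes \<open>N\<close> commute with \<open>R\<close>, so that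
  \<open>(1 - r) d\<mu>\<^sub>y(r) = r d\<mu>\<^bsub>N y\<^esub>(r)\<close>; after the substitution \<open>s = (1 - r)/r\<close> the \<open>n\<close>-th moment of
  \<open>\<mu>\<^sub>x\<close> is \<open>\<parallel>N\<^sup>n x\<parallel>\<^sup>2\<close> (\<open>normal_operator_moments\<close>).

  From moments to the density equation.  Grouping the descendants of \<open>u\<close> by the child they descend
  from gives \<open>\<parallel>S\<^sup>n\<^sup>+\<^sup>1 e\<^sub>u\<parallel>\<^sup>2 = \<Sum>v\<in>Chi u. |w\<^sub>v|\<^sup>2 \<parallel>S\<^sup>n e\<^sub>v\<parallel>\<^sup>2\<close>.  Hence, if \<open>\<mu>\<^sub>v\<close> has the moments
  \<open>\<parallel>S\<^sup>n e\<^sub>v\<parallel>\<^sup>2\<close> for each \<open>v\<close>, both sides of the density equation have the same moments.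
  Quasi-analyticity of \<open>e\<^sub>u\<close> and Carleman's inequality give the Carleman condition for these moments, and
  then they determine the measure: the integrals of \<open>cos (x sqrt s)\<close> with respect to the two sides differ,
  as functions of \<open>x\<close>, by a quasi-analytic function that is flat at \<open>0\<close>, hence zero
  (\<open>denjoy_carleman\<close>, \<open>stieltjes_determinate\<close>).  In the other direction, the density equation and the
  recursion for the norms give the moments by induction on \<open>n\<close>.

  From the density equation to a normal extension.  On the direct sum of the spaces \<open>L\<^sup>2(\<mu>\<^sub>v)\<close> the
  operator \<open>(T F)(v, s) = w\<^sub>v F(par v, s)\<close> extends \<open>S\<close>, if a square summable \<open>f\<close> is regarded as the function that is
  constantly \<open>f v\<close> on the fibre at \<open>v\<close>.  The density equation says that \<open>T\<^sup>* T\<close> is the multiplication by \<open>s\<close>,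
  which commutes with \<open>T\<close>.  So \<open>T\<close> is quasinormal, and quasinormal operators have normal
  extensions.  The construction below works with bounded operators only.  With
  \<open>\<theta> = arctan (sqrt s)\<close>, the multiplications by \<open>B = cos \<theta>\<close> and \<open>C = sin \<theta>\<close> are bounded, and \<open>T\<close> is
  \<open>W C B\<^sup>-\<^sup>1\<close> for a partial isometry \<open>W\<close> that commutes with \<open>B\<close> and \<open>C\<close>
  (\<open>subnormal_if_angular_measures\<close>).  A dilation of \<open>W C\<close> to a bounded normal operator gives the
  normal extension of \<open>T\<close> as a quotient (\<open>quasinormal_normal_extension\<close>).  The spaces \<open>L\<^sup>2(\<mu>\<^sub>v)\<close>
  enter only through the inner products of the functions \<open>e\<^sup>i\<^sup>n\<^sup>\<theta>\<close>, so they can be replaced by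
  vectors with the same Gram matrix in the square summable functions on \<open>\<nat>\<close>; this is why the
  extension acts on square summable functions on the pairs of a vertex and a natural number.
\<close>

section \<open>Inner products and orthogonal projections\<close>

lemma cinner_add_right: "cinner x (y + z) = cinner x y + cinner x (z::'a::complex_inner)"
  by (metis cinner_add_left cinner_commute complex_cnj_add)

lemma cinner_scaleC_right: "cinner x (c *\<^sub>C y) = cnj c * cinner x (y::'a::complex_inner)"
  by (metis cinner_commute cinner_scaleC_left complex_cnj_mult)

text \<open>
  The imaginary part of the complex inner product is a real inner product as well.  Continuity and
  orthogonality can therefore be transferred from the real inner product.
\<close>

lemma cinner_eq_Complex: "cinner x y = Complex (inner x y) (inner x (\<i> *\<^sub>C (y::'a::complex_inner)))"
  by (simp add: complex_eq_iff inner_eq_Re_cinner cinner_scaleC_right)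

lemma scaleC_one [simp]: "1 *\<^sub>C x = (x::'a::complex_inner)"
  using scaleC_of_real[of 1 x] by simp

lemma scaleC_minus1: "(-1) *\<^sub>C x = - (x::'a::complex_inner)"
  using scaleC_of_real[of "-1" x] by simp

lemma scaleC_zero_left [simp]: "0 *\<^sub>C x = (0::'a::complex_inner)"
  using scaleC_of_real[of 0 x] by simp

lemma scaleC_zero_right [simp]: "c *\<^sub>C 0 = (0::'a::complex_inner)"
  using scaleC_scaleC[of c 0 "0::'a"] by simp

lemma scaleC_minus_left: "(-c) *\<^sub>C x = - (c *\<^sub>C (x::'a::complex_inner))"
  using scaleC_scaleC[of "-1" c x] by (simp add: scaleC_minus1)

lemma scaleC_minus_right: "c *\<^sub>C (- x) = - (c *\<^sub>C (x::'a::complex_inner))"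
  by (metis mult.commute scaleC_minus1 scaleC_scaleC)

lemma scaleC_diff_right: "c *\<^sub>C (x - y) = c *\<^sub>C x - c *\<^sub>C (y::'a::complex_inner)"
  using scaleC_add_right[of c x "-y"] by (simp add: scaleC_minus_right)

lemma cinner_zero_left [simp]: "cinner 0 x = (0::complex)" for x :: "'a::complex_inner"
  using cinner_scaleC_left[of 0 x x] by simp

lemma cinner_zero_right [simp]: "cinner x 0 = (0::complex)" for x :: "'a::complex_inner"
  using cinner_scaleC_right[of x 0 x] by simp

lemma cinner_minus_left: "cinner (- x) y = - cinner x (y::'a::complex_inner)"
  using cinner_scaleC_left[of "-1" x y] by (simp add: scaleC_minus1)

lemma cinner_minus_right: "cinner x (- y) = - cinner x (y::'a::complex_inner)"
  using cinner_scaleC_right[of x "-1" y] by (simp add: scaleC_minus1)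

lemma cinner_diff_left: "cinner (x - y) z = cinner x z - cinner y (z::'a::complex_inner)"
  using cinner_add_left[of x "-y" z] by (simp add: cinner_minus_left)

lemma cinner_diff_right: "cinner z (x - y) = cinner z x - cinner z (y::'a::complex_inner)"
  using cinner_add_right[of z x "-y"] by (simp add: cinner_minus_right)

lemmas cinner_simps = cinner_add_left cinner_add_right cinner_diff_left cinner_diff_right
  cinner_scaleC_left cinner_scaleC_right cinner_minus_left cinner_minus_right

lemma cinner_self_eq_0: "cinner x x = 0 \<longleftrightarrow> x = (0::'a::complex_inner)"
  by (simp add: cinner_self)

lemma cinner_extensionality:
  assumes "\<And>y. cinner a y = cinner b (y::'a::complex_inner)"
  shows "a = b"
  using assms[of "a - b"] cinner_self_eq_0[of "a - b"] by (simp add: cinner_diff_left)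

lemma cinner_eq_0_sym: "cinner x y = 0 \<longleftrightarrow> cinner y (x::'a::complex_inner) = 0"
  by (metis cinner_commute complex_cnj_zero)

lemma norm_scaleC: "norm (c *\<^sub>C x) = cmod c * norm (x::'a::complex_inner)"
proof -
  have "complex_of_real ((norm (c *\<^sub>C x))\<^sup>2) = complex_of_real ((cmod c * norm x)\<^sup>2)"
    unfolding cinner_self[symmetric] cinner_scaleC_left cinner_scaleC_right
    by (simp add: cinner_self power_mult_distrib complex_norm_square algebra_simps
        flip: complex_norm_square)
  then have "(norm (c *\<^sub>C x))\<^sup>2 = (cmod c * norm x)\<^sup>2"
    using of_real_eq_iff by blast
  then show ?thesis
    by (simp add: power2_eq_iff_nonneg)
qed

lemma continuous_scaleC_right: "continuous_on UNIV (\<lambda>x::'a::complex_inner. c *\<^sub>C x)"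
proof -
  have "bounded_linear (\<lambda>x::'a. c *\<^sub>C x)"
    by (rule bounded_linear_intro[of _ "cmod c"])
      (auto simp: scaleC_add_right norm_scaleC scaleC_scaleC mult.commute simp flip: scaleC_of_real)
  then show ?thesis
    by (simp add: linear_continuous_on)
qed

lemma continuous_cinner_right: "continuous_on UNIV (\<lambda>y::'a::complex_inner. cinner x y)"
  unfolding cinner_eq_Complex complex_eq_iff Complex_eq
  by (intro continuous_intros continuous_scaleC_right)

lemma continuous_cinner_left: "continuous_on UNIV (\<lambda>x::'a::complex_inner. cinner x y)"
  unfolding cinner_eq_Complex complex_eq_iff Complex_eq
  by (intro continuous_intros)

lemma tendsto_cinner_left:
  assumes "(X \<longlongrightarrow> (x::'a::complex_inner)) F" shows "((\<lambda>n. cinner (X n) y) \<longlongrightarrow> cinner x y) F"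
  using continuous_on_tendsto_compose[OF continuous_cinner_left assms] by simp

lemma tendsto_cinner_right:
  assumes "(X \<longlongrightarrow> (x::'a::complex_inner)) F" shows "((\<lambda>n. cinner y (X n)) \<longlongrightarrow> cinner y x) F"
  using continuous_on_tendsto_compose[OF continuous_cinner_right assms] by simp

text \<open>
  The subspace need not be closed; this is why the projection \<open>p\<close> comes with an approximating sequence
  from \<open>M\<close>.  A sequence that minimizes the distance to \<open>a\<close> is Cauchy by the parallelogram law, and
  minimality of its limit forces orthogonality.
\<close>

lemma orthogonal_projection:
  fixes M :: "'a::{real_inner,complete_space} set" and a :: 'a
  assumes M0: "0 \<in> M" and Madd: "\<And>x y. x \<in> M \<Longrightarrow> y \<in> M \<Longrightarrow> x + y \<in> M"
    and Mscale: "\<And>c x. x \<in> M \<Longrightarrow> c *\<^sub>R x \<in> M"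
  obtains X p where "\<And>n. X n \<in> M" "X \<longlonglongrightarrow> p" "\<And>m. m \<in> M \<Longrightarrow> inner (a - p) m = 0"
proof -
  define d where "d = (INF m\<in>M. (norm (a - m))\<^sup>2)"
  have bdd: "bdd_below ((\<lambda>m. (norm (a - m))\<^sup>2) ` M)"
    by (rule bdd_belowI2[of _ 0]) simp
  have dle: "d \<le> (norm (a - m))\<^sup>2" if "m \<in> M" for m
    unfolding d_def by (rule cINF_lower[OF bdd that])
  have "\<exists>m\<in>M. (norm (a - m))\<^sup>2 < d + 1 / real (Suc n)" for n
    using cINF_less_iff[of M "\<lambda>m. (norm (a - m))\<^sup>2" "d + 1 / real (Suc n)"] M0 bdd
    unfolding d_def by fastforce
  then obtain X where XM: "\<And>n. X n \<in> M" and Xd: "\<And>n. (norm (a - X n))\<^sup>2 < d + 1 / real (Suc n)"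
    by metis
  have close: "(norm (X m - X n))\<^sup>2 \<le> 2 / real (Suc m) + 2 / real (Suc n)" for m n
  proof -
    have "(norm (X m - X n))\<^sup>2
        = 2 * (norm (a - X m))\<^sup>2 + 2 * (norm (a - X n))\<^sup>2 - 4 * (norm (a - (1/2) *\<^sub>R (X m + X n)))\<^sup>2"
      by (simp add: power2_norm_eq_inner algebra_simps inner_commute)
    also have "\<dots> \<le> 2 * (d + 1 / real (Suc m)) + 2 * (d + 1 / real (Suc n)) - 4 * d"
    proof -
      have "2 * x + 2 * y - 4 * z \<le> 2 * (d + e) + 2 * (d + e') - 4 * d"
        if "x < d + e" "y < d + e'" "d \<le> z" for x y z e e' :: real
        using that by argo
      from this[OF Xd[of m] Xd[of n] dle[OF Mscale[OF Madd[OF XM[of m] XM[of n]], of "1/2"]]]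
      show ?thesis .
    qed
    finally show ?thesis by (simp add: algebra_simps)
  qed
  have "Cauchy X"
  proof (rule CauchyI)
    fix e :: real assume "0 < e"
    obtain K :: nat where K: "4 / e\<^sup>2 < real K"
      using reals_Archimedean2 by blast
    show "\<exists>K. \<forall>m\<ge>K. \<forall>n\<ge>K. norm (X m - X n) < e"
    proof (intro exI[of _ K] allI impI)
      fix m n assume mn: "K \<le> m" "K \<le> n"
      have "0 < real K" using K \<open>0 < e\<close> by (smt (verit) divide_nonneg_nonneg zero_le_power2)
      then have le: "2 / real (Suc m) \<le> 2 / real K" "2 / real (Suc n) \<le> 2 / real K"
        using mn by (auto intro!: divide_left_mono)
      have "4 / real K < e\<^sup>2"
        using K \<open>0 < e\<close> \<open>0 < real K\<close> by (simp add: field_simps)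
      then have "(norm (X m - X n))\<^sup>2 < e\<^sup>2"
        using close[of m n] le by simp
      then show "norm (X m - X n) < e"
        using \<open>0 < e\<close> by (simp add: power2_less_imp_less)
    qed
  qed
  then obtain p where p: "X \<longlonglongrightarrow> p"
    using Cauchy_convergent convergent_def by blast
  have "(\<lambda>n. (norm (a - X n))\<^sup>2) \<longlonglongrightarrow> (norm (a - p))\<^sup>2"
    by (intro tendsto_intros p)
  moreover have "(\<lambda>n. d + 1 / real (Suc n)) \<longlonglongrightarrow> d + 0"
    by (intro tendsto_intros LIMSEQ_inverse_real_of_nat[unfolded inverse_eq_divide])
  ultimately have pd: "(norm (a - p))\<^sup>2 \<le> d"
    using Xd by (intro LIMSEQ_le[of _ _ "\<lambda>n. d + 1 / real (Suc n)"]) (auto intro: less_imp_le)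
  \<comment> \<open>The quadratic \<open>t \<mapsto> \<parallel>a - p - t m\<parallel>\<^sup>2\<close> is
    smallest at \<open>t = 0\<close>.\<close>
  have "inner (a - p) m = 0" if m: "m \<in> M" for m
  proof -
    have ineq: "2 * t * inner (a - p) m \<le> t\<^sup>2 * (norm m)\<^sup>2" for t
    proof -
      have "(\<lambda>n. (norm (a - (X n + t *\<^sub>R m)))\<^sup>2) \<longlonglongrightarrow> (norm (a - (p + t *\<^sub>R m)))\<^sup>2"
        by (intro tendsto_intros p)
      then have "d \<le> (norm (a - (p + t *\<^sub>R m)))\<^sup>2"
        by (rule LIMSEQ_le_const) (auto intro!: exI[of _ 0] dle Madd Mscale m XM)
      also have "\<dots> = (norm (a - p))\<^sup>2 - 2 * t * inner (a - p) m + t\<^sup>2 * (norm m)\<^sup>2"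
        unfolding power2_norm_eq_inner
        by (simp add: algebra_simps inner_commute power2_eq_square[of t])
      finally show ?thesis using pd by linarith
    qed
    show ?thesis
    proof (cases "m = 0")
      case False
      define t where "t = inner (a - p) m / (norm m)\<^sup>2"
      have "t * (norm m)\<^sup>2 = inner (a - p) m" using False by (simp add: t_def)
      then have "2 * t * (t * (norm m)\<^sup>2) \<le> t\<^sup>2 * (norm m)\<^sup>2"
        using ineq[of t] by simp
      then have "t\<^sup>2 * (norm m)\<^sup>2 \<le> 0" by (simp add: power2_eq_square algebra_simps)
      then have "t = 0" using False by (simp add: mult_le_0_iff)
      then show ?thesis using \<open>t * (norm m)\<^sup>2 = inner (a - p) m\<close> by simp
    qed simp
  qed
  with XM p show ?thesis using that by blast
qed

section \<open>Adjoint pairs and partial isometries\<close>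

text \<open>
  Bounded operators are represented as pairs of everywhere defined functions that are formally
  adjoint to each other.  Linearity of both functions then follows from nondegeneracy of the inner
  product, and adjoints of sums and products can be written down without boundedness estimates.
\<close>

definition adj_pair :: "('a::complex_inner \<Rightarrow> 'b::complex_inner) \<Rightarrow> ('b \<Rightarrow> 'a) \<Rightarrow> bool"
  where "adj_pair A A' \<longleftrightarrow> (\<forall>x y. cinner (A x) y = cinner x (A' y))"

lemma adj_pairD: "adj_pair A A' \<Longrightarrow> cinner (A x) y = cinner x (A' y)"
  by (simp add: adj_pair_def)

lemma adj_pair_swap: "adj_pair A A' \<Longrightarrow> adj_pair A' A"
  unfolding adj_pair_def by (metis cinner_commute)

lemma adj_pair_add: "adj_pair A A' \<Longrightarrow> A (x + y) = A x + A y"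
  by (rule cinner_extensionality) (simp add: adj_pairD cinner_simps)

lemma adj_pair_scale: "adj_pair A A' \<Longrightarrow> A (c *\<^sub>C x) = c *\<^sub>C A x"
  by (rule cinner_extensionality) (simp add: adj_pairD cinner_simps)

lemma adj_pair_diff: "adj_pair A A' \<Longrightarrow> A (x - y) = A x - A y"
  by (rule cinner_extensionality) (simp add: adj_pairD cinner_simps)

lemma adj_pair_zero: "adj_pair A A' \<Longrightarrow> A 0 = 0"
  by (rule cinner_extensionality) (simp add: adj_pairD)

lemma adj_pair_id: "adj_pair (\<lambda>x. x) (\<lambda>x. x)"
  by (simp add: adj_pair_def)

lemma adj_pair_comp: "adj_pair A A' \<Longrightarrow> adj_pair B B' \<Longrightarrow> adj_pair (\<lambda>x. A (B x)) (\<lambda>x. B' (A' x))"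
  by (simp add: adj_pair_def)

lemma adj_pair_plus: "adj_pair A A' \<Longrightarrow> adj_pair B B' \<Longrightarrow> adj_pair (\<lambda>x. A x + B x) (\<lambda>x. A' x + B' x)"
  by (simp add: adj_pair_def cinner_simps)

lemma adj_pair_minus: "adj_pair A A' \<Longrightarrow> adj_pair B B' \<Longrightarrow> adj_pair (\<lambda>x. A x - B x) (\<lambda>x. A' x - B' x)"
  by (simp add: adj_pair_def cinner_simps)

lemma adj_pair_funpow:
  fixes A :: "'a::complex_inner \<Rightarrow> 'a"
  shows "adj_pair A A' \<Longrightarrow> adj_pair (A ^^ n) (A' ^^ n)"
  by (induction n) (simp_all add: adj_pair_def funpow_swap1)

text \<open>
  An equality of operators may be checked on a family \<open>g\<close> and on its orthogonal complement, without
  decomposing vectors.  The reason is that the vector \<open>d\<close> that represents \<open>a \<mapsto> \<langle>A a - B a, y\<rangle>\<close> is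
  orthogonal to the family, hence \<open>A\<close> and \<open>B\<close> agree on \<open>d\<close> itself, which gives \<open>\<langle>d, d\<rangle> = 0\<close>.
\<close>

lemma adj_pair_eqI:
  assumes "adj_pair A A'" "adj_pair B B'"
    and gen: "\<And>i. A (g i) = B (g i)"
    and orth: "\<And>a. (\<And>i. cinner a (g i) = 0) \<Longrightarrow> A a = B a"
  shows "A a = B a"
proof (rule cinner_extensionality)
  fix y
  define d where "d = A' y - B' y"
  have d: "cinner a d = cinner (A a) y - cinner (B a) y" for a
    by (simp add: d_def cinner_simps adj_pairD[OF assms(1)] adj_pairD[OF assms(2)])
  have "cinner (g i) d = 0" for i
    by (simp add: d gen)
  then have "cinner d (g i) = 0" for i
    using cinner_eq_0_sym by blast
  then have "cinner d d = 0"
    using orth[of d] by (simp add: d)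
  then have "d = 0"
    by (simp add: cinner_self_eq_0)
  then show "cinner (A a) y = cinner (B a) y"
    using d[of a] by simp
qed

lemma adj_pair_eqI2:
  assumes "adj_pair A A'" "adj_pair B B'"
    and "\<And>i j. A (g i j) = B (g i j)"
    and "\<And>a. (\<And>i j. cinner a (g i j) = 0) \<Longrightarrow> A a = B a"
  shows "A a = B a"
proof (rule adj_pair_eqI[where g = "\<lambda>p. g (fst p) (snd p)", OF assms(1,2)])
  fix a assume "\<And>p. cinner a (g (fst p) (snd p)) = 0"
  from this[of "(_, _)"] show "A a = B a"
    by (intro assms(4)) simp
qed (rule assms(3))

text \<open>
  Pairs of linear combinations of \<open>x\<close> and of \<open>y\<close> with the same coefficients.  If the two families
  have the same Gram matrix, this relation is the graph of an isometry between the spans; keeping it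
  as a relation avoids the proof that \<open>x i \<mapsto> y i\<close> is well defined.
\<close>

inductive_set matched_span :: "('i \<Rightarrow> 'a::complex_inner) \<Rightarrow> ('i \<Rightarrow> 'b::complex_inner) \<Rightarrow> ('a \<times> 'b) set"
  for x y where
    zero: "(0, 0) \<in> matched_span x y"
  | step: "(a, b) \<in> matched_span x y \<Longrightarrow> (a + c *\<^sub>C x i, b + c *\<^sub>C y i) \<in> matched_span x y"

lemma matched_span_add:
  assumes "(a, b) \<in> matched_span x y" "(a', b') \<in> matched_span x y"
  shows "(a + a', b + b') \<in> matched_span x y"
  using assms(2) by induction (auto simp: assms(1) add.assoc[symmetric] intro: matched_span.step)

lemma matched_span_scale:
  assumes "(a, b) \<in> matched_span x y"
  shows "(c *\<^sub>C a, c *\<^sub>C b) \<in> matched_span x y"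
  using assms
  by induction (auto simp: scaleC_add_right scaleC_scaleC intro: matched_span.intros)

lemma matched_span_gen: "(x i, y i) \<in> matched_span x y"
  using matched_span.step[OF matched_span.zero, where x = x and y = y and c = 1 and i = i] by simp

lemma matched_span_swap: "(a, b) \<in> matched_span x y \<Longrightarrow> (b, a) \<in> matched_span y x"
  by (induction rule: matched_span.induct) (auto intro: matched_span.intros)

lemma matched_span_orthogonal:
  assumes "(a, b) \<in> matched_span x y" "\<And>i. cinner z (x i) = 0"
  shows "cinner z a = 0"
  using assms(1) by induction (auto simp: cinner_simps assms(2))

lemma matched_span_cinner:
  assumes "\<And>i j. cinner (x i) (x j) = cinner (y i) (y j)"
    and "(a, b) \<in> matched_span x y" "(a', b') \<in> matched_span x y"
  shows "cinner a a' = cinner b b'"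
proof -
  have "cinner a (x i) = cinner b (y i)" for i
    using assms(2) by induction (auto simp: cinner_simps assms(1))
  with assms(3) show ?thesis
    by induction (auto simp: cinner_simps)
qed

text \<open>
  The projection of \<open>a\<close> to the closed span of \<open>x\<close>, together with its image \<open>q\<close>: a sequence of
  combinations of \<open>x\<close> that converges to the projection is matched with a Cauchy sequence of
  combinations of \<open>y\<close>.
\<close>

lemma matched_span_projection:
  fixes x :: "'i \<Rightarrow> 'a::chilbert_space" and y :: "'i \<Rightarrow> 'b::chilbert_space"
  assumes eq: "\<And>i j. cinner (x i) (x j) = cinner (y i) (y j)"
  shows "\<exists>X Y p q. (\<forall>n::nat. (X n, Y n) \<in> matched_span x y) \<and> X \<longlonglongrightarrow> p \<and> Y \<longlonglongrightarrow> q \<and>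
    (\<forall>i. cinner (a - p) (x i) = 0)"
proof -
  let ?R = "matched_span x y"
  have scale: "c *\<^sub>C u \<in> Domain ?R" if "u \<in> Domain ?R" for u c
    using that matched_span_scale by blast
  have "c *\<^sub>R u \<in> Domain ?R" if "u \<in> Domain ?R" for u c
    using scale[OF that, of "complex_of_real c"] by (simp add: scaleC_of_real)
  moreover have "u + v \<in> Domain ?R" if "u \<in> Domain ?R" "v \<in> Domain ?R" for u v
    using that matched_span_add by blast
  moreover have "0 \<in> Domain ?R"
    using matched_span.zero by blast
  ultimately obtain X p where X: "\<And>n. X n \<in> Domain ?R" "X \<longlonglongrightarrow> p"
    and orth: "\<And>m. m \<in> Domain ?R \<Longrightarrow> inner (a - p) m = 0"
    using orthogonal_projection[of "Domain ?R" a] by metis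
  obtain Y where XY: "\<And>n. (X n, Y n) \<in> ?R"
    using X(1) by (auto simp: Domain_iff) metis
  have "norm (Y m - Y n) = norm (X m - X n)" for m n
  proof -
    have "(X m - X n, Y m - Y n) \<in> ?R"
      using matched_span_add[OF XY[of m] matched_span_scale[OF XY[of n], of "-1"]]
      by (simp add: scaleC_minus1)
    then have "cinner (X m - X n) (X m - X n) = cinner (Y m - Y n) (Y m - Y n)"
      by (intro matched_span_cinner[OF eq])
    then show ?thesis
      unfolding cinner_self of_real_eq_iff by (simp add: power2_eq_iff_nonneg)
  qed
  then have "Cauchy Y"
    using LIMSEQ_imp_Cauchy[OF X(2)] by (simp add: Cauchy_iff)
  then obtain q where "Y \<longlonglongrightarrow> q"
    using Cauchy_convergent convergent_def by blast
  moreover have "cinner (a - p) (x i) = 0" for i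
  proof -
    have "x i \<in> Domain ?R"
      using matched_span_gen[of x i y] by blast
    then show ?thesis
      by (simp add: cinner_eq_Complex orth scale complex_eq_iff)
  qed
  ultimately show ?thesis
    using XY X(2) by blast
qed

text \<open>
  \<open>W\<close> projects to the closed span of \<open>x\<close> and then follows the closure \<open>R\<close> of the matched span; \<open>W'\<close> does
  the same in the opposite direction.  They are adjoint because related pairs have equal inner products.
\<close>

theorem partial_isometry_exists:
  fixes x :: "'i \<Rightarrow> 'a::chilbert_space" and y :: "'i \<Rightarrow> 'b::chilbert_space"
  assumes eq: "\<And>i j. cinner (x i) (x j) = cinner (y i) (y j)"
  shows "\<exists>W W'. adj_pair W W' \<and> (\<forall>i. W (x i) = y i) \<and> (\<forall>i. W' (y i) = x i) \<and>
    (\<forall>a. (\<forall>i. cinner a (x i) = 0) \<longrightarrow> W a = 0) \<and> (\<forall>b. (\<forall>i. cinner b (y i) = 0) \<longrightarrow> W' b = 0)"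
proof -
  define R where "R = {(p, q). \<exists>X Y. (\<forall>n::nat. (X n, Y n) \<in> matched_span x y) \<and> X \<longlonglongrightarrow> p \<and> Y \<longlonglongrightarrow> q}"
  have lim: "cinner p p' = cinner q q'" if "(p, q) \<in> R" "(p', q') \<in> R" for p q p' q'
  proof -
    from that obtain X Y X' Y' where *: "\<And>n::nat. (X n, Y n) \<in> matched_span x y" "X \<longlonglongrightarrow> p" "Y \<longlonglongrightarrow> q"
      "\<And>n::nat. (X' n, Y' n) \<in> matched_span x y" "X' \<longlonglongrightarrow> p'" "Y' \<longlonglongrightarrow> q'"
      unfolding R_def by blast
    have c: "cinner (X m) (X' n) = cinner (Y m) (Y' n)" for m n
      by (rule matched_span_cinner[OF eq *(1) *(4)])
    have "cinner (X m) p' = cinner (Y m) q'" for m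
      using LIMSEQ_unique[OF tendsto_cinner_right[OF *(5), of "X m"]] tendsto_cinner_right[OF *(6), of "Y m"]
      by (simp add: c)
    then show ?thesis
      using LIMSEQ_unique[OF tendsto_cinner_left[OF *(2), of p']] tendsto_cinner_left[OF *(3), of q']
      by simp
  qed
  have genR: "(x i, y i) \<in> R" for i
    unfolding R_def by (auto intro!: exI[of _ "\<lambda>_. x i"] exI[of _ "\<lambda>_. y i"] matched_span_gen)
  have orthx: "cinner z p = 0" if "(p, q) \<in> R" "\<And>i. cinner z (x i) = 0" for z p q
  proof -
    obtain X Y where *: "\<And>n::nat. (X n, Y n) \<in> matched_span x y" "X \<longlonglongrightarrow> p"
      using \<open>(p, q) \<in> R\<close> unfolding R_def by blast
    have "cinner z (X n) = 0" for n
      using matched_span_orthogonal[OF *(1)] that(2) by blast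
    then show ?thesis
      using LIMSEQ_unique[OF tendsto_cinner_right[OF *(2), of z]] by auto
  qed
  have orthy: "cinner z q = 0" if "(p, q) \<in> R" "\<And>i. cinner z (y i) = 0" for z p q
  proof -
    obtain X Y where *: "\<And>n::nat. (X n, Y n) \<in> matched_span x y" "Y \<longlonglongrightarrow> q"
      using \<open>(p, q) \<in> R\<close> unfolding R_def by blast
    have "cinner z (Y n) = 0" for n
      using matched_span_orthogonal[OF matched_span_swap[OF *(1)]] that(2) by blast
    then show ?thesis
      using LIMSEQ_unique[OF tendsto_cinner_right[OF *(2), of z]] by auto
  qed
  have "\<exists>p q. (p, q) \<in> R \<and> (\<forall>i. cinner (a - p) (x i) = 0)" for a
    using matched_span_projection[of x y a] eq unfolding R_def by blast
  then obtain P W where PW: "\<And>a. (P a, W a) \<in> R" "\<And>a i. cinner (a - P a) (x i) = 0"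
    by metis
  have "\<exists>p q. (p, q) \<in> R \<and> (\<forall>i. cinner (b - q) (y i) = 0)" for b
  proof -
    obtain X Y p q where *: "\<And>n::nat. (X n, Y n) \<in> matched_span y x" "X \<longlonglongrightarrow> p" "Y \<longlonglongrightarrow> q"
      "\<And>i. cinner (b - p) (y i) = 0"
      using matched_span_projection[of y x b] eq by auto
    then have "(q, p) \<in> R"
      unfolding R_def using matched_span_swap by blast
    with * show ?thesis by blast
  qed
  then obtain W' Q where QW: "\<And>b. (W' b, Q b) \<in> R" "\<And>b i. cinner (b - Q b) (y i) = 0"
    by metis
  have adj: "cinner (W a) c = cinner a (W' c)" for a c
  proof -
    have "cinner (c - Q c) (W a) = 0" "cinner (a - P a) (W' c) = 0"
      using orthy[OF PW(1)] orthx[OF QW(1)] PW(2) QW(2) by blast+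
    then have "cinner c (W a) = cinner (Q c) (W a)" "cinner a (W' c) = cinner (P a) (W' c)"
      by (simp_all add: cinner_simps)
    then show ?thesis
      using lim[OF PW(1) QW(1), of a c] by (metis cinner_commute)
  qed
  have orthc: "cinner (y i) c = cinner (y i) (Q c)" "cinner (x i) a = cinner (x i) (P a)" for i a c
    using QW(2)[of c i] PW(2)[of a i] by (metis cinner_commute cinner_diff_left eq_iff_diff_eq_0)+
  show ?thesis
  proof (intro exI[of _ W] exI[of _ W'] conjI allI impI)
    show "adj_pair W W'"
      by (simp add: adj_pair_def adj)
    show "W (x i) = y i" for i
    proof (rule cinner_extensionality)
      fix c
      show "cinner (W (x i)) c = cinner (y i) c"
        unfolding adj lim[OF genR QW(1)] by (rule orthc(1)[symmetric])
    qed
    show "W' (y i) = x i" for i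
    proof (rule cinner_extensionality)
      fix a
      have "cinner (W' (y i)) a = cinner (y i) (W a)"
        using adj_pairD[OF adj_pair_swap, of W W'] adj by (simp add: adj_pair_def)
      also have "\<dots> = cinner (x i) a"
        unfolding lim[OF genR PW(1), symmetric] by (rule orthc(2)[symmetric])
      finally show "cinner (W' (y i)) a = cinner (x i) a" .
    qed
    show "W a = 0" if "\<forall>i. cinner a (x i) = 0" for a
      by (rule cinner_extensionality) (simp add: adj orthx[OF QW(1) that[rule_format]])
    show "W' b = 0" if "\<forall>i. cinner b (y i) = 0" for b
    proof (rule cinner_extensionality)
      fix a
      have "cinner (W' b) a = cinner b (W a)"
        using adj_pairD[OF adj_pair_swap, of W W'] adj by (simp add: adj_pair_def)
      then show "cinner (W' b) a = cinner 0 a"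
        by (simp add: orthy[OF PW(1) that[rule_format]])
    qed
  qed
qed

section \<open>Normal operators as quotients of bounded operators\<close>

lemma closed_adjoint_op: "closed (adjoint_op A)"
proof -
  have "adjoint_op A = (\<Inter>p\<in>A. {q. cinner (snd p) (fst q) = cinner (fst p) (snd q)})"
    by (fastforce simp: adjoint_op_def)
  moreover have "continuous_on UNIV (\<lambda>q::'a \<times> 'a. cinner x (fst q))"
    "continuous_on UNIV (\<lambda>q::'a \<times> 'a. cinner x (snd q))" for x :: 'a
    by (auto intro!: continuous_on_compose2[OF continuous_cinner_right] continuous_intros)
  ultimately show ?thesis
    by (auto intro!: closed_INT closed_Collect_eq)
qed

text \<open>
  The orthogonal complement of the range of a self-adjoint \<open>B\<close> is the kernel of \<open>B\<close>.
\<close>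

lemma dense_range_if_injective:
  fixes B :: "'a::chilbert_space \<Rightarrow> 'a"
  assumes B: "adj_pair B B" and inj: "\<And>a. B a = 0 \<Longrightarrow> a = 0"
  shows "closure (range B) = UNIV"
proof -
  have "a \<in> closure (range B)" for a
  proof -
    have "c *\<^sub>R B x = B (c *\<^sub>R x)" for c x
      using adj_pair_scale[OF B, of "complex_of_real c" x] by (simp add: scaleC_of_real)
    then have "c *\<^sub>R x \<in> range B" if "x \<in> range B" for c x
      using that by auto
    moreover have "x + y \<in> range B" if "x \<in> range B" "y \<in> range B" for x y
      using that by (auto simp: adj_pair_add[OF B, symmetric])
    moreover have "0 \<in> range B"
      using adj_pair_zero[OF B] by (metis rangeI)
    ultimately obtain X p where X: "\<And>n. X n \<in> range B" "X \<longlonglongrightarrow> p"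
      and orth: "\<And>m. m \<in> range B \<Longrightarrow> inner (a - p) m = 0"
      using orthogonal_projection[of "range B" a] by metis
    have "inner (B (a - p)) z = 0" for z
      using orth[of "B z"] by (simp add: inner_eq_Re_cinner adj_pairD[OF B])
    from this[of "B (a - p)"] have "a = p"
      using inj[of "a - p"] by simp
    then show ?thesis
      using X closure_sequential by blast
  qed
  then show ?thesis by blast
qed

lemma adj_pair_commute:
  assumes "adj_pair B B" "adj_pair T T'" "\<And>a. T (B a) = B (T a)"
  shows "T' (B a) = B (T' a)"
  by (rule cinner_extensionality)
    (simp add: adj_pairD[OF adj_pair_swap[OF assms(2)]] adj_pairD[OF assms(1)] assms(3))

text \<open>
  The graph of \<open>T B\<^sup>-\<^sup>1\<close> has an implicit and a parametric form.  They agree because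
  \<open>T\<^sup>* T + B\<^sup>2 = 1\<close>: if \<open>T f = B g\<close>, then \<open>y = B f + T\<^sup>* g\<close> is the parameter.
\<close>

lemma quotient_graph_iff:
  assumes B: "adj_pair B B" and T: "adj_pair T T'"
    and normal: "\<And>a. T (T' a) = T' (T a)"
    and TB: "\<And>a. T (B a) = B (T a)" and sum: "\<And>a. T' (T a) + B (B a) = a"
  shows "T f = B g \<longleftrightarrow> (\<exists>y. f = B y \<and> g = T y)"
proof
  assume fg: "T f = B g"
  note T'B = adj_pair_commute[OF B T TB]
  have "B (B f + T' g) = T' (T f) + B (B f)"
    by (simp add: adj_pair_add[OF B] fg T'B add.commute)
  moreover have "T (B f + T' g) = T' (T g) + B (B g)"
    by (simp add: adj_pair_add[OF T] TB fg normal add.commute)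
  ultimately show "\<exists>y. f = B y \<and> g = T y"
    unfolding sum by metis
qed (auto simp: TB)

text \<open>
  The parametric form of the graph turns the defining condition of the adjoint into
  \<open>\<langle>T y, g\<rangle> = \<langle>B y, g'\<rangle>\<close> for all \<open>y\<close>, which is the implicit form for \<open>T\<^sup>*\<close>.
\<close>

lemma adjoint_quotient_graph:
  assumes B: "adj_pair B B" and T: "adj_pair T T'"
    and normal: "\<And>a. T (T' a) = T' (T a)"
    and TB: "\<And>a. T (B a) = B (T a)" and sum: "\<And>a. T' (T a) + B (B a) = a"
  shows "adjoint_op {(f, g). T f = B g} = {(f, g). T' f = B g}"
proof (rule set_eqI, clarify)
  fix g g'
  have "(g, g') \<in> adjoint_op {(f, g). T f = B g} \<longleftrightarrow> (\<forall>y. cinner (T y) g = cinner (B y) g')"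
    unfolding adjoint_op_def quotient_graph_iff[OF assms] by fastforce
  also have "\<dots> \<longleftrightarrow> (\<forall>y. cinner y (T' g) = cinner y (B g'))"
    by (simp add: adj_pairD[OF T] adj_pairD[OF B])
  also have "\<dots> \<longleftrightarrow> T' g = B g'"
    by (metis cinner_commute cinner_extensionality)
  finally show "(g, g') \<in> adjoint_op {(f, g). T f = B g} \<longleftrightarrow> (g, g') \<in> {(f, g). T' f = B g}"
    by simp
qed

text \<open>
  The product of the quotients of \<open>T\<close> and \<open>T\<^sup>*\<close> has graph \<open>{(B\<^sup>2 k, T T\<^sup>* k)}\<close>.  This set is symmetric in
  \<open>T\<close> and \<open>T\<^sup>*\<close>, so the two quotients commute.
\<close>

lemma quotient_graph_relcomp:
  assumes B: "adj_pair B B" and T: "adj_pair T T'"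
    and normal: "\<And>a. T (T' a) = T' (T a)"
    and TB: "\<And>a. T (B a) = B (T a)" and sum: "\<And>a. T' (T a) + B (B a) = a"
    and inj: "\<And>a. B a = 0 \<Longrightarrow> a = 0"
  shows "(f, h) \<in> {(f, g). T f = B g} O {(f, g). T' f = B g} \<longleftrightarrow> (\<exists>k. f = B (B k) \<and> h = T (T' k))"
proof
  note T' = adj_pair_swap[OF T] and T'B = adj_pair_commute[OF B T TB]
  assume "(f, h) \<in> {(f, g). T f = B g} O {(f, g). T' f = B g}"
  then obtain g where "T f = B g" "T' g = B h" by blast
  then have "\<exists>y. f = B y \<and> g = T y" "\<exists>z. g = B z \<and> h = T' z"
    unfolding quotient_graph_iff[OF assms(1-5)]
      quotient_graph_iff[OF B T' normal[symmetric] T'B sum[unfolded normal[symmetric]]] .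
  then obtain y z where yz: "f = B y" "T y = B z" "h = T' z" by metis
  \<comment> \<open>If \<open>f = B\<^sup>2 k\<close> and \<open>h = T T\<^sup>* k\<close>, then \<open>y = B
    k\<close> and \<open>z = T k\<close>, hence \<open>T\<^sup>* z + B y = k\<close>.\<close>
  define k where "k = T' z + B y"
  have k: "B k = y"
    unfolding k_def adj_pair_add[OF B] T'B[symmetric] using sum[of y] yz by simp
  have "B (T k - z) = 0"
    by (simp add: adj_pair_diff[OF B] k yz(2) flip: TB)
  then have "T k = z"
    using inj by force
  then show "\<exists>k. f = B (B k) \<and> h = T (T' k)"
    by (intro exI[of _ k]) (simp add: k yz normal)
next
  assume "\<exists>k. f = B (B k) \<and> h = T (T' k)"
  then obtain k where "f = B (B k)" "h = T' (T k)" using normal by auto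
  moreover have "T (B (B k)) = B (T (B k))" "T' (T (B k)) = B (T' (T k))"
    by (simp_all add: TB adj_pair_commute[OF B T TB])
  ultimately show "(f, h) \<in> {(f, g). T f = B g} O {(f, g). T' f = B g}" by blast
qed

text \<open>
  The quotient \<open>T B\<^sup>-\<^sup>1\<close> of commuting bounded operators, \<open>T\<close> normal and \<open>B\<close> self-adjoint and injective.
  The normalization \<open>T\<^sup>* T + B\<^sup>2 = 1\<close> means that \<open>y \<mapsto> (B y, T y)\<close> is an isometric parametrization of the graph.
\<close>

theorem normal_operator_quotient:
  fixes B T T' :: "'a::chilbert_space \<Rightarrow> 'a"
  assumes B: "adj_pair B B" and T: "adj_pair T T'"
    and normal: "\<And>a. T (T' a) = T' (T a)"
    and TB: "\<And>a. T (B a) = B (T a)" and sum: "\<And>a. T' (T a) + B (B a) = a"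
    and inj: "\<And>a. B a = 0 \<Longrightarrow> a = 0"
  shows "normal_operator {(f, g). T f = B g}"
proof -
  define N where "N = {(f, g). T f = B g}"
  define N' where "N' = {(f, g). T' f = B g}"
  note T' = adj_pair_swap[OF T] and T'B = adj_pair_commute[OF B T TB]
    and sum' = sum[unfolded normal[symmetric]]
  have adj: "adjoint_op N = N'" "adjoint_op N' = N"
    unfolding N_def N'_def
    using adjoint_quotient_graph[OF B T normal TB sum]
      adjoint_quotient_graph[OF B T' normal[symmetric] T'B sum'] by blast+
  have "Domain N = range B"
    unfolding N_def Domain_unfold using quotient_graph_iff[OF B T normal TB sum] by auto
  then have "densely_defined N"
    by (simp add: densely_defined_def dense_range_if_injective[OF B inj])
  moreover have "a = b" if "B a = B b" for a b
    using inj[of "a - b"] that by (simp add: adj_pair_diff[OF B])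
  then have "linear_operator N"
    unfolding linear_operator_def N_def
    by (auto simp: single_valued_def adj_pair_add[OF B] adj_pair_add[OF T] adj_pair_scale[OF B]
        adj_pair_scale[OF T] adj_pair_zero[OF B] adj_pair_zero[OF T])
  moreover have "p \<in> N O N' \<longleftrightarrow> p \<in> N' O N" for p
    unfolding N_def N'_def
    using quotient_graph_relcomp[OF B T normal TB sum inj, of "fst p" "snd p"]
      quotient_graph_relcomp[OF B T' normal[symmetric] T'B sum' inj, of "fst p" "snd p"]
    by (simp add: normal)
  then have "N O adjoint_op N = adjoint_op N O N"
    unfolding adj by blast
  ultimately show ?thesis
    using closed_adjoint_op[of N'] unfolding normal_operator_def adj N_def by blast
qed

section \<open>Vectors with a prescribed Gram matrix\<close>

definition pos_kernel :: "('i \<Rightarrow> 'i \<Rightarrow> complex) \<Rightarrow> bool"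
  where "pos_kernel K \<longleftrightarrow> (\<forall>i j. K j i = cnj (K i j)) \<and>
    (\<forall>F c. finite F \<longrightarrow> 0 \<le> Re (\<Sum>i\<in>F. \<Sum>j\<in>F. c i * cnj (c j) * K i j))"

text \<open>
  One step of symmetric Gaussian elimination, with pivot \<open>k\<close>.  If \<open>K k k = 0\<close>, the column \<open>k\<close> of a
  positive kernel vanishes (\<open>pos_kernel_null_column\<close>), and the convention \<open>x / 0 = 0\<close> makes the step
  the identity, as it should be.
\<close>

definition schur :: "'i \<Rightarrow> ('i \<Rightarrow> 'i \<Rightarrow> complex) \<Rightarrow> 'i \<Rightarrow> 'i \<Rightarrow> complex"
  where "schur k K i j = K i j - K i k * K k j / K k k"

lemma pos_kernel_hermitian: "pos_kernel K \<Longrightarrow> K j i = cnj (K i j)"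
  unfolding pos_kernel_def by blast

lemma pos_kernel_form_nonneg:
  "pos_kernel K \<Longrightarrow> finite F \<Longrightarrow> 0 \<le> Re (\<Sum>i\<in>F. \<Sum>j\<in>F. c i * cnj (c j) * K i j)"
  unfolding pos_kernel_def by blast

lemma pos_kernel_diag:
  assumes "pos_kernel K" shows "K i i = of_real (Re (K i i))" "0 \<le> Re (K i i)"
proof -
  have "K i i = cnj (K i i)" using pos_kernel_hermitian[OF assms] by blast
  then show "K i i = of_real (Re (K i i))"
    by (simp add: complex_eq_iff)
  show "0 \<le> Re (K i i)"
    using pos_kernel_form_nonneg[OF assms, of "{i}" "\<lambda>_. 1"] by simp
qed

text \<open>
  The value of the form at the coefficients \<open>c + e \<delta>\<^sub>k\<close>.  The index \<open>k\<close> may or may not belong to \<open>F\<close>;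
  this is the only place where that distinction has to be made.
\<close>

lemma pos_kernel_shift_form:
  fixes c :: "'i \<Rightarrow> complex" and k :: 'i
  assumes K: "pos_kernel K" and F: "finite F"
  defines "s \<equiv> \<Sum>i\<in>F. c i * K i k"
  shows "0 \<le> Re ((\<Sum>i\<in>F. \<Sum>j\<in>F. c i * cnj (c j) * K i j) + cnj e * s + e * cnj s + e * cnj e * K k k)"
proof -
  define G where "G = insert k F"
  define d where "d i = (if i \<in> F then c i else 0)" for i
  have G: "finite G" "k \<in> G" "F \<subseteq> G" using F by (auto simp: G_def)
  have restr: "(\<Sum>i\<in>G. d i * h i) = (\<Sum>i\<in>F. c i * h i)" for h :: "'i \<Rightarrow> complex"
    using G by (intro sum.mono_neutral_cong_right) (auto simp: d_def)
  have restr': "(\<Sum>i\<in>G. cnj (d i) * h i) = (\<Sum>i\<in>F. cnj (c i) * h i)" for h :: "'i \<Rightarrow> complex"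
    using G by (intro sum.mono_neutral_cong_right) (auto simp: d_def)
  have delta: "(\<Sum>i\<in>G. (if i = k then e else 0) * h i) = e * h k"
    "(\<Sum>i\<in>G. cnj (if i = k then e else 0) * h i) = cnj e * h k" for h :: "'i \<Rightarrow> complex"
    using G by (simp_all add: if_distrib[of "\<lambda>x. x * _"] if_distrib[of cnj] cong: if_cong)
  have "0 \<le> Re (\<Sum>i\<in>G. \<Sum>j\<in>G. (d i + (if i = k then e else 0)) * cnj (d j + (if j = k then e else 0)) * K i j)"
    by (rule pos_kernel_form_nonneg[OF K G(1)])
  also have "(\<Sum>i\<in>G. \<Sum>j\<in>G. (d i + (if i = k then e else 0)) * cnj (d j + (if j = k then e else 0)) * K i j)
    = (\<Sum>i\<in>G. (d i + (if i = k then e else 0)) * ((\<Sum>j\<in>F. cnj (c j) * K i j) + cnj e * K i k))"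
  proof (intro sum.cong refl)
    fix i
    let ?x = "d i + (if i = k then e else 0)"
    have "(\<Sum>j\<in>G. ?x * cnj (d j + (if j = k then e else 0)) * K i j)
      = ?x * ((\<Sum>j\<in>G. cnj (d j) * K i j) + (\<Sum>j\<in>G. cnj (if j = k then e else 0) * K i j))"
      unfolding sum.distrib[symmetric] sum_distrib_left complex_cnj_add
      by (intro sum.cong refl) (simp only: distrib_right distrib_left mult.assoc)
    then show "(\<Sum>j\<in>G. ?x * cnj (d j + (if j = k then e else 0)) * K i j)
      = ?x * ((\<Sum>j\<in>F. cnj (c j) * K i j) + cnj e * K i k)"
      by (simp only: restr' delta)
  qed
  also have "\<dots> = (\<Sum>i\<in>F. c i * ((\<Sum>j\<in>F. cnj (c j) * K i j) + cnj e * K i k))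
      + e * ((\<Sum>j\<in>F. cnj (c j) * K k j) + cnj e * K k k)"
    by (simp only: distrib_right sum.distrib restr delta)
  also have "(\<Sum>i\<in>F. c i * ((\<Sum>j\<in>F. cnj (c j) * K i j) + cnj e * K i k))
      = (\<Sum>i\<in>F. \<Sum>j\<in>F. c i * cnj (c j) * K i j) + cnj e * s"
    by (simp add: s_def distrib_left sum.distrib sum_distrib_left mult_ac)
  also have "(\<Sum>j\<in>F. cnj (c j) * K k j) = cnj s"
    unfolding s_def cnj_sum by (intro sum.cong refl) (simp flip: pos_kernel_hermitian[OF K])
  finally show ?thesis by (simp add: algebra_simps)
qed

lemma pos_kernel_null_column:
  assumes K: "pos_kernel K" and "K k k = 0"
  shows "K i k = 0"
proof (rule ccontr)
  assume ne: "K i k \<noteq> 0"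
  define r where "r = Re (K i i)"
  \<comment> \<open>With this \<open>e\<close> the form at \<open>\<delta>\<^sub>i + e
    \<delta>\<^sub>k\<close> has the value \<open>r - 2 (r + 1) < 0\<close>.\<close>
  define e where "e = - (of_real ((r + 1) / (cmod (K i k))\<^sup>2)) * K i k"
  have *: "cnj e * K i k = - of_real (r + 1)"
    using ne by (simp add: e_def field_simps complex_norm_square del: of_real_power flip: of_real_power)
  have "e * cnj (K i k) = - of_real (r + 1)"
    using arg_cong[OF *, of cnj] by simp
  then show False
    using pos_kernel_shift_form[OF K, where F = "{i}" and c = "\<lambda>_. 1" and k = k and e = e] * pos_kernel_diag(2)[OF K, of i] assms(2)
    by (simp add: r_def)
qed

text \<open>
  The form of the Schur complement at \<open>c\<close> is the form of \<open>K\<close> at \<open>c + e \<delta>\<^sub>k\<close>, where \<open>e = - s / K k k\<close> is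
  the minimizer.
\<close>

lemma pos_kernel_schur:
  assumes K: "pos_kernel K" shows "pos_kernel (schur k K)"
  unfolding pos_kernel_def
proof (intro conjI allI impI)
  fix i j
  show "schur k K j i = cnj (schur k K i j)"
    unfolding schur_def by (simp add: mult.commute flip: pos_kernel_hermitian[OF K])
next
  fix F :: "'a set" and c :: "'a \<Rightarrow> complex"
  assume F: "finite F"
  define s where "s = (\<Sum>i\<in>F. c i * K i k)"
  define d where "d = Re (K k k)"
  have d: "K k k = of_real d" using pos_kernel_diag(1)[OF K] by (simp add: d_def)
  have s': "(\<Sum>j\<in>F. cnj (c j) * K k j) = cnj s"
    unfolding s_def cnj_sum by (intro sum.cong refl) (simp flip: pos_kernel_hermitian[OF K])
  have "s * cnj s = (\<Sum>i\<in>F. \<Sum>j\<in>F. c i * K i k * (cnj (c j) * K k j))"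
    using sum_product[of "\<lambda>i. c i * K i k" F "\<lambda>j. cnj (c j) * K k j" F] by (simp add: s' flip: s_def)
  then have "(\<Sum>i\<in>F. \<Sum>j\<in>F. c i * cnj (c j) * schur k K i j)
      = (\<Sum>i\<in>F. \<Sum>j\<in>F. c i * cnj (c j) * K i j) - s * cnj s / K k k"
    by (simp add: schur_def right_diff_distrib sum_subtractf sum_divide_distrib mult_ac)
  moreover have "0 \<le> Re ((\<Sum>i\<in>F. \<Sum>j\<in>F. c i * cnj (c j) * K i j) - s * cnj s / K k k)"
  proof (cases "K k k = 0")
    case True
    then show ?thesis using pos_kernel_form_nonneg[OF K F] by simp
  next
    case False
    then have "d \<noteq> 0" using d by auto
    have "cnj (- s / K k k) * s + (- s / K k k) * cnj s + (- s / K k k) * cnj (- s / K k k) * K k k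
      = - (s * cnj s / K k k)"
      using \<open>d \<noteq> 0\<close> by (simp add: d field_simps)
    then show ?thesis
      using pos_kernel_shift_form[OF K F, where c = c and k = k and e = "- s / K k k"] unfolding s_def[symmetric]
      by (simp add: add.assoc)
  qed
  ultimately show "0 \<le> Re (\<Sum>i\<in>F. \<Sum>j\<in>F. c i * cnj (c j) * schur k K i j)" by simp
qed

lemma schur_null: "pos_kernel K \<Longrightarrow> schur k K i k = 0" "pos_kernel K \<Longrightarrow> schur k K k j = 0"
  using pos_kernel_null_column[of K k i] pos_kernel_null_column[of K k j] pos_kernel_hermitian[of K k j]
  by (cases "K k k = 0"; simp add: schur_def)+

primrec residual :: "(nat \<Rightarrow> nat \<Rightarrow> complex) \<Rightarrow> nat \<Rightarrow> nat \<Rightarrow> nat \<Rightarrow> complex"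
  where "residual K 0 = K"
  | "residual K (Suc n) = schur n (residual K n)"

lemma pos_kernel_residual: "pos_kernel K \<Longrightarrow> pos_kernel (residual K n)"
  by (induction n) (simp_all add: pos_kernel_schur)

lemma residual_null:
  assumes "pos_kernel K" shows "i < n \<or> j < n \<Longrightarrow> residual K n i j = 0"
proof (induction n arbitrary: i j)
  case (Suc n)
  show ?case
  proof (cases "i = n \<or> j = n")
    case True
    then show ?thesis using schur_null[OF pos_kernel_residual[OF assms, of n]] by auto
  next
    case False
    then have "i < n \<or> j < n" using Suc.prems by auto
    then show ?thesis using Suc.IH[of i j] Suc.IH[of i n] Suc.IH[of n j] by (auto simp: schur_def)
  qed
qed simp

text \<open>
  The entry of the triangular factor in row \<open>i\<close> and column \<open>k\<close>.  A vanishing pivot gives the column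
  \<open>0\<close>, again by \<open>x / 0 = 0\<close>.
\<close>

definition cholesky :: "(nat \<Rightarrow> nat \<Rightarrow> complex) \<Rightarrow> nat \<Rightarrow> nat \<Rightarrow> complex"
  where "cholesky K i k = residual K k i k / of_real (sqrt (Re (residual K k k k)))"

lemma cholesky_upper: "pos_kernel K \<Longrightarrow> i < k \<Longrightarrow> cholesky K i k = 0"
  by (simp add: cholesky_def residual_null)

lemma cholesky_support: "pos_kernel K \<Longrightarrow> cholesky K i k \<noteq> 0 \<Longrightarrow> k \<le> i"
  using cholesky_upper by (metis not_le)

lemma cholesky_partial:
  assumes "pos_kernel K"
  shows "K i j = (\<Sum>k<n. cholesky K i k * cnj (cholesky K j k)) + residual K n i j"
proof (induction n)
  case (Suc n)
  have R: "pos_kernel (residual K n)" by (rule pos_kernel_residual[OF assms])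
  have d: "residual K n n n = of_real (Re (residual K n n n))" "0 \<le> Re (residual K n n n)"
    using pos_kernel_diag[OF R] by auto
  have "cholesky K i n * cnj (cholesky K j n) = residual K n i n * residual K n n j / residual K n n n"
  proof -
    have "of_real (sqrt (Re (residual K n n n))) * of_real (sqrt (Re (residual K n n n))) = residual K n n n"
      using d by (metis of_real_mult real_sqrt_mult_self abs_of_nonneg)
    moreover have "cnj (residual K n j n) = residual K n n j"
      by (rule pos_kernel_hermitian[OF R, symmetric])
    ultimately show ?thesis
      by (simp add: cholesky_def)
  qed
  then show ?case using Suc by (simp add: schur_def)
qed simp

lemma cholesky_factorization:
  assumes "pos_kernel K" "i < n"
  shows "(\<Sum>k<n. cholesky K i k * cnj (cholesky K j k)) = K i j"
  using cholesky_partial[OF assms(1), of i j n] residual_null[OF assms(1)] assms(2) by simp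

lemma infsum_supported:
  fixes f :: "'a \<Rightarrow> 'b::{comm_monoid_add,t2_space}"
  assumes "finite F" "\<And>x. x \<in> A - F \<Longrightarrow> f x = 0" "F \<subseteq> A"
  shows "infsum f A = sum f F"
proof -
  have "infsum f A = infsum f F"
    by (rule infsum_cong_neutral) (use assms in auto)
  then show ?thesis using assms by simp
qed

lemma finite_support_square_summable:
  fixes f :: "'a \<Rightarrow> complex"
  assumes "finite F" "\<And>x. x \<notin> F \<Longrightarrow> f x = 0"
  shows "(\<lambda>v. (cmod (f v))\<^sup>2) summable_on UNIV"
proof -
  have "(\<lambda>v. (cmod (f v))\<^sup>2) summable_on UNIV \<longleftrightarrow> (\<lambda>v. (cmod (f v))\<^sup>2) summable_on F"
    by (rule summable_on_cong_neutral) (use assms in auto)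
  then show ?thesis using assms by simp
qed

text \<open>
  The \<open>n\<close>-th row of the factor, placed in the fibre of the vertex \<open>u\<close>.  Rows of a lower
  triangular matrix are finite, so square summability is automatic, although the kernel is infinite.
\<close>

definition gram_vec :: "('v \<Rightarrow> nat \<Rightarrow> nat \<Rightarrow> complex) \<Rightarrow> 'v \<Rightarrow> nat \<Rightarrow> ('v \<times> nat) ell2"
  where "gram_vec K u n = Abs_ell2 (\<lambda>(v, k). if v = u then cholesky (K u) n k else 0)"

lemma gram_vec_fun:
  assumes "\<And>u. pos_kernel (K u)"
  shows "ell2_fun (gram_vec K u n) (v, k) = (if v = u then cholesky (K u) n k else 0)"
proof -
  have "(\<lambda>x. (cmod ((\<lambda>(v, k). if v = u then cholesky (K u) n k else 0) x))\<^sup>2) summable_on UNIV"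
    by (rule finite_support_square_summable[of "{u} \<times> {..n}"])
      (auto split: if_splits dest: cholesky_support[OF assms])
  then show ?thesis
    unfolding gram_vec_def by (subst Abs_ell2_inverse) auto
qed

lemma gram_vec_cinner:
  assumes "\<And>u. pos_kernel (K u)"
  shows "cinner (gram_vec K u m) (gram_vec K v n) = (if u = v then K u m n else 0)"
proof -
  have "cinner (gram_vec K u m) (gram_vec K v n)
    = (\<Sum>p\<in>{u} \<times> {..<Suc m}. ell2_fun (gram_vec K u m) p * cnj (ell2_fun (gram_vec K v n) p))"
    unfolding cinner_ell2.rep_eq
    by (subst infsum_supported[where F = "{u} \<times> {..<Suc m}"])
      (auto simp: gram_vec_fun[OF assms] less_Suc_eq_le split: if_splits dest: cholesky_support[OF assms])
  also have "\<dots> = (\<Sum>k<Suc m. ell2_fun (gram_vec K u m) (u, k) * cnj (ell2_fun (gram_vec K v n) (u, k)))"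
    by (rule sum.reindex_bij_witness[of _ "\<lambda>k. (u, k)" snd]) auto
  also have "\<dots> = (if u = v then K u m n else 0)"
  proof (cases "u = v")
    case True
    then show ?thesis
      using cholesky_factorization[OF assms, of m "Suc m" v n]
      by (simp add: gram_vec_fun[OF assms] del: sum.lessThan_Suc)
  qed (simp add: gram_vec_fun[OF assms])
  finally show ?thesis .
qed

section \<open>Reindexing of square summable functions\<close>

definition embed_vec :: "('a \<Rightarrow> 'b) \<Rightarrow> 'a ell2 \<Rightarrow> 'b ell2"
  where "embed_vec \<phi> f = Abs_ell2 (\<lambda>b. if b \<in> range \<phi> then ell2_fun f (inv \<phi> b) else 0)"

definition pull_vec :: "('a \<Rightarrow> 'b) \<Rightarrow> 'b ell2 \<Rightarrow> 'a ell2"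
  where "pull_vec \<phi> g = Abs_ell2 (\<lambda>a. ell2_fun g (\<phi> a))"

lemma ell2_eqI: "(\<And>v. ell2_fun f v = ell2_fun g v) \<Longrightarrow> f = g"
  by (metis ell2_fun_inject ext)

lemma embed_vec_fun:
  assumes "inj \<phi>"
  shows "ell2_fun (embed_vec \<phi> f) b = (if b \<in> range \<phi> then ell2_fun f (inv \<phi> b) else 0)"
proof -
  let ?h = "\<lambda>b. if b \<in> range \<phi> then ell2_fun f (inv \<phi> b) else 0"
  have "(\<lambda>b. (cmod (?h b))\<^sup>2) summable_on UNIV \<longleftrightarrow> (\<lambda>b. (cmod (?h b))\<^sup>2) summable_on range \<phi>"
    by (rule summable_on_cong_neutral) auto
  also have "\<dots> \<longleftrightarrow> ((\<lambda>b. (cmod (?h b))\<^sup>2) \<circ> \<phi>) summable_on UNIV"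
    by (rule summable_on_reindex[OF assms])
  also have "(\<lambda>b. (cmod (?h b))\<^sup>2) \<circ> \<phi> = (\<lambda>a. (cmod (ell2_fun f a))\<^sup>2)"
    using assms by (auto simp: fun_eq_iff)
  finally show ?thesis
    unfolding embed_vec_def using square_summable[of f] by (subst Abs_ell2_inverse) auto
qed

lemma embed_vec_image: "inj \<phi> \<Longrightarrow> ell2_fun (embed_vec \<phi> f) (\<phi> a) = ell2_fun f a"
  by (simp add: embed_vec_fun)

lemma pull_vec_fun:
  assumes "inj \<phi>"
  shows "ell2_fun (pull_vec \<phi> g) a = ell2_fun g (\<phi> a)"
proof -
  have "(\<lambda>b. (cmod (ell2_fun g b))\<^sup>2) summable_on range \<phi>"
    by (rule summable_on_subset_banach[OF square_summable]) auto
  then have "(\<lambda>a. (cmod (ell2_fun g (\<phi> a)))\<^sup>2) summable_on UNIV"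
    by (simp add: summable_on_reindex[OF assms] o_def)
  then show ?thesis
    unfolding pull_vec_def by (subst Abs_ell2_inverse) auto
qed

lemma adj_pair_embed_pull:
  assumes "inj \<phi>" shows "adj_pair (embed_vec \<phi>) (pull_vec \<phi>)"
  unfolding adj_pair_def
proof (intro allI)
  fix f g
  let ?h = "\<lambda>b. ell2_fun (embed_vec \<phi> f) b * cnj (ell2_fun g b)"
  have "infsum ?h UNIV = infsum ?h (range \<phi>)"
    by (rule infsum_cong_neutral) (auto simp: embed_vec_fun[OF assms])
  also have "\<dots> = infsum (?h \<circ> \<phi>) UNIV"
    by (rule infsum_reindex[OF assms])
  also have "?h \<circ> \<phi> = (\<lambda>a. ell2_fun f a * cnj (ell2_fun (pull_vec \<phi> g) a))"
    by (simp add: fun_eq_iff embed_vec_image pull_vec_fun assms)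
  finally show "cinner (embed_vec \<phi> f) g = cinner f (pull_vec \<phi> g)"
    by (simp add: cinner_ell2.rep_eq)
qed

lemma pull_embed_vec: "inj \<phi> \<Longrightarrow> pull_vec \<phi> (embed_vec \<phi> f) = f"
  by (rule ell2_eqI) (simp add: pull_vec_fun embed_vec_image)

lemma pull_embed_disjoint:
  assumes "inj \<phi>" "inj \<psi>" "range \<phi> \<inter> range \<psi> = {}"
  shows "pull_vec \<psi> (embed_vec \<phi> f) = 0"
  by (rule ell2_eqI) (use assms in \<open>auto simp: pull_vec_fun embed_vec_fun zero_ell2.rep_eq\<close>)

lemma unit_vec_fun: "ell2_fun (unit_vec u) v = (if v = u then 1 else 0)"
  by transfer simp

lemma embed_unit_vec: "inj \<phi> \<Longrightarrow> embed_vec \<phi> (unit_vec u) = unit_vec (\<phi> u)"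
  by (rule ell2_eqI) (auto simp: embed_vec_fun unit_vec_fun)

lemma cinner_unit_vec: "cinner f (unit_vec u) = ell2_fun f u"
proof -
  have "cinner f (unit_vec u) = (\<Sum>v\<in>{u}. ell2_fun f v * cnj (ell2_fun (unit_vec u) v))"
    unfolding cinner_ell2.rep_eq by (rule infsum_supported) (auto simp: unit_vec_fun)
  then show ?thesis by (simp add: unit_vec_fun)
qed

section \<open>A unitary operator with prescribed spectral measures\<close>

text \<open>
  The vector \<open>g u n\<close> plays the role of the function \<open>e\<^sup>i\<^sup>n\<^sup>\<theta>\<close> in \<open>L\<^sup>2\<close> of a measure on the circle with Fourier
  coefficients \<open>m u\<close>, and \<open>Z\<close> is the multiplication by \<open>e\<^sup>i\<^sup>\<theta>\<close>.  Since the Gram matrix depends on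
  differences of indices only, the shift \<open>g u n \<mapsto> g u (n + 1)\<close> is a partial isometry; completing it
  by the identity on the orthogonal complement makes it unitary.
\<close>

theorem cyclic_unitary_exists:
  fixes m :: "'v \<Rightarrow> int \<Rightarrow> complex"
  assumes pos: "\<And>u. pos_kernel (\<lambda>i j. m u (i - j))" and one: "\<And>u. m u 0 = 1"
  shows "\<exists>(Z :: ('v \<times> nat) ell2 \<Rightarrow> ('v \<times> nat) ell2) Z' (g :: 'v \<Rightarrow> int \<Rightarrow> ('v \<times> nat) ell2).
    adj_pair Z Z' \<and> (\<forall>a. Z (Z' a) = a) \<and> (\<forall>a. Z' (Z a) = a) \<and>
    (\<forall>u n. Z (g u n) = g u (n + 1)) \<and> (\<forall>u n. Z' (g u n) = g u (n - 1)) \<and>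
    (\<forall>u n v k. cinner (g u n) (g v k) = (if u = v then m u (n - k) else 0)) \<and>
    (\<forall>u. g u 0 = unit_vec (u, 0)) \<and>
    (\<forall>a. (\<forall>u n. cinner a (g u n) = 0) \<longrightarrow> Z a = a \<and> Z' a = a)"
proof -
  \<comment> \<open>Cholesky factors are indexed by \<open>\<nat>\<close>. The coding of \<open>\<int>\<close>
    maps \<open>0\<close> to \<open>0\<close>, so the first row of the factor, which is the unit vector, is
    \<open>g u 0\<close>.\<close>
  define K where "K u i j = m u (int_decode i - int_decode j)" for u i j
  have K: "pos_kernel (K u)" for u
    unfolding pos_kernel_def
  proof (intro conjI allI impI)
    show "K u j i = cnj (K u i j)" for i j
      unfolding K_def by (rule pos_kernel_hermitian[OF pos])
  next
    fix F :: "nat set" and c :: "nat \<Rightarrow> complex"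
    assume F: "finite F"
    have inj: "inj_on int_decode F" by (rule inj_on_subset[OF inj_int_decode]) auto
    have "0 \<le> Re (\<Sum>i\<in>int_decode ` F. \<Sum>j\<in>int_decode ` F. c (int_encode i) * cnj (c (int_encode j)) * m u (i - j))"
      by (rule pos_kernel_form_nonneg[OF pos]) (use F in simp)
    then show "0 \<le> Re (\<Sum>i\<in>F. \<Sum>j\<in>F. c i * cnj (c j) * K u i j)"
      by (simp add: sum.reindex[OF inj] K_def)
  qed
  define g where "g u n = gram_vec K u (int_encode n)" for u n
  have gram: "cinner (g u n) (g v k) = (if u = v then m u (n - k) else 0)" for u n v k
    unfolding g_def by (simp add: gram_vec_cinner[OF K] K_def)
  have int0: "int_encode 0 = 0" "int_decode 0 = 0"
    by (simp_all add: int_encode_def sum_encode_def int_decode_def sum_decode_def)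
  have g0: "g u 0 = unit_vec (u, 0)" for u
  proof (rule ell2_eqI)
    fix p :: "'v \<times> nat"
    obtain v k where p: "p = (v, k)" by (cases p)
    have "cholesky (K u) 0 0 = 1"
      by (simp add: cholesky_def K_def int0 one)
    moreover have "cholesky (K u) 0 k = 0" if "k > 0"
      using cholesky_upper[OF K that] .
    ultimately show "ell2_fun (g u 0) p = ell2_fun (unit_vec (u, 0)) p"
      by (auto simp: p g_def int0 gram_vec_fun[OF K] unit_vec_fun)
  qed
  define x where "x p = g (fst p) (snd p)" for p
  define y where "y p = g (fst p) (snd p + 1)" for p
  have eq: "cinner (x p) (x q) = cinner (y p) (y q)" for p q
    by (simp add: x_def y_def gram)
  obtain W W' where W: "adj_pair W W'" "\<forall>p. W (x p) = y p" "\<forall>p. W' (y p) = x p"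
    "\<forall>a. (\<forall>p. cinner a (x p) = 0) \<longrightarrow> W a = 0" "\<forall>b. (\<forall>p. cinner b (y p) = 0) \<longrightarrow> W' b = 0"
    using partial_isometry_exists[of x y] eq by blast
  have Wg: "W (g u n) = g u (n + 1)" "W' (g u n) = g u (n - 1)" for u n
    using W(2)[rule_format, of "(u, n)"] W(3)[rule_format, of "(u, n - 1)"] by (simp_all add: x_def y_def)
  have W0: "W a = 0" "W' a = 0" if "\<And>u n. cinner a (g u n) = 0" for a
    using that W(4,5) by (auto simp: x_def y_def)
  define P where "P a = W' (W a)" for a
  have P: "adj_pair P P"
    unfolding P_def by (rule adj_pair_comp[OF adj_pair_swap[OF W(1)] W(1)])
  define Z where "Z a = W a + (a - P a)" for a
  define Z' where "Z' a = W' a + (a - P a)" for a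
  have Z: "adj_pair Z Z'"
    unfolding Z_def Z'_def by (intro adj_pair_plus adj_pair_minus adj_pair_id W(1) P)
  have Pg: "P (g u n) = g u n" for u n
    by (simp add: P_def Wg)
  have Zg: "Z (g u n) = g u (n + 1)" "Z' (g u n) = g u (n - 1)" for u n
    by (simp_all add: Z_def Z'_def Pg Wg)
  have Zorth: "Z a = a" "Z' a = a" if "\<And>u n. cinner a (g u n) = 0" for a
    using adj_pair_zero[OF adj_pair_swap[OF W(1)]] W0[OF that] by (simp_all add: Z_def Z'_def P_def)
  have ZZ': "Z (Z' a) = a" for a
    by (rule adj_pair_eqI2[where g = g, OF adj_pair_comp[OF Z adj_pair_swap[OF Z]] adj_pair_id])
      (simp_all add: Zg Zorth)
  have Z'Z: "Z' (Z a) = a" for a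
    by (rule adj_pair_eqI2[where g = g, OF adj_pair_comp[OF adj_pair_swap[OF Z] Z] adj_pair_id])
      (simp_all add: Zg Zorth)
  show ?thesis
    using Z ZZ' Z'Z Zg gram g0 Zorth by blast
qed

text \<open>
  An operator that is diagonal on the vectors \<open>e\<^bsub>(u, 0)\<^esub>\<close> is diagonal as a form on their closed span.  The
  infinite expansion of \<open>J f\<close> is moved through \<open>A\<close> by means of the adjoint.
\<close>

lemma cinner_block_diagonal:
  fixes A A' :: "('v \<times> nat) ell2 \<Rightarrow> ('v \<times> nat) ell2"
  assumes A: "adj_pair A A'"
    and diag: "\<And>u v. cinner (A (unit_vec (u, 0))) (unit_vec (v, 0)) = (if u = v then \<alpha> u else 0)"
  defines "J \<equiv> embed_vec (\<lambda>v. (v, 0::nat))"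
  shows "cinner (A (J f)) (J h) = (\<Sum>\<^sub>\<infinity>v. ell2_fun f v * cnj (ell2_fun h v) * \<alpha> v)"
proof -
  have inj: "inj (\<lambda>v::'v. (v, 0::nat))" by (auto simp: inj_on_def)
  note J = adj_pair_embed_pull[OF inj, folded J_def]
  have pull: "ell2_fun (pull_vec (\<lambda>v. (v, 0::nat)) a) v = cinner a (unit_vec (v, 0))" for a :: "('v \<times> nat) ell2" and v
    by (simp add: pull_vec_fun[OF inj] cinner_unit_vec)
  have Ju: "J (unit_vec v) = unit_vec (v, 0)" for v
    by (simp add: J_def embed_unit_vec[OF inj])
  have Au: "cinner (A (unit_vec (v, 0))) (J h) = \<alpha> v * cnj (ell2_fun h v)" for v
  proof -
    have "pull_vec (\<lambda>v. (v, 0::nat)) (A (unit_vec (v, 0))) = \<alpha> v *\<^sub>C unit_vec v"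
      by (rule ell2_eqI) (auto simp: pull diag scaleC_ell2.rep_eq unit_vec_fun)
    then have *: "cinner (J h) (A (unit_vec (v, 0))) = cinner h (\<alpha> v *\<^sub>C unit_vec v)"
      by (simp add: adj_pairD[OF J])
    have "cinner (A (unit_vec (v, 0))) (J h) = cnj (cinner (J h) (A (unit_vec (v, 0))))"
      by (rule cinner_commute)
    then show ?thesis
      unfolding * by (simp add: cinner_scaleC_right cinner_unit_vec)
  qed
  have "cinner (A (J f)) (J h) = cinner f (pull_vec (\<lambda>v. (v, 0::nat)) (A' (J h)))"
    by (simp add: adj_pairD[OF A] adj_pairD[OF J])
  also have "\<dots> = (\<Sum>\<^sub>\<infinity>v. ell2_fun f v * cnj (cinner (A' (J h)) (unit_vec (v, 0))))"
    by (simp add: cinner_ell2.rep_eq pull)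
  also have "\<dots> = (\<Sum>\<^sub>\<infinity>v. ell2_fun f v * (\<alpha> v * cnj (ell2_fun h v)))"
    unfolding Au[symmetric] adj_pairD[OF A] by (simp flip: cinner_commute)
  finally show ?thesis by (simp add: mult_ac)
qed

section \<open>Normal extensions of quasinormal operators\<close>

lemma linear_if_adj_pair:
  assumes "adj_pair A A'" shows "Vector_Spaces.linear scaleC scaleC A"
  by (simp add: Vector_Spaces.linear_iff vector_space_scaleC adj_pair_add[OF assms] adj_pair_scale[OF assms])

text \<open>
  The isometry \<open>J\<close> carries \<open>A\<close> into the quasinormal operator \<open>W C B\<^sup>-\<^sup>1\<close>.  A dilation in the style of
  Halmos makes its numerator normal: with \<open>D = C - W C W\<^sup>*\<close>, for a partial isometry \<open>W\<close> the product of
  \<open>C\<close> and the projection to the complement of the final space of \<open>W\<close>, the block matrix with rows \<open>(W C, D)\<close> and \<open>(0, C W\<^sup>*)\<close> is normal and commutes with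
  \<open>B \<oplus> B\<close>.  The two copies of the space are the functions supported on even and on odd second
  coordinates, so the extension acts on the original type.
\<close>

theorem quasinormal_normal_extension:
  fixes B C W W' :: "('v \<times> nat) ell2 \<Rightarrow> ('v \<times> nat) ell2" and A :: "'h::chilbert_space operator"
    and J :: "'h \<Rightarrow> ('v \<times> nat) ell2"
  assumes B: "adj_pair B B" and C: "adj_pair C C" and W: "adj_pair W W'"
    and BC: "\<And>a. B (C a) = C (B a)" and sum: "\<And>a. B (B a) + C (C a) = a"
    and WB: "\<And>a. W (B a) = B (W a)" and WC: "\<And>a. W (C a) = C (W a)"
    and iso: "\<And>a. W' (W (C a)) = C a"
    and inj: "\<And>a. B a = 0 \<Longrightarrow> a = 0"
    and J: "adj_pair J J'" "\<And>f. norm (J f) = norm f"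
    and ext: "\<And>f g. (f, g) \<in> A \<Longrightarrow> W (C (J f)) = B (J g)"
    and A: "linear_operator A" "densely_defined A"
  shows "subnormal_in TYPE(('v \<times> nat) ell2) A"
proof -
  note W' = adj_pair_swap[OF W]
  have W'B: "W' (B a) = B (W' a)" and W'C: "W' (C a) = C (W' a)" for a
    by (rule cinner_extensionality, simp add: adj_pairD[OF W'] adj_pairD[OF B] adj_pairD[OF C] WB WC)+
  define T where "T a = W (C a)" for a
  define T' where "T' a = C (W' a)" for a
  define D where "D a = C a - W (C (W' a))" for a
  have T: "adj_pair T T'"
    unfolding T_def T'_def by (rule adj_pair_comp[OF W C])
  have D: "adj_pair D D"
    unfolding D_def using adj_pair_minus[OF C adj_pair_comp[OF W adj_pair_comp[OF C W']]] by simp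
  note lin = adj_pair_add[OF B] adj_pair_diff[OF B] adj_pair_add[OF C] adj_pair_diff[OF C]
    adj_pair_add[OF W] adj_pair_diff[OF W] adj_pair_add[OF W'] adj_pair_diff[OF W']
    adj_pair_zero[OF B] adj_pair_zero[OF C] adj_pair_zero[OF W] adj_pair_zero[OF W']
  have isoC: "C (W' (W a)) = C a" for a
    using iso[of a] by (simp add: WC W'C)
  have T'T: "T' (T a) = C (C a)" for a
    by (simp add: T_def T'_def iso)
  have TT': "T (T' a) = C (C (W (W' a)))" for a
    by (simp add: T_def T'_def WC)
  have DT: "D (T a) = 0" "T' (D a) = 0" for a
    by (simp_all add: D_def T_def T'_def lin WC W'C isoC)
  have DD: "D (D a) + T (T' a) = C (C a)" for a
    by (simp add: D_def TT' lin WC W'C isoC)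
  have TB: "T (B a) = B (T a)" "T' (B a) = B (T' a)" "D (B a) = B (D a)" for a
    by (simp_all add: T_def T'_def D_def lin WB W'B flip: BC)
  \<comment> \<open>The two copies: \<open>V\<close> and \<open>U\<close> are isometries with complementary
    ranges.\<close>
  define \<phi> where "\<phi> p = (fst p, 2 * snd p)" for p :: "'v \<times> nat"
  define \<psi> where "\<psi> p = (fst p, 2 * snd p + 1)" for p :: "'v \<times> nat"
  have inj\<phi>: "inj \<phi>" and inj\<psi>: "inj \<psi>" by (auto simp: inj_on_def \<phi>_def \<psi>_def prod_eq_iff)
  have disj: "range \<phi> \<inter> range \<psi> = {}"
    by (auto simp: \<phi>_def \<psi>_def) presburger
  then have disj': "range \<psi> \<inter> range \<phi> = {}"
    by blast
  have cover: "range \<phi> \<union> range \<psi> = UNIV"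
  proof -
    have "p \<in> range \<phi> \<union> range \<psi>" for p :: "'v \<times> nat"
    proof (cases "even (snd p)")
      case True
      then have "p = \<phi> (fst p, snd p div 2)" by (auto simp: \<phi>_def prod_eq_iff)
      then show ?thesis by blast
    next
      case False
      then have "p = \<psi> (fst p, snd p div 2)" by (auto simp: \<psi>_def prod_eq_iff)
      then show ?thesis by blast
    qed
    then show ?thesis by blast
  qed
  define V where "V = embed_vec \<phi>"
  define V' where "V' = pull_vec \<phi>"
  define U where "U = embed_vec \<psi>"
  define U' where "U' = pull_vec \<psi>"
  have V: "adj_pair V V'" and U: "adj_pair U U'"
    using adj_pair_embed_pull inj\<phi> inj\<psi> by (auto simp: V_def V'_def U_def U'_def)
  have VV: "V' (V a) = a" "U' (U a) = a" "V' (U a) = 0" "U' (V a) = 0" for a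
    using pull_embed_vec inj\<phi> inj\<psi> pull_embed_disjoint[OF inj\<phi> inj\<psi> disj]
      pull_embed_disjoint[OF inj\<psi> inj\<phi> disj'] by (auto simp: V_def V'_def U_def U'_def)
  have split: "V (V' a) + U (U' a) = a" for a
  proof (rule ell2_eqI)
    fix p
    show "ell2_fun (V (V' a) + U (U' a)) p = ell2_fun a p"
      using cover disj inj\<phi> inj\<psi>
      by (cases "p \<in> range \<phi>") (auto simp: V_def V'_def U_def U'_def plus_ell2.rep_eq embed_vec_fun pull_vec_fun f_inv_into_f)
  qed
  note V's = adj_pair_swap[OF V] adj_pair_swap[OF U]
  note linV = adj_pair_add[OF V] adj_pair_add[OF U] adj_pair_add[OF V's(1)] adj_pair_add[OF V's(2)]
    adj_pair_zero[OF V] adj_pair_zero[OF U] adj_pair_zero[OF V's(1)] adj_pair_zero[OF V's(2)]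
    adj_pair_add[OF T] adj_pair_add[OF adj_pair_swap[OF T]] adj_pair_add[OF D]
    adj_pair_zero[OF T] adj_pair_zero[OF adj_pair_swap[OF T]] adj_pair_zero[OF D]
  \<comment> \<open>The block operators \<open>B \<oplus> B\<close>, the dilation, and the adjoint of the
    dilation.\<close>
  define BB where "BB a = V (B (V' a)) + U (B (U' a))" for a
  define N where "N a = (V (T (V' a)) + V (D (U' a))) + U (T' (U' a))" for a
  define N' where "N' a = (V (T' (V' a)) + U (D (V' a))) + U (T (U' a))" for a
  have BB: "adj_pair BB BB"
    unfolding BB_def by (rule adj_pair_plus[OF adj_pair_comp[OF V adj_pair_comp[OF B V's(1)]]
        adj_pair_comp[OF U adj_pair_comp[OF B V's(2)]]])
  have N: "adj_pair N N'"
    unfolding N_def N'_def by (rule adj_pair_plus[OF adj_pair_plus[OF adj_pair_comp[OF V adj_pair_comp[OF T V's(1)]]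
        adj_pair_comp[OF V adj_pair_comp[OF D V's(2)]]]
        adj_pair_comp[OF U adj_pair_comp[OF adj_pair_swap[OF T] V's(2)]]])
  have parts: "V' (BB a) = B (V' a)" "U' (BB a) = B (U' a)"
    "V' (N a) = T (V' a) + D (U' a)" "U' (N a) = T' (U' a)"
    "V' (N' a) = T' (V' a)" "U' (N' a) = D (V' a) + T (U' a)" for a
    by (simp_all add: BB_def N_def N'_def linV lin VV)
  have eqI: "a = b" if "V' a = V' b" "U' a = U' b" for a b
    using split[of a] split[of b] that by metis
  have "normal_operator {(f, g). N f = BB g}"
  proof (rule normal_operator_quotient[OF BB N])
    show "N (N' a) = N' (N a)" for a
    proof (rule eqI)
      show "V' (N (N' a)) = V' (N' (N a))"
        using DD[of "V' a"] DT(1) DT(2) by (simp add: parts linV T'T add.commute add.left_commute)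
      show "U' (N (N' a)) = U' (N' (N a))"
        using DD[of "U' a"] by (simp add: parts linV T'T DT)
    qed
    show "N (BB a) = BB (N a)" for a
      by (rule eqI) (simp_all add: parts linV lin TB)
    show "N' (N a) + BB (BB a) = a" for a
    proof (rule eqI)
      show "V' (N' (N a) + BB (BB a)) = V' a"
        using sum by (simp add: parts linV T'T DT add.commute)
      show "U' (N' (N a) + BB (BB a)) = U' a"
        using sum by (simp add: parts linV T'T DT DD add.commute)
    qed
    show "a = 0" if "BB a = 0" for a
    proof (rule eqI)
      show "V' a = V' 0"
        using inj[of "V' a"] that parts(1)[of a] by (simp add: linV)
      show "U' a = U' 0"
        using inj[of "U' a"] that parts(2)[of a] by (simp add: linV)
    qed
  qed
  moreover have "N (V (J f)) = BB (V (J g))" if "(f, g) \<in> A" for f g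
    by (rule eqI) (simp_all add: parts VV linV lin T_def ext[OF that])
  moreover have "norm (V a) = norm a" for a
  proof -
    have "cinner (V a) (V a) = cinner a a" by (simp add: adj_pairD[OF V] VV)
    then show ?thesis unfolding cinner_self of_real_eq_iff by (simp add: power2_eq_iff_nonneg)
  qed
  moreover have "Vector_Spaces.linear scaleC scaleC (\<lambda>h. V (J h))"
    by (rule linear_if_adj_pair[OF adj_pair_comp[OF V J(1)]])
  ultimately show ?thesis
    unfolding subnormal_in_def using A J(2)
    by (intro conjI exI[of _ "\<lambda>h. V (J h)"] exI[of _ "{(f, g). N f = BB g}"]) auto
qed

section \<open>Weighted shifts on directed trees\<close>

text \<open>
  This makes \<open>par\<close> and \<open>Chi\<close> inverse to each other, so that sums over the non-root vertices can be
  regrouped as sums over the children of all vertices.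
\<close>

definition unique_parents :: "('v \<times> 'v) set \<Rightarrow> bool"
  where "unique_parents E \<longleftrightarrow> (\<forall>v. \<not> is_root E v \<longrightarrow> (\<exists>!u. (u, v) \<in> E))"

lemma Chi_iff_par: "unique_parents E \<Longrightarrow> v \<in> Chi E u \<longleftrightarrow> \<not> is_root E v \<and> par E v = u"
proof -
  assume par: "unique_parents E"
  have "par E v = u" if "(u, v) \<in> E" for u
  proof -
    have "\<exists>!u. (u, v) \<in> E"
      using par that unfolding unique_parents_def is_root_def by blast
    then show ?thesis
      unfolding par_def using that by (rule the1_equality)
  qed
  then show ?thesis
    unfolding Chi_def is_root_def by blast
qed

lemma linear_operator_weighted_shift: "linear_operator (weighted_shift E w)"
proof -
  have shift: "(f, g) \<in> weighted_shift E w \<longleftrightarrow> (\<forall>v. ell2_fun g v = shift_map E w (ell2_fun f) v)" for f g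
    by (auto simp: weighted_shift_def)
  have "g = h" if "(f, g) \<in> weighted_shift E w" "(f, h) \<in> weighted_shift E w" for f g h
    using that unfolding shift by (intro ell2_eqI) simp
  then have "single_valued (weighted_shift E w)"
    unfolding single_valued_def by blast
  then show ?thesis
    unfolding linear_operator_def shift
    by (simp add: shift_map_def zero_ell2.rep_eq plus_ell2.rep_eq scaleC_ell2.rep_eq algebra_simps)
qed

lemma shift_unit_vec:
  assumes "unique_parents E" "(unit_vec u, s) \<in> weighted_shift E w"
  shows "ell2_fun s v = (if v \<in> Chi E u then w v else 0)"
  using assms(2) unfolding weighted_shift_def
  by (simp add: Chi_iff_par[OF assms(1)] shift_map_def unit_vec_fun)

text \<open>
  Formally \<open>S f\<close> is the sum of \<open>f(u) S e\<^sub>u\<close>.  The sum over the vertices that computes the inner product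
  is regrouped by the parent of each vertex, since \<open>S e\<^sub>u\<close> lives on the children of \<open>u\<close>.
\<close>

lemma cinner_shift_expand:
  assumes par: "unique_parents E" and fg: "(f, g) \<in> weighted_shift E w"
    and s: "\<And>u. (unit_vec u, s u) \<in> weighted_shift E w"
  shows "cinner g d = (\<Sum>\<^sub>\<infinity>u. ell2_fun f u * cinner (s u) d)"
proof -
  let ?h = "\<lambda>v. ell2_fun g v * cnj (ell2_fun d v)"
  let ?P = "Sigma UNIV (Chi E)"
  have g: "ell2_fun g v = (if is_root E v then 0 else w v * ell2_fun f (par E v))" for v
    using fg by (simp add: weighted_shift_def shift_map_def)
  have inj: "inj_on snd ?P"
    by (auto simp: inj_on_def Chi_iff_par[OF par])
  have img: "snd ` ?P = {v. \<not> is_root E v}"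
    by (force simp: Chi_iff_par[OF par])
  have sum: "?h summable_on UNIV"
    by (intro product_summable square_summable)
  then have "?h summable_on snd ` ?P"
    by (rule summable_on_subset_banach) auto
  then have sumP: "(\<lambda>(u, v). ?h v) summable_on ?P"
    unfolding summable_on_reindex[OF inj] by (simp add: o_def case_prod_unfold)
  have "cinner g d = infsum ?h (snd ` ?P)"
    unfolding cinner_ell2.rep_eq img by (rule infsum_cong_neutral) (auto simp: g)
  also have "\<dots> = infsum (\<lambda>(u, v). ?h v) ?P"
    unfolding infsum_reindex[OF inj] by (simp add: o_def case_prod_unfold)
  also have "\<dots> = (\<Sum>\<^sub>\<infinity>u. \<Sum>\<^sub>\<infinity>v\<in>Chi E u. ?h v)"
    by (rule infsum_Sigma'_banach[OF sumP, symmetric])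
  also have "\<dots> = (\<Sum>\<^sub>\<infinity>u. ell2_fun f u * cinner (s u) d)"
  proof (rule infsum_cong)
    fix u
    have "(\<Sum>\<^sub>\<infinity>v\<in>Chi E u. ?h v) = (\<Sum>\<^sub>\<infinity>v\<in>Chi E u. ell2_fun f u * (ell2_fun (s u) v * cnj (ell2_fun d v)))"
      by (rule infsum_cong) (simp add: g shift_unit_vec[OF par s] Chi_iff_par[OF par])
    also have "\<dots> = ell2_fun f u * (\<Sum>\<^sub>\<infinity>v\<in>Chi E u. ell2_fun (s u) v * cnj (ell2_fun d v))"
      by (rule infsum_cmult_right')
    also have "(\<Sum>\<^sub>\<infinity>v\<in>Chi E u. ell2_fun (s u) v * cnj (ell2_fun d v)) = cinner (s u) d"
      unfolding cinner_ell2.rep_eq by (rule infsum_cong_neutral) (auto simp: shift_unit_vec[OF par s])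
    finally show "(\<Sum>\<^sub>\<infinity>v\<in>Chi E u. ?h v) = ell2_fun f u * cinner (s u) d" .
  qed
  finally show ?thesis .
qed

text \<open>
  A vector orthogonal to all unit vectors has only zero coordinates.
\<close>

lemma ell2_closure_unit_vecs:
  assumes M0: "0 \<in> M" and Madd: "\<And>x y. x \<in> M \<Longrightarrow> y \<in> M \<Longrightarrow> x + y \<in> M"
    and Mscale: "\<And>c x. x \<in> M \<Longrightarrow> c *\<^sub>C x \<in> M" and unit: "\<And>u. unit_vec u \<in> M"
  shows "closure M = (UNIV :: 'v ell2 set)"
proof -
  have "a \<in> closure M" for a :: "'v ell2"
  proof -
    have "c *\<^sub>R x \<in> M" if "x \<in> M" for c x
      using Mscale[OF that, of "complex_of_real c"] by (simp add: scaleC_of_real)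
    then obtain X p where X: "\<And>n. X n \<in> M" "X \<longlonglongrightarrow> p" and orth: "\<And>m. m \<in> M \<Longrightarrow> inner (a - p) m = 0"
      using orthogonal_projection[of M a] M0 Madd by metis
    have "ell2_fun (a - p) u = 0" for u
      using orth[OF unit[of u]] orth[OF Mscale[OF unit[of u], of \<i>]]
      by (simp flip: cinner_unit_vec add: cinner_eq_Complex complex_eq_iff)
    then have "a - p = 0"
      by (intro ell2_eqI) (simp add: zero_ell2.rep_eq)
    then show ?thesis
      using X closure_sequential by (metis eq_iff_diff_eq_0)
  qed
  then show ?thesis by blast
qed

lemma densely_defined_weighted_shift:
  assumes "\<And>u. unit_vec u \<in> Domain (weighted_shift E w)"
  shows "densely_defined (weighted_shift E w)"
  unfolding densely_defined_def
proof (rule ell2_closure_unit_vecs)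
  note lin = linear_operator_weighted_shift[of E w, unfolded linear_operator_def]
  show "0 \<in> Domain (weighted_shift E w)"
    using lin by blast
  show "x + y \<in> Domain (weighted_shift E w)"
    if "x \<in> Domain (weighted_shift E w)" "y \<in> Domain (weighted_shift E w)" for x y
    using lin that by blast
  show "c *\<^sub>C x \<in> Domain (weighted_shift E w)" if "x \<in> Domain (weighted_shift E w)" for c x
    using lin that by blast
qed (rule assms)

section \<open>Subnormality from measures on the circle\<close>

lemma cinner_norm_le: "cmod (cinner x y) \<le> norm x * norm (y::'a::complex_inner)"
proof (cases "cinner x y = 0")
  case False
  \<comment> \<open>Rotating \<open>x\<close> by \<open>c\<close> makes the inner product real and
    nonnegative.\<close>
  define c where "c = cnj (cinner x y) / of_real (cmod (cinner x y))"
  have "cmod c = 1"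
    using False by (simp add: c_def norm_divide)
  have "cinner (c *\<^sub>C x) y = of_real (cmod (cinner x y))"
    using False complex_norm_square[of "cinner x y"]
    by (simp add: c_def cinner_simps field_simps power2_eq_square)
  then have "cmod (cinner x y) = inner (c *\<^sub>C x) y"
    by (simp add: inner_eq_Re_cinner)
  also have "\<dots> \<le> norm (c *\<^sub>C x) * norm y"
    by (rule norm_cauchy_schwarz)
  finally show ?thesis
    by (simp add: norm_scaleC \<open>cmod c = 1\<close>)
qed simp

lemma cis_diff: "cis (a - b) = cis a * cnj (cis b)"
  by (simp add: cis_cnj cis_mult)

lemma integrable_bounded_prob:
  fixes f :: "real \<Rightarrow> 'b::{banach, second_countable_topology}"
  assumes "prob_space M" "f \<in> borel_measurable M" "\<And>x. norm (f x) \<le> c"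
  shows "integrable M f"
proof -
  interpret prob_space M by fact
  show ?thesis
    by (rule integrable_const_bound[of _ c]) (use assms in auto)
qed

text \<open>
  The form at \<open>c\<close> is the integral of \<open>|\<Sum>i. c\<^sub>i e\<^sup>i\<^sup>\<theta>|\<^sup>2\<close>, with the summation index in the exponent.
\<close>

lemma pos_kernel_fourier:
  fixes M :: "real measure"
  assumes M: "prob_space M" and sets[measurable_cong]: "sets M = sets borel"
  shows "pos_kernel (\<lambda>i j. \<integral>\<theta>. cis (of_int (i - j) * \<theta>) \<partial>M)"
  unfolding pos_kernel_def
proof (intro conjI allI impI)
  fix i j :: int
  show "(\<integral>\<theta>. cis (of_int (j - i) * \<theta>) \<partial>M) = cnj (\<integral>\<theta>. cis (of_int (i - j) * \<theta>) \<partial>M)"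
  proof -
    have "cnj (cis (of_int (i - j) * \<theta>)) = cis (of_int (j - i) * \<theta>)" for \<theta> :: real
      by (simp add: cis_cnj algebra_simps)
    then show ?thesis
      using Bochner_Integration.integral_cnj[of M "\<lambda>\<theta>. cis (of_int (i - j) * \<theta>)"] by simp
  qed
next
  fix F :: "int set" and c :: "int \<Rightarrow> complex"
  assume F: "finite F"
  have cis_meas [measurable]: "(\<lambda>x. cis (f x)) \<in> borel_measurable M" if "f \<in> borel_measurable M" for f
    using that unfolding cis_conv_exp by measurable
  have int: "integrable M (\<lambda>\<theta>. c i * cnj (c j) * cis (of_int (i - j) * \<theta>))" for i j
    by (rule integrable_bounded_prob[OF M, where c = "norm (c i * cnj (c j))"]) (auto simp: norm_mult)
  have "(\<Sum>i\<in>F. \<Sum>j\<in>F. c i * cnj (c j) * (\<integral>\<theta>. cis (of_int (i - j) * \<theta>) \<partial>M))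
     = (\<integral>\<theta>. (\<Sum>i\<in>F. \<Sum>j\<in>F. c i * cnj (c j) * cis (of_int (i - j) * \<theta>)) \<partial>M)"
    using int by (simp add: Bochner_Integration.integral_sum)
  also have "\<dots> = (\<integral>\<theta>. complex_of_real ((cmod (\<Sum>i\<in>F. c i * cis (of_int i * \<theta>)))\<^sup>2) \<partial>M)"
  proof (rule Bochner_Integration.integral_cong[OF refl])
    fix \<theta>
    have "complex_of_real ((cmod (\<Sum>i\<in>F. c i * cis (of_int i * \<theta>)))\<^sup>2)
      = (\<Sum>i\<in>F. c i * cis (of_int i * \<theta>)) * (\<Sum>i\<in>F. cnj (c i) * cnj (cis (of_int i * \<theta>)))"
      unfolding complex_norm_square by simp
    also have "\<dots> = (\<Sum>i\<in>F. \<Sum>j\<in>F. (c i * cis (of_int i * \<theta>)) * (cnj (c j) * cnj (cis (of_int j * \<theta>))))"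
      by (rule sum_product)
    also have "\<dots> = (\<Sum>i\<in>F. \<Sum>j\<in>F. c i * cnj (c j) * cis (of_int (i - j) * \<theta>))"
      by (intro sum.cong refl) (simp add: cis_diff right_diff_distrib mult_ac)
    finally show "(\<Sum>i\<in>F. \<Sum>j\<in>F. c i * cnj (c j) * cis (of_int (i - j) * \<theta>))
      = complex_of_real ((cmod (\<Sum>i\<in>F. c i * cis (of_int i * \<theta>)))\<^sup>2)" by simp
  qed
  also have "\<dots> = complex_of_real (\<integral>\<theta>. (cmod (\<Sum>i\<in>F. c i * cis (of_int i * \<theta>)))\<^sup>2 \<partial>M)"
  proof (rule integral_of_real, rule integrable_bounded_prob[OF M, where c = "(\<Sum>i\<in>F. cmod (c i))\<^sup>2"])
    fix \<theta>
    have "cmod (\<Sum>i\<in>F. c i * cis (of_int i * \<theta>)) \<le> (\<Sum>i\<in>F. cmod (c i))"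
      by (rule sum_norm_le) (simp add: norm_mult)
    then show "norm ((cmod (\<Sum>i\<in>F. c i * cis (of_int i * \<theta>)))\<^sup>2) \<le> (\<Sum>i\<in>F. cmod (c i))\<^sup>2"
      by (simp add: power_mono)
  qed measurable
  finally show "0 \<le> Re (\<Sum>i\<in>F. \<Sum>j\<in>F. c i * cnj (c j) * (\<integral>\<theta>. cis (of_int (i - j) * \<theta>) \<partial>M))"
    by simp
qed

lemma tendsto_integral_sin_power:
  fixes M :: "real measure"
  assumes M: "prob_space M" and sets[measurable_cong]: "sets M = sets borel"
    and pos: "AE \<theta> in M. 0 < cos \<theta>"
  shows "(\<lambda>k. \<integral>\<theta>. sin \<theta> ^ k \<partial>M) \<longlonglongrightarrow> 0"
proof -
  interpret prob_space M by fact
  have "(\<lambda>k. \<integral>\<theta>. sin \<theta> ^ k \<partial>M) \<longlonglongrightarrow> (\<integral>\<theta>. 0 \<partial>M)"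
  proof (rule integral_dominated_convergence[where w = "\<lambda>_. 1"])
    show "AE \<theta> in M. (\<lambda>k. sin \<theta> ^ k) \<longlonglongrightarrow> 0"
      using pos
    proof eventually_elim
      case (elim \<theta>)
      then have "(sin \<theta>)\<^sup>2 < 1\<^sup>2"
        using sin_cos_squared_add[of \<theta>] by (smt (verit) one_power2 zero_less_power)
      then have "\<bar>sin \<theta>\<bar> < 1"
        by (simp add: abs_square_less_1)
      then show ?case by (intro LIMSEQ_power_zero) simp
    qed
    show "AE \<theta> in M. norm (sin \<theta> ^ k) \<le> 1" for k
      by (simp add: power_abs power_le_one)
  qed auto
  then show ?thesis by simp
qed

text \<open>
  The measure \<open>\<nu> u\<close> is the law of \<open>\<theta> = arctan (sqrt s)\<close> under \<open>\<mu>\<^sub>u\<close>.  As \<open>sin\<^sup>2 \<theta> = s / (1 + s)\<close> and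
  \<open>cos\<^sup>2 \<theta> = 1 / (1 + s)\<close>, the last hypothesis is the density equation, divided by \<open>1 + s\<close> and
  tested against \<open>e\<^sup>i\<^sup>n\<^sup>\<theta>\<close>.  In the model of the spaces \<open>L\<^sup>2(\<nu> u)\<close> by the vectors \<open>g u n\<close>, the operators
  \<open>B = (Z + Z\<^sup>*) / 2\<close> and \<open>C = (Z - Z\<^sup>*) / 2i\<close> are the multiplications by \<open>cos \<theta>\<close> and \<open>sin \<theta>\<close>.  The
  hypothesis says that the vectors \<open>C (g u n)\<close> have the same Gram matrix as the vectors
  \<open>y u n = B Z\<^sup>n J S e\<^sub>u\<close>; the partial isometry \<open>W\<close> that maps the former to the latter satisfies
  \<open>W C J = B J S\<close>, so \<open>S\<close> is a restriction of \<open>W C B\<^sup>-\<^sup>1\<close>.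
\<close>

theorem subnormal_if_angular_measures:
  fixes E :: "('v \<times> 'v) set" and w :: "'v \<Rightarrow> complex" and \<nu> :: "'v \<Rightarrow> real measure"
  assumes par: "unique_parents E"
    and dom: "\<And>u. unit_vec u \<in> Domain (weighted_shift E w)"
    and prob: "\<And>u. prob_space (\<nu> u)" and sets[measurable_cong]: "\<And>u. sets (\<nu> u) = sets borel"
    and cos_pos: "\<And>u. AE \<theta> in \<nu> u. 0 < cos \<theta>"
    and rel: "\<And>u n. (\<integral>\<theta>. of_real ((sin \<theta>)\<^sup>2) * cis (of_int n * \<theta>) \<partial>\<nu> u)
      = (\<Sum>\<^sub>\<infinity>v\<in>Chi E u. of_real ((cmod (w v))\<^sup>2) * (\<integral>\<theta>. of_real ((cos \<theta>)\<^sup>2) * cis (of_int n * \<theta>) \<partial>\<nu> v))"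
  shows "subnormal_in TYPE(('v \<times> nat) ell2) (weighted_shift E w)"
proof -
  define F where "F h u n = (\<integral>\<theta>. of_real (h \<theta>) * cis (of_int n * \<theta>) \<partial>\<nu> u)" for h :: "real \<Rightarrow> real" and u and n :: int
  have cis_meas [measurable]: "(\<lambda>x. cis (f x)) \<in> borel_measurable M" if "f \<in> borel_measurable M" for f and M :: "real measure"
    using that unfolding cis_conv_exp by measurable
  have int: "integrable (\<nu> u) (\<lambda>\<theta>. of_real (h \<theta>) * cis (of_int n * \<theta>))"
    if "h \<in> borel_measurable borel" "\<And>\<theta>. \<bar>h \<theta>\<bar> \<le> 1" for h u and n :: int
    by (rule integrable_bounded_prob[OF prob, where c = 1]) (use that in \<open>auto simp: norm_mult\<close>)
  define m where "m = F (\<lambda>_. 1)"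
  have pos: "pos_kernel (\<lambda>i j. m u (i - j))" for u
    unfolding m_def F_def using pos_kernel_fourier[OF prob sets] by simp
  have one: "m u 0 = 1" for u
    using prob_space.prob_space[OF prob, of u] by (simp add: m_def F_def)
  obtain Z Z' :: "('v \<times> nat) ell2 \<Rightarrow> ('v \<times> nat) ell2" and g
    where Z: "adj_pair Z Z'" and ZZ': "\<And>a. Z (Z' a) = a" and Z'Z: "\<And>a. Z' (Z a) = a"
      and Zg: "\<And>u n. Z (g u n) = g u (n + 1)" "\<And>u n. Z' (g u n) = g u (n - 1)"
      and gram: "\<And>u n v k. cinner (g u n) (g v k) = (if u = v then m u (n - k) else 0)"
      and g0: "\<And>u. g u 0 = unit_vec (u, 0)"
      and orth: "\<forall>a. (\<forall>u n. cinner a (g u n) = 0) \<longrightarrow> Z a = a \<and> Z' a = a"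
    using cyclic_unitary_exists[where m = m, OF pos one] by blast
  note Z' = adj_pair_swap[OF Z]
  note linZ = adj_pair_add[OF Z] adj_pair_add[OF Z'] adj_pair_diff[OF Z] adj_pair_diff[OF Z']
    adj_pair_scale[OF Z] adj_pair_scale[OF Z'] adj_pair_zero[OF Z] adj_pair_zero[OF Z']
  define B where "B a = (1/2) *\<^sub>C (Z a + Z' a)" for a
  define C where "C a = (1/(2 * \<i>)) *\<^sub>C (Z a - Z' a)" for a
  have B: "adj_pair B B"
    by (simp add: adj_pair_def B_def cinner_simps adj_pairD[OF Z] adj_pairD[OF Z'] add.commute)
  have C: "adj_pair C C"
    by (simp add: adj_pair_def C_def cinner_simps adj_pairD[OF Z] adj_pairD[OF Z'] algebra_simps)
  have BC: "B (C a) = C (B a)" for a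
    by (simp add: B_def C_def linZ ZZ' Z'Z scaleC_scaleC scaleC_add_right scaleC_diff_right mult.commute)
  have sum: "B (B a) + C (C a) = a" for a
  proof -
    have "B (B a) + C (C a) = (1/4) *\<^sub>C a + (1/4) *\<^sub>C a + (1/4) *\<^sub>C a + (1/4) *\<^sub>C a"
      by (simp add: B_def C_def linZ ZZ' Z'Z scaleC_scaleC scaleC_add_right scaleC_diff_right
          scaleC_minus_left scaleC_minus_right algebra_simps)
    also have "\<dots> = (1/4 + 1/4 + 1/4 + 1/4) *\<^sub>C a"
      by (simp only: scaleC_add_left)
    also have "\<dots> = a"
      by simp
    finally show ?thesis .
  qed
  note linB = adj_pair_add[OF B] adj_pair_diff[OF B] adj_pair_scale[OF B] adj_pair_zero[OF B]
  note linC = adj_pair_add[OF C] adj_pair_diff[OF C] adj_pair_scale[OF C] adj_pair_zero[OF C]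
  have ZB: "Z (B a) = B (Z a)" and ZC: "Z (C a) = C (Z a)" and Z'B: "Z' (B a) = B (Z' a)" and Z'C: "Z' (C a) = C (Z' a)" for a
    by (simp_all add: B_def C_def linZ ZZ' Z'Z)
  have Bg: "B (g u n) = (1/2) *\<^sub>C (g u (n + 1) + g u (n - 1))" and
    Cg: "C (g u n) = (1/(2 * \<i>)) *\<^sub>C (g u (n + 1) - g u (n - 1))" for u n
    by (simp_all add: B_def C_def Zg)
  \<comment> \<open>In matrix coefficients, applying \<open>C\<close> multiplies the integrand by \<open>sin
    \<theta>\<close>.\<close>
  have sinpow: "cinner ((C ^^ k) (g u n)) (g v j) = (if u = v then F (\<lambda>\<theta>. sin \<theta> ^ k) u (n - j) else 0)" for k u n v j
  proof (induction k arbitrary: n)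
    case 0
    then show ?case by (simp add: gram m_def)
  next
    case (Suc k)
    have "cinner ((C ^^ Suc k) (g u n)) (g v j)
      = (1/(2 * \<i>)) * (cinner ((C ^^ k) (g u (n + 1))) (g v j) - cinner ((C ^^ k) (g u (n - 1))) (g v j))"
      using adj_pair_funpow[OF C, of k]
      by (simp add: funpow_swap1 Cg adj_pair_scale adj_pair_diff cinner_simps del: funpow.simps add: funpow_Suc_right)
    also have "\<dots> = (if u = v then F (\<lambda>\<theta>. sin \<theta> ^ Suc k) u (n - j) else 0)"
    proof (cases "u = v")
      case True
      let ?c = "\<lambda>i \<theta>. of_real (sin \<theta> ^ k) * cis (of_int i * \<theta>)"
      have "(1/(2 * \<i>)) * (F (\<lambda>\<theta>. sin \<theta> ^ k) u (n + 1 - j) - F (\<lambda>\<theta>. sin \<theta> ^ k) u (n - 1 - j))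
        = (1/(2 * \<i>)) * (\<integral>\<theta>. ?c (n + 1 - j) \<theta> - ?c (n - 1 - j) \<theta> \<partial>\<nu> u)"
        unfolding F_def
        by (subst Bochner_Integration.integral_diff[OF int int]) (simp_all add: power_abs power_le_one)
      also have "\<dots> = (\<integral>\<theta>. (1/(2 * \<i>)) * (?c (n + 1 - j) \<theta> - ?c (n - 1 - j) \<theta>) \<partial>\<nu> u)"
        by simp
      also have "\<dots> = F (\<lambda>\<theta>. sin \<theta> ^ Suc k) u (n - j)"
        unfolding F_def
      proof (rule Bochner_Integration.integral_cong[OF refl])
        fix \<theta>
        have "cis (of_int (n + 1 - j) * \<theta>) = cis (of_int (n - j) * \<theta>) * cis \<theta>"
          "cis (of_int (n - 1 - j) * \<theta>) = cis (of_int (n - j) * \<theta>) * cnj (cis \<theta>)"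
          by (simp_all add: cis_mult cis_cnj algebra_simps)
        then have "(1/(2 * \<i>)) * (?c (n + 1 - j) \<theta> - ?c (n - 1 - j) \<theta>)
          = ?c (n - j) \<theta> * ((cis \<theta> - cnj (cis \<theta>)) / (2 * \<i>))"
          by (simp add: field_simps)
        also have "(cis \<theta> - cnj (cis \<theta>)) / (2 * \<i>) = of_real (sin \<theta>)"
        proof -
          have "cis \<theta> - cnj (cis \<theta>) = 2 * \<i> * of_real (sin \<theta>)"
            by (simp add: complex_eq_iff)
          then show ?thesis by simp
        qed
        finally show "(1/(2 * \<i>)) * (?c (n + 1 - j) \<theta> - ?c (n - 1 - j) \<theta>)
          = of_real (sin \<theta> ^ Suc k) * cis (of_int (n - j) * \<theta>)" by simp
      qed
      finally show ?thesis unfolding Suc.IH if_P[OF True] .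
    qed (simp add: Suc.IH)
    finally show ?case .
  qed
  have CC: "cinner (C (g u n)) (C (g v j)) = (if u = v then F (\<lambda>\<theta>. (sin \<theta>)\<^sup>2) u (n - j) else 0)" for u n v j
    using sinpow[of 2 u n v j] by (simp add: numeral_2_eq_2 adj_pairD[OF C])
  have BB: "cinner (B (B (g u n))) (g v j) = (if u = v then F (\<lambda>\<theta>. (cos \<theta>)\<^sup>2) u (n - j) else 0)" for u n v j
  proof -
    have "cinner (B (B (g u n))) (g v j) = cinner (g u n) (g v j) - cinner (C (C (g u n))) (g v j)"
      using arg_cong[OF sum[of "g u n"], of "\<lambda>x. cinner x (g v j)"] by (simp add: cinner_simps algebra_simps)
    also have "\<dots> = (if u = v then m u (n - j) - F (\<lambda>\<theta>. (sin \<theta>)\<^sup>2) u (n - j) else 0)"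
      using CC[of u n v j] by (simp add: gram adj_pairD[OF C])
    also have "m u (n - j) - F (\<lambda>\<theta>. (sin \<theta>)\<^sup>2) u (n - j) = F (\<lambda>\<theta>. (cos \<theta>)\<^sup>2) u (n - j)"
      unfolding m_def F_def
      by (subst Bochner_Integration.integral_diff[OF int int, symmetric])
        (auto intro!: Bochner_Integration.integral_cong simp: abs_square_le_1 cos_squared_eq algebra_simps)
    finally show ?thesis .
  qed
  \<comment> \<open>If \<open>B a = 0\<close>, then \<open>C\<^sup>2 a = a\<close>, so \<open>\<langle>a, g u
    n\<rangle> = \<langle>a, C\<^sup>2\<^sup>k (g u n)\<rangle>\<close> for all \<open>k\<close>. The norm of
    \<open>C\<^sup>2\<^sup>k (g u n)\<close> tends to \<open>0\<close> because \<open>|sin \<theta>| <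
    1\<close> almost everywhere. Hence \<open>a\<close> is orthogonal to all \<open>g u n\<close>; on such
    vectors \<open>Z\<close> and therefore \<open>B\<close> is the identity.\<close>
  have inj: "a = 0" if "B a = 0" for a
  proof -
    have "C (C a) = a" using sum[of a] that by (simp add: linB)
    then have C2: "(C ^^ (2 * k)) a = a" for k
      by (induction k) (simp_all add: funpow_swap1)
    have "cinner a (g u n) = 0" for u n
    proof -
      have bound: "(cmod (cinner a (g u n)))\<^sup>2 \<le> (norm a)\<^sup>2 * (\<integral>\<theta>. sin \<theta> ^ (4 * k) \<partial>\<nu> u)" for k
      proof -
        let ?b = "(C ^^ (2 * k)) (g u n)"
        have 1: "cinner a (g u n) = cinner a ?b"
          using adj_pairD[OF adj_pair_funpow[OF C], of "2 * k" a "g u n"] by (simp add: C2)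
        have "cinner ?b ?b = cinner ((C ^^ (4 * k)) (g u n)) (g u n)"
          using adj_pairD[OF adj_pair_funpow[OF C], of "2 * k" ?b "g u n"]
          by (simp add: adj_pairD[OF adj_pair_funpow[OF C]] flip: funpow_add[THEN fun_cong, unfolded o_apply])
        also have "\<dots> = of_real (\<integral>\<theta>. sin \<theta> ^ (4 * k) \<partial>\<nu> u)"
          by (simp add: sinpow F_def flip: of_real_power)
        finally have 2: "(norm ?b)\<^sup>2 = (\<integral>\<theta>. sin \<theta> ^ (4 * k) \<partial>\<nu> u)"
          unfolding cinner_self of_real_eq_iff .
        show ?thesis
          unfolding 1 2[symmetric] power_mult_distrib[symmetric]
          by (intro power_mono cinner_norm_le) simp
      qed
      have "(\<lambda>k. (norm a)\<^sup>2 * (\<integral>\<theta>. sin \<theta> ^ (4 * k) \<partial>\<nu> u)) \<longlonglongrightarrow> (norm a)\<^sup>2 * 0"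
        by (intro tendsto_mult_left filterlim_compose[OF tendsto_integral_sin_power[OF prob sets cos_pos]])
          (simp add: filterlim_subseq strict_mono_def)
      then have "(cmod (cinner a (g u n)))\<^sup>2 \<le> (norm a)\<^sup>2 * 0"
        by (rule LIMSEQ_le_const) (use bound in blast)
      then show ?thesis by simp
    qed
    then have "Z a = a" "Z' a = a" using orth by blast+
    then have "B a = a"
      by (simp add: B_def scaleC_add_right flip: scaleC_add_left)
    then show "a = 0" using that by simp
  qed
  obtain s where s: "\<And>u. (unit_vec u, s u) \<in> weighted_shift E w"
    using dom unfolding Domain_iff by metis
  note s_fun = shift_unit_vec[OF par s]
  have inj0: "inj (\<lambda>v::'v. (v, 0::nat))" by (auto simp: inj_on_def)
  define J where "J = embed_vec (\<lambda>v::'v. (v, 0::nat))"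
  define J' where "J' = pull_vec (\<lambda>v::'v. (v, 0::nat))"
  have J: "adj_pair J J'"
    unfolding J_def J'_def by (rule adj_pair_embed_pull[OF inj0])
  have Ju: "J (unit_vec u) = g u 0" for u
    by (simp add: J_def embed_unit_vec[OF inj0] g0)
  \<comment> \<open>The integer powers of the unitary operator \<open>Z\<close>.\<close>
  define Zp where "Zp n = (if n \<ge> 0 then Z ^^ nat n else Z' ^^ nat (- n))" for n :: int
  have Zp: "adj_pair (Zp n) (Zp (- n))" for n
    using adj_pair_funpow[OF Z] adj_pair_funpow[OF Z'] by (auto simp: Zp_def adj_pair_id[unfolded id_def[symmetric]] adj_pair_def)
  have Zpg: "Zp n (g u k) = g u (k + n)" for n u k
  proof -
    have "(Z ^^ i) (g u k) = g u (k + int i)" "(Z' ^^ i) (g u k) = g u (k - int i)" for i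
      by (induction i) (simp_all add: Zg algebra_simps)
    then show ?thesis by (simp add: Zp_def)
  qed
  have Zporth: "Zp n a = a" if "\<And>u n. cinner a (g u n) = 0" for n a
  proof -
    have "(Z ^^ i) a = a" "(Z' ^^ i) a = a" for i
      using orth that by (induction i) auto
    then show ?thesis by (simp add: Zp_def)
  qed
  have ZZp: "Z (Zp n a) = Zp (n + 1) a" for n a
    by (rule adj_pair_eqI2[where g = g, OF adj_pair_comp[OF Z Zp] Zp])
      (use orth in \<open>auto simp: Zpg Zg Zporth algebra_simps\<close>)
  define y where "y u n = B (Zp n (J (s u)))" for u n
  have "cinner (C (g u n)) (C (g v k)) = cinner (y u n) (y v k)" for u n v k
  proof -
    define A where "A a = Zp (- k) (B (B (Zp n a)))" for a
    define A' where "A' a = Zp (- n) (B (B (Zp k a)))" for a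
    have A: "adj_pair A A'"
      unfolding A_def A'_def using adj_pair_comp[OF Zp[of "- k"] adj_pair_comp[OF B adj_pair_comp[OF B Zp[of n]]]] by simp
    have diag: "cinner (A (unit_vec (u', 0))) (unit_vec (v', 0)) = (if u' = v' then F (\<lambda>\<theta>. (cos \<theta>)\<^sup>2) u' (n - k) else 0)" for u' v'
      using adj_pairD[OF Zp[of "- k"]] by (simp add: A_def Zpg BB flip: g0)
    have "cinner (y u n) (y v k) = cinner (A (J (s u))) (J (s v))"
      using adj_pairD[OF Zp[of "- k"]] by (simp add: y_def A_def adj_pairD[OF B])
    also have "\<dots> = (\<Sum>\<^sub>\<infinity>x. ell2_fun (s u) x * cnj (ell2_fun (s v) x) * F (\<lambda>\<theta>. (cos \<theta>)\<^sup>2) x (n - k))"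
      unfolding J_def by (rule cinner_block_diagonal[OF A diag])
    also have "\<dots> = cinner (C (g u n)) (C (g v k))"
    proof (cases "u = v")
      case True
      have "(\<Sum>\<^sub>\<infinity>x. ell2_fun (s u) x * cnj (ell2_fun (s v) x) * F (\<lambda>\<theta>. (cos \<theta>)\<^sup>2) x (n - k))
        = (\<Sum>\<^sub>\<infinity>x\<in>Chi E u. of_real ((cmod (w x))\<^sup>2) * F (\<lambda>\<theta>. (cos \<theta>)\<^sup>2) x (n - k))"
        by (rule infsum_cong_neutral) (auto simp: s_fun True complex_norm_square simp del: of_real_power)
      then show ?thesis using True rel[of u "n - k"] by (simp add: CC F_def)
    next
      case False
      then have "(\<lambda>x. ell2_fun (s u) x * cnj (ell2_fun (s v) x) * F (\<lambda>\<theta>. (cos \<theta>)\<^sup>2) x (n - k)) = (\<lambda>_. 0)"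
        by (auto simp: s_fun Chi_iff_par[OF par] fun_eq_iff)
      then show ?thesis using False by (simp add: CC)
    qed
    finally show ?thesis by simp
  qed
  then obtain W W' where W: "adj_pair W W'" and Wp: "\<forall>p. W (C (g (fst p) (snd p))) = y (fst p) (snd p)"
    and W'p: "\<forall>p. W' (y (fst p) (snd p)) = C (g (fst p) (snd p))"
    and W0: "\<forall>a. (\<forall>p. cinner a (C (g (fst p) (snd p))) = 0) \<longrightarrow> W a = 0"
    using partial_isometry_exists[of "\<lambda>p. C (g (fst p) (snd p))" "\<lambda>p. y (fst p) (snd p)"] by blast
  have Wg: "W (C (g u n)) = y u n" "W' (y u n) = C (g u n)" for u n
    using Wp[rule_format, of "(u, n)"] W'p[rule_format, of "(u, n)"] by simp_all
  have W0': "W a = 0" if "\<And>u n. cinner a (C (g u n)) = 0" for a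
    using W0 that by simp
  note linW = adj_pair_add[OF W] adj_pair_diff[OF W] adj_pair_scale[OF W] adj_pair_zero[OF W]
  have Zy: "Z (y u n) = y u (n + 1)" for u n
    by (simp add: y_def ZB ZZp)
  \<comment> \<open>Both \<open>C (g u n)\<close> and its image \<open>y u n\<close> are shifted by
    \<open>Z\<close>.\<close>
  have WZ: "W (Z a) = Z (W a)" for a
  proof (rule adj_pair_eqI2[where g = "\<lambda>u n. C (g u n)", OF adj_pair_comp[OF W Z] adj_pair_comp[OF Z W]])
    show "W (Z (C (g u n))) = Z (W (C (g u n)))" for u n
      by (simp add: ZC Zg Wg Zy)
    fix a assume a: "\<And>u n. cinner a (C (g u n)) = 0"
    then have "cinner (Z a) (C (g u n)) = 0" for u n
      by (simp add: adj_pairD[OF Z] Z'C Zg)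
    then show "W (Z a) = Z (W a)"
      by (simp add: W0' a linZ)
  qed
  have WZ': "W (Z' a) = Z' (W a)" for a
    using WZ[of "Z' a"] by (metis ZZ' Z'Z)
  have WB: "W (B a) = B (W a)" and WC: "W (C a) = C (W a)" for a
    by (simp_all add: B_def C_def linW WZ WZ')
  have iso: "W' (W (C a)) = C a" for a
  proof (rule adj_pair_eqI2[where g = g, OF adj_pair_comp[OF adj_pair_swap[OF W] adj_pair_comp[OF W C]] C])
    fix a assume "\<And>u n. cinner a (g u n) = 0"
    then have "C a = 0"
      using orth by (simp add: C_def)
    then show "W' (W (C a)) = C a"
      by (simp add: linW adj_pair_zero[OF adj_pair_swap[OF W]])
  qed (simp add: Wg)
  have ext: "W (C (J f)) = B (J h)" if fh: "(f, h) \<in> weighted_shift E w" for f h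
  proof (rule cinner_extensionality)
    fix b
    have unit: "W (C (J (unit_vec u))) = B (J (s u))" for u
      using Wg(1)[of u 0] by (simp add: Ju y_def Zp_def)
    have "cinner (W (C (J f))) b = cinner f (J' (C (W' b)))"
      by (simp add: adj_pairD[OF W] adj_pairD[OF C] adj_pairD[OF J])
    also have "\<dots> = (\<Sum>\<^sub>\<infinity>u. ell2_fun f u * cnj (cinner (J' (C (W' b))) (unit_vec u)))"
      by (simp add: cinner_ell2.rep_eq[of f] cinner_unit_vec)
    also have "\<dots> = (\<Sum>\<^sub>\<infinity>u. ell2_fun f u * cinner (s u) (J' (B b)))"
    proof (rule infsum_cong)
      fix u
      have "cnj (cinner (J' (C (W' b))) (unit_vec u)) = cinner (unit_vec u) (J' (C (W' b)))"
        by (rule cinner_commute[symmetric])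
      also have "\<dots> = cinner (W (C (J (unit_vec u)))) b"
        by (simp add: adj_pairD[OF W] adj_pairD[OF C] adj_pairD[OF J])
      also have "\<dots> = cinner (s u) (J' (B b))"
        unfolding unit by (simp add: adj_pairD[OF B] adj_pairD[OF J])
      finally show "ell2_fun f u * cnj (cinner (J' (C (W' b))) (unit_vec u)) = ell2_fun f u * cinner (s u) (J' (B b))"
        by simp
    qed
    also have "\<dots> = cinner h (J' (B b))"
      by (rule cinner_shift_expand[OF par fh s, symmetric])
    also have "\<dots> = cinner (B (J h)) b"
      by (simp add: adj_pairD[OF B] adj_pairD[OF J])
    finally show "cinner (W (C (J f))) b = cinner (B (J h)) b" .
  qed
  have normJ: "norm (J f) = norm f" for f
  proof -
    have "cinner (J f) (J f) = cinner f f"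
      unfolding adj_pairD[OF J] by (simp add: J_def J'_def pull_embed_vec[OF inj0])
    then show ?thesis
      unfolding cinner_self of_real_eq_iff by (simp add: power2_eq_iff_nonneg)
  qed
  show ?thesis
    by (rule quasinormal_normal_extension[OF B C W BC sum WB WC iso inj J normJ ext
          linear_operator_weighted_shift densely_defined_weighted_shift[OF dom]])
qed

section \<open>Quasi-analytic functions\<close>

lemma partial_exp_sum_le:
  fixes y :: real
  assumes "0 \<le> y" shows "(\<Sum>j<m. y ^ j / fact j) \<le> exp y"
proof -
  have s: "(\<lambda>j. y ^ j / fact j) sums exp y"
    using exp_converges[of y] by (simp add: divide_inverse mult.commute)
  show ?thesis
    unfolding sums_unique[OF s]
    by (rule sum_le_suminf[OF sums_summable[OF s]]) (use assms in auto)
qed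

text \<open>
  One step of Bang's proof of the Denjoy--Carleman theorem.  If all derivatives are small at \<open>x\<close>, namely
  at most \<open>e\<^sup>n\<^sup>-\<^sup>N\<^sup>-\<^sup>1 M\<^sub>n\<close>, then Taylor's formula of order \<open>N + 1 - n\<close> shows that at distance
  \<open>M\<^sub>N / (e M\<^bsub>N + 1\<^esub>)\<close> they have grown by a factor of at most \<open>e\<close>.  The remainder is under
  control because the derivative of order \<open>N + 1\<close> obeys the same bound everywhere, and the
  coefficients form part of an exponential series because \<open>M\<^bsub>k + 1\<^esub> / M\<^sub>k\<close> increases with \<open>k\<close>.
\<close>

lemma bang_step:
  fixes F :: "nat \<Rightarrow> real \<Rightarrow> real" and M :: "nat \<Rightarrow> real"
  assumes deriv: "\<And>n x. (F n has_real_derivative F (Suc n) x) (at x)"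
    and bound: "\<And>n x. \<bar>F n x\<bar> \<le> M n" and pos: "\<And>n. 0 < M n"
    and logconvex: "\<And>n. (M (Suc n))\<^sup>2 \<le> M n * M (Suc (Suc n))"
    and small: "\<And>n. \<bar>F n x\<bar> \<le> exp (- real (Suc N)) * exp (real n) * M n"
    and h: "0 \<le> h" "h \<le> M N / (exp 1 * M (Suc N))"
  shows "\<bar>F n (x + h)\<bar> \<le> exp (- real N) * exp (real n) * M n"
proof (cases "n \<le> N")
  case False
  then have "1 \<le> exp (- real N) * exp (real n)"
    by (simp flip: exp_add)
  then have "M n \<le> exp (- real N) * exp (real n) * M n"
    using pos[of n] mult_right_mono[of 1 "exp (- real N) * exp (real n)" "M n"] by simp
  then show ?thesis using bound[of n "x + h"] by linarith
next
  case True
  define r where "r = M (Suc N) / M N"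
  have r: "0 < r" using pos by (simp add: r_def)
  have mono: "incseq (\<lambda>k. M (Suc k) / M k)"
    by (rule incseq_SucI) (use logconvex pos in \<open>simp add: divide_simps power2_eq_square mult.commute\<close>)
  have ratio: "M (n + j) \<le> M n * r ^ j" if "n + j \<le> Suc N" for j
    using that
  proof (induction j)
    case (Suc j)
    have "M (n + Suc j) = M (n + j) * (M (Suc (n + j)) / M (n + j))"
      using pos[of "n + j"] by simp
    also have "\<dots> \<le> M (n + j) * r"
      unfolding r_def using Suc.prems pos[of "n + j"]
      by (intro mult_left_mono incseqD[OF mono]) auto
    also have "\<dots> \<le> (M n * r ^ j) * r"
      using Suc r by (intro mult_right_mono) auto
    finally show ?case by (simp add: mult_ac)
  qed simp
  define m where "m = Suc N - n"
  have m: "n + m = Suc N" "0 < m" using True by (auto simp: m_def)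
  define e where "e = exp (- real (Suc N)) * exp (real n) * M n"
  have term_bound: "\<bar>v\<bar> / fact j * h ^ j \<le> e * ((exp 1 * r * h) ^ j / fact j)"
    if "j \<le> m" "\<bar>v\<bar> \<le> exp (- real (Suc N)) * exp (real (n + j)) * M (n + j)" for v j
  proof -
    have "\<bar>v\<bar> \<le> exp (- real (Suc N)) * exp (real (n + j)) * (M n * r ^ j)"
      using that(2) ratio[of j] that(1) m
      by (intro order_trans[OF that(2)] mult_left_mono) auto
    also have "exp (real (n + j)) = exp (real n) * exp 1 ^ j"
      by (simp add: exp_add flip: exp_of_nat_mult)
    finally have "\<bar>v\<bar> \<le> e * (exp 1 * r) ^ j"
      by (simp add: e_def power_mult_distrib mult_ac)
    then have "\<bar>v\<bar> * (h ^ j / fact j) \<le> e * (exp 1 * r) ^ j * (h ^ j / fact j)"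
      using h by (intro mult_right_mono) auto
    then show ?thesis by (simp add: power_mult_distrib mult_ac)
  qed
  have "\<bar>F n (x + h)\<bar> \<le> (\<Sum>j\<le>m. e * ((exp 1 * r * h) ^ j / fact j))"
  proof (cases "h = 0")
    case True
    have "\<bar>F n x\<bar> \<le> (\<Sum>j\<in>{0}. e * ((exp 1 * r * h) ^ j / fact j))"
      using small[of n] by (simp add: e_def)
    also have "\<dots> \<le> (\<Sum>j\<le>m. e * ((exp 1 * r * h) ^ j / fact j))"
      using pos[of n] by (intro sum_mono2) (auto simp: e_def True intro!: mult_nonneg_nonneg less_imp_le)
    finally show ?thesis by (simp add: True)
  next
    case False
    then have "x < x + h" using h by simp
    then obtain t where t: "F n (x + h) = (\<Sum>j<m. F (n + j) x / fact j * h ^ j) + F (n + m) t / fact m * h ^ m"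
      using Taylor_up[of m "\<lambda>j. F (n + j)" "F n" x "x + h" x] m deriv by auto
    have "\<bar>F n (x + h)\<bar> \<le> (\<Sum>j<m. \<bar>F (n + j) x / fact j * h ^ j\<bar>) + \<bar>F (n + m) t / fact m * h ^ m\<bar>"
      unfolding t by (rule order_trans[OF abs_triangle_ineq]) (intro add_right_mono sum_abs)
    also have "\<dots> = (\<Sum>j<m. \<bar>F (n + j) x\<bar> / fact j * h ^ j) + \<bar>F (n + m) t\<bar> / fact m * h ^ m"
      using h by (simp add: abs_mult)
    also have "\<dots> \<le> (\<Sum>j<m. e * ((exp 1 * r * h) ^ j / fact j)) + e * ((exp 1 * r * h) ^ m / fact m)"
    proof (intro add_mono sum_mono term_bound)
      show "\<bar>F (n + j) x\<bar> \<le> exp (- real (Suc N)) * exp (real (n + j)) * M (n + j)" for j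
        by (rule small)
      show "\<bar>F (n + m) t\<bar> \<le> exp (- real (Suc N)) * exp (real (n + m)) * M (n + m)"
        using bound[of "Suc N" t] unfolding m by (simp flip: exp_add)
    qed auto
    finally show ?thesis by (simp add: lessThan_Suc_atMost[symmetric])
  qed
  also have "\<dots> = e * (\<Sum>j<Suc m. (exp 1 * r * h) ^ j / fact j)"
    by (simp add: sum_distrib_left lessThan_Suc_atMost)
  also have "\<dots> \<le> e * exp (exp 1 * r * h)"
    using h r pos[of n] by (intro mult_left_mono partial_exp_sum_le) (auto simp: e_def)
  also have "\<dots> \<le> e * exp 1"
  proof -
    have "exp 1 * r * h \<le> 1"
      using h pos[of N] pos[of "Suc N"] by (simp add: r_def divide_simps mult_ac)
    then show ?thesis using pos[of n] by (intro mult_left_mono) (auto simp: e_def)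
  qed
  also have "\<dots> = exp (- real N) * exp (real n) * M n"
    by (simp add: e_def mult_ac flip: exp_add)
  finally show ?thesis .
qed

text \<open>
  At \<open>0\<close> all derivatives are smaller than any level \<open>e\<^sup>-\<^sup>K\<close>.  Moving away from \<open>0\<close>, the level may rise from
  \<open>K\<close> to \<open>N\<close> in steps whose lengths add up to \<open>X N K\<close>; since the sum of the step lengths diverges, for every
  \<open>N\<close> there is a \<open>K\<close> such that this includes the point \<open>x\<close>.
\<close>

theorem denjoy_carleman:
  fixes F :: "nat \<Rightarrow> real \<Rightarrow> real" and M :: "nat \<Rightarrow> real"
  assumes deriv: "\<And>n x. (F n has_real_derivative F (Suc n) x) (at x)"
    and bound: "\<And>n x. \<bar>F n x\<bar> \<le> M n" and pos: "\<And>n. 0 < M n"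
    and logconvex: "\<And>n. (M (Suc n))\<^sup>2 \<le> M n * M (Suc (Suc n))"
    and zero: "\<And>n. F n 0 = 0"
    and diverge: "\<not> summable (\<lambda>n. M n / M (Suc n))" and x: "0 \<le> x"
  shows "F 0 x = 0"
proof -
  define X where "X N K = (\<Sum>k=N..<K. M k / (exp 1 * M (Suc k)))" for N K
  have small: "\<bar>F n y\<bar> \<le> exp (- real N) * exp (real n) * M n" if "N \<le> K" "0 \<le> y" "y \<le> X N K" for N K n y
    using that
  proof (induction N arbitrary: y n rule: inc_induct)
    case base
    then have "y = 0" by (simp add: X_def)
    then show ?case using zero pos[of n] by simp
  next
    case (step N)
    define x0 where "x0 = min y (X (Suc N) K)"
    have split: "X N K = M N / (exp 1 * M (Suc N)) + X (Suc N) K"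
      unfolding X_def using step.hyps by (simp add: sum.atLeast_Suc_lessThan)
    have "0 \<le> X (Suc N) K"
      unfolding X_def by (intro sum_nonneg) (use pos in \<open>simp add: less_imp_le\<close>)
    then have small: "\<bar>F n x0\<bar> \<le> exp (- real (Suc N)) * exp (real n) * M n" for n
      using step.prems by (intro step.IH) (auto simp: x0_def)
    have "\<bar>F n (x0 + (y - x0))\<bar> \<le> exp (- real N) * exp (real n) * M n"
    proof (rule bang_step[where F = F and M = M and N = N])
      show "0 \<le> y - x0" "y - x0 \<le> M N / (exp 1 * M (Suc N))"
        using step.prems split pos[of N] pos[of "Suc N"] by (auto simp: x0_def min_def)
    qed (rule deriv bound pos logconvex small)+
    then show ?case by simp
  qed
  have "\<bar>F 0 x\<bar> \<le> exp (- real N) * M 0" for N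
  proof -
    have "\<exists>K\<ge>N. x \<le> X N K"
    proof (rule ccontr)
      assume contr: "\<not> (\<exists>K\<ge>N. x \<le> X N K)"
      have le: "X N K \<le> x" if "N \<le> K" for K
        using that contr by (meson linorder_le_cases)
      have "(\<Sum>k<K. M (k + N) / M (Suc (k + N))) \<le> exp 1 * x" for K
      proof -
        have "(\<Sum>k<K. M (k + N) / M (Suc (k + N))) = exp 1 * X N (K + N)"
          unfolding X_def sum_distrib_left
          by (rule sum.reindex_bij_witness[of _ "\<lambda>k. k - N" "\<lambda>k. k + N"]) auto
        then show ?thesis using le[of "K + N"] by simp
      qed
      then have bounded: "(\<Sum>k\<le>K. M (k + N) / M (Suc (k + N))) \<le> exp 1 * x" for K
        unfolding lessThan_Suc_atMost[symmetric] .
      have "summable (\<lambda>k. M (k + N) / M (Suc (k + N)))"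
      proof (rule bounded_imp_summable[of _ "exp 1 * x"])
        show "0 \<le> M (k + N) / M (Suc (k + N))" for k
          using pos[of "k + N"] pos[of "Suc (k + N)"] by simp
      qed (rule bounded)
      then show False
        using diverge summable_iff_shift[of "\<lambda>n. M n / M (Suc n)" N] by simp
    qed
    then show ?thesis using small[of N _ x 0] x by auto
  qed
  moreover have "(\<lambda>N. exp (- real N) * M 0) \<longlonglongrightarrow> 0"
    by real_asymp
  ultimately have "\<bar>F 0 x\<bar> \<le> 0"
    by (intro LIMSEQ_le_const) auto
  then show ?thesis by simp
qed

text \<open>
  Polya's proof: weights \<open>c\<^sub>k\<close> are inserted before the inequality of the arithmetic and the geometric mean
  is used.  The product of \<open>c\<^sub>0, \<dots>, c\<^sub>n\<close> is \<open>(n + 2)\<^sup>n\<^sup>+\<^sup>1\<close>, so that the factors that appear telescope, as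
  \<open>1 / ((n + 1) (n + 2))\<close> is a difference, and \<open>c\<^sub>k \<le> e (k + 1)\<close> bounds what remains.
\<close>

theorem carleman_inequality:
  fixes a :: "nat \<Rightarrow> real"
  assumes pos: "\<And>n. 0 < a n" and a: "summable a"
  shows "summable (\<lambda>n. root (Suc n) (\<Prod>k\<le>n. a k))"
proof -
  define c where "c k = real (k + 2) ^ (k + 1) / real (k + 1) ^ k" for k
  have cpos: "0 < c k" for k by (simp add: c_def)
  have cprod: "(\<Prod>k\<le>n. c k) = real (n + 2) ^ (n + 1)" for n
  proof (induction n)
    case (Suc n)
    have "(\<Prod>k\<le>Suc n. c k) = real (n + 2) ^ (n + 1) * c (Suc n)"
      by (simp only: prod.atMost_Suc Suc.IH)
    also have "c (Suc n) = real (Suc n + 2) ^ (Suc n + 1) / real (n + 2) ^ (n + 1)"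
      by (simp add: c_def)
    finally show ?case by simp
  qed (simp add: c_def)
  have cle: "c k / real (k + 1) \<le> exp 1" for k
  proof -
    have "c k / real (k + 1) = (real (k + 2) / real (k + 1)) ^ (k + 1)"
      by (simp add: c_def power_divide)
    also have "real (k + 2) / real (k + 1) = 1 + 1 / real (k + 1)"
      by (simp add: field_simps)
    finally have "c k / real (k + 1) = (1 + 1 / real (k + 1)) ^ (k + 1)" .
    also have "(1 + 1 / real (k + 1)) ^ (k + 1) \<le> exp (1 / real (k + 1)) ^ (k + 1)"
      by (intro power_mono exp_ge_add_one_self) auto
    also have "\<dots> = exp 1"
      by (subst exp_of_nat_mult[symmetric]) (simp del: of_nat_add)
    finally show ?thesis .
  qed
  define g where "g n = root (Suc n) (\<Prod>k\<le>n. a k)" for n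
  have gle: "g n \<le> (\<Sum>k\<le>n. c k * a k) / (real (n + 1) * real (n + 2))" for n
  proof -
    have "root (Suc n) (\<Prod>k\<le>n. c k * a k) = real (n + 2) * g n"
      by (simp only: prod.distrib cprod g_def real_root_mult) (simp add: real_root_power_cancel del: power_Suc)
    moreover have "root (Suc n) (\<Prod>k\<le>n. c k * a k) \<le> (\<Sum>k\<le>n. c k * a k) / real (n + 1)"
    proof -
      have "root (Suc n) (\<Prod>k\<le>n. c k * a k) = (\<Prod>k\<le>n. c k * a k) powr (1 / card {..n})"
        using prod_pos[of "{..n}" "\<lambda>k. c k * a k"] pos cpos
        by (subst root_powr_inverse) (auto simp: inverse_eq_divide)
      also have "\<dots> \<le> (\<Sum>k\<le>n. c k * a k / card {..n})"
        using pos cpos by (intro arith_geom_mean) (auto intro!: mult_nonneg_nonneg less_imp_le)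
      finally show ?thesis by (simp add: sum_divide_distrib)
    qed
    ultimately have "real (n + 2) * g n \<le> (\<Sum>k\<le>n. c k * a k) / real (n + 1)" by simp
    moreover have "z \<le> S / (x * y)" if "y * z \<le> S / x" "0 < x" "0 < y" for x y z S :: real
      using that by (simp add: field_simps)
    ultimately show ?thesis by simp
  qed
  have "(\<Sum>n\<le>N. g n) \<le> (\<Sum>k\<le>N. c k * a k * (1 / real (k + 1) - 1 / real (N + 2)))" for N
  proof (induction N)
    case 0
    then show ?case using gle[of 0] by (simp add: field_simps)
  next
    case (Suc N)
    define S where "S = (\<Sum>k\<le>Suc N. c k * a k)"
    have tel: "1 / (real (Suc N + 1) * real (Suc N + 2)) = 1 / real (N + 2) - 1 / real (Suc N + 2)"
      by (simp add: field_simps)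
    have "(\<Sum>n\<le>Suc N. g n) \<le> (\<Sum>k\<le>N. c k * a k * (1 / real (k + 1) - 1 / real (N + 2))) + S * (1 / (real (Suc N + 1) * real (Suc N + 2)))"
      using Suc gle[of "Suc N"] by (simp add: S_def del: sum.atMost_Suc add: sum.atMost_Suc[of g])
    also have "(\<Sum>k\<le>N. c k * a k * (1 / real (k + 1) - 1 / real (N + 2)))
        = (\<Sum>k\<le>Suc N. c k * a k * (1 / real (k + 1) - 1 / real (N + 2)))"
      by simp
    also have "\<dots> + S * (1 / (real (Suc N + 1) * real (Suc N + 2)))
        = (\<Sum>k\<le>Suc N. c k * a k * (1 / real (k + 1) - 1 / real (Suc N + 2)))"
      unfolding tel S_def sum_distrib_right sum.distrib[symmetric]
      by (intro sum.cong refl) (simp add: right_diff_distrib)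
    finally show ?case .
  qed
  also have "(\<Sum>k\<le>N. c k * a k * (1 / real (k + 1) - 1 / real (N + 2))) \<le> exp 1 * (\<Sum>k\<le>N. a k)" for N
    unfolding sum_distrib_left
  proof (rule sum_mono)
    fix k
    have "c k * a k * (1 / real (k + 1) - 1 / real (N + 2)) \<le> c k * a k * (1 / real (k + 1))"
      using pos[of k] cpos[of k] by (intro mult_left_mono) auto
    also have "\<dots> = c k / real (k + 1) * a k" by simp
    also have "\<dots> \<le> exp 1 * a k"
      using pos[of k] by (intro mult_right_mono cle) auto
    finally show "c k * a k * (1 / real (k + 1) - 1 / real (N + 2)) \<le> exp 1 * a k" .
  qed
  also have "exp 1 * (\<Sum>k\<le>N. a k) \<le> exp 1 * suminf a" for N
    using pos by (intro mult_left_mono sum_le_suminf a) (auto intro: less_imp_le)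
  finally have "(\<Sum>n\<le>N. g n) \<le> exp 1 * suminf a" for N .
  moreover have "0 \<le> g n" for n
    unfolding g_def by (intro real_root_ge_zero prod_nonneg) (use pos in \<open>auto intro: less_imp_le\<close>)
  ultimately show ?thesis
    unfolding g_def[symmetric] by (intro bounded_imp_summable) auto
qed

section \<open>Determinacy of Stieltjes moment sequences\<close>

text \<open>
  The Cauchy--Schwarz inequality for the square roots of \<open>f\<close> and \<open>g\<close>.
\<close>

lemma integral_geometric_mean:
  fixes f g h :: "real \<Rightarrow> real"
  assumes int: "integrable M f" "integrable M g" "integrable M h"
    and nonneg: "\<And>x. 0 \<le> f x" "\<And>x. 0 \<le> g x" and le: "\<And>x. (h x)\<^sup>2 \<le> f x * g x"
    and pos: "0 < (\<integral>x. f x \<partial>M)" "0 < (\<integral>x. g x \<partial>M)"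
  shows "(\<integral>x. h x \<partial>M) \<le> sqrt ((\<integral>x. f x \<partial>M) * (\<integral>x. g x \<partial>M))"
proof -
  define A B where "A = (\<integral>x. f x \<partial>M)" and "B = (\<integral>x. g x \<partial>M)"
  \<comment> \<open>With this scaling \<open>c f\<close> and \<open>g / c\<close> have equal integrals, and
    the arithmetic mean loses nothing.\<close>
  define c where "c = sqrt (B / A)"
  have AB: "0 < A" "0 < B" using pos by (simp_all add: A_def B_def)
  have c: "0 < c" using AB by (simp add: c_def)
  have "h x \<le> (c * f x + g x / c) / 2" for x
  proof -
    have "h x \<le> sqrt (f x * g x)"
      by (rule real_le_rsqrt[OF le])
    also have "\<dots> = sqrt ((c * f x) * (g x / c))"
      using c by simp
    also have "\<dots> \<le> (c * f x + g x / c) / 2"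
      using c nonneg by (intro arith_geo_mean_sqrt) auto
    finally show ?thesis .
  qed
  then have "(\<integral>x. h x \<partial>M) \<le> (\<integral>x. (c * f x + g x / c) / 2 \<partial>M)"
    using int by (intro integral_mono) auto
  also have "\<dots> = (c * A + B / c) / 2"
    using int by (simp add: A_def B_def)
  also have "c * A = sqrt (A * B)"
    using AB by (simp add: c_def real_sqrt_divide real_sqrt_mult field_simps)
  also have "B / c = sqrt (A * B)"
    using AB by (simp add: c_def real_sqrt_divide real_sqrt_mult field_simps)
  finally show ?thesis by (simp add: A_def B_def)
qed

text \<open>
  The remainder must be uniform in \<open>z\<close>; it comes from the second order estimate for the complex
  exponential function, rotated by \<open>z\<close>.
\<close>

lemma cos_second_order: "\<bar>cos (z + d) - cos z + d * sin z\<bar> \<le> d\<^sup>2 / (2::real)"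
proof -
  have "cos (z + d) - cos z + d * sin z = Re (cis z * (iexp d - (\<Sum>k\<le>1. (\<i> * d) ^ k / fact k)))"
    by (simp add: cis_conv_exp[symmetric] cos_add algebra_simps)
  also have "\<bar>\<dots>\<bar> \<le> cmod (cis z * (iexp d - (\<Sum>k\<le>1. (\<i> * d) ^ k / fact k)))"
    by (rule abs_Re_le_cmod)
  also have "\<dots> = cmod (iexp d - (\<Sum>k\<le>1. (\<i> * d) ^ k / fact k))"
    by (simp only: norm_mult norm_cis mult_1)
  also have "\<dots> \<le> \<bar>d\<bar> ^ Suc 1 / fact (Suc 1)"
    by (rule iexp_approx1)
  finally show ?thesis by (simp add: power2_eq_square)
qed

locale even_moments = finite_measure M for M :: "real measure" +
  assumes sets_M [measurable_cong, simp]: "sets M = sets borel"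
    and even_integrable: "\<And>n. integrable M (\<lambda>y. y ^ (2 * n))"
begin

lemma integrable_abs_power: "integrable M (\<lambda>y. \<bar>y\<bar> ^ k)"
proof (rule Bochner_Integration.integrable_bound)
  show "integrable M (\<lambda>y. 1 + y ^ (2 * k))"
    using even_integrable by simp
  have "\<bar>y\<bar> ^ k \<le> 1 + y ^ (2 * k)" for y :: real
  proof -
    have "0 \<le> (\<bar>y\<bar> ^ k - 1)\<^sup>2 + (\<bar>y\<bar> ^ k)\<^sup>2 + 1" by simp
    then have "2 * \<bar>y\<bar> ^ k \<le> 2 * ((\<bar>y\<bar> ^ k)\<^sup>2 + 1)"
      by (simp add: power2_diff)
    also have "(\<bar>y\<bar> ^ k)\<^sup>2 = y ^ (2 * k)"
      by (simp add: power_mult[symmetric] mult.commute[of k] power_mult power2_eq_square flip: power_mult_distrib power_abs)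
    finally show ?thesis by simp
  qed
  then show "AE y in M. norm (\<bar>y\<bar> ^ k) \<le> norm (1 + y ^ (2 * k))"
    by (intro AE_I2) (simp add: abs_le_iff order_trans[OF _ abs_ge_self])
qed measurable

lemma integrable_times_cos: "integrable M (\<lambda>y. y ^ k * cos (f y))" if [measurable]: "f \<in> borel_measurable borel"
proof (rule Bochner_Integration.integrable_bound[OF integrable_abs_power[of k]])
  show "AE y in M. norm (y ^ k * cos (f y)) \<le> norm (\<bar>y\<bar> ^ k)"
    by (intro AE_I2) (simp add: abs_mult power_abs mult_left_le)
qed measurable

text \<open>
  The \<open>k\<close>-th derivative of the cosine transform.  The phase \<open>k \<pi> / 2\<close> combines the four derivatives of the
  cosine into one formula.
\<close>

definition cos_deriv :: "nat \<Rightarrow> real \<Rightarrow> real"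
  where "cos_deriv k x = (\<integral>y. y ^ k * cos (x * y + real k * (pi / 2)) \<partial>M)"

lemma cos_deriv_bound: "\<bar>cos_deriv k x\<bar> \<le> (\<integral>y. \<bar>y\<bar> ^ k \<partial>M)"
proof -
  have "\<bar>cos_deriv k x\<bar> \<le> (\<integral>y. \<bar>y ^ k * cos (x * y + real k * (pi / 2))\<bar> \<partial>M)"
    unfolding cos_deriv_def by (rule integral_abs_bound)
  also have "\<dots> \<le> (\<integral>y. \<bar>y\<bar> ^ k \<partial>M)"
    by (intro integral_mono integrable_abs integrable_times_cos integrable_abs_power)
      (auto simp: abs_mult power_abs mult_left_le)
  finally show ?thesis .
qed

lemma cos_deriv_has_derivative: "(cos_deriv k has_real_derivative cos_deriv (Suc k) x) (at x)"
proof -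
  define c where "c = (\<integral>y. \<bar>y\<bar> ^ (k + 2) \<partial>M)"
  have est: "\<bar>cos_deriv k (x + h) - cos_deriv k x - h * cos_deriv (Suc k) x\<bar> \<le> h\<^sup>2 / 2 * c" for h
  proof -
    let ?z = "\<lambda>y. x * y + real k * (pi / 2)"
    have eq: "y ^ k * cos ((x + h) * y + real k * (pi / 2)) - y ^ k * cos (?z y)
        - h * (y ^ Suc k * cos (x * y + real (Suc k) * (pi / 2)))
      = y ^ k * (cos (?z y + h * y) - cos (?z y) + (h * y) * sin (?z y))" for y
    proof -
      have suc: "x * y + real (Suc k) * (pi / 2) = ?z y + pi / 2"
        by (simp add: field_simps)
      have "cos (x * y + real (Suc k) * (pi / 2)) = - sin (?z y)"
        unfolding suc cos_add by simp
      moreover have "(x + h) * y + real k * (pi / 2) = ?z y + h * y"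
        by (simp add: algebra_simps)
      ultimately show ?thesis by (simp add: algebra_simps)
    qed
    have int: "integrable M (\<lambda>y. y ^ k * cos ((x + h) * y + real k * (pi / 2)))"
      "integrable M (\<lambda>y. y ^ k * cos (?z y))"
      "integrable M (\<lambda>y. y ^ Suc k * cos (x * y + real (Suc k) * (pi / 2)))"
      by (intro integrable_times_cos; measurable)+
    have "cos_deriv k (x + h) - cos_deriv k x - h * cos_deriv (Suc k) x
      = (\<integral>y. y ^ k * cos ((x + h) * y + real k * (pi / 2)) - y ^ k * cos (?z y)
        - h * (y ^ Suc k * cos (x * y + real (Suc k) * (pi / 2))) \<partial>M)"
      unfolding cos_deriv_def
      by (simp only: Bochner_Integration.integral_diff[OF Bochner_Integration.integrable_diff[OF int(1,2)] integrable_mult_right[OF int(3)]]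
          Bochner_Integration.integral_diff[OF int(1,2)] Bochner_Integration.integral_mult_right[OF int(3)])
    also have "\<dots> = (\<integral>y. y ^ k * (cos (?z y + h * y) - cos (?z y) + (h * y) * sin (?z y)) \<partial>M)"
      by (intro Bochner_Integration.integral_cong refl) (rule eq)
    finally have "\<bar>cos_deriv k (x + h) - cos_deriv k x - h * cos_deriv (Suc k) x\<bar>
        \<le> (\<integral>y. \<bar>y ^ k * (cos (?z y + h * y) - cos (?z y) + (h * y) * sin (?z y))\<bar> \<partial>M)"
      by (simp only: integral_abs_bound)
    also have "\<dots> \<le> (\<integral>y. h\<^sup>2 / 2 * \<bar>y\<bar> ^ (k + 2) \<partial>M)"
    proof (rule integral_mono)
      show "integrable M (\<lambda>y. \<bar>y ^ k * (cos (?z y + h * y) - cos (?z y) + (h * y) * sin (?z y))\<bar>)"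
      proof (rule integrable_abs, rule Bochner_Integration.integrable_cong[OF refl eq, THEN iffD1])
        show "integrable M (\<lambda>y. y ^ k * cos ((x + h) * y + real k * (pi / 2)) - y ^ k * cos (?z y)
            - h * (y ^ Suc k * cos (x * y + real (Suc k) * (pi / 2))))"
          by (intro Bochner_Integration.integrable_diff integrable_mult_right int)
      qed
      show "integrable M (\<lambda>y. h\<^sup>2 / 2 * \<bar>y\<bar> ^ (k + 2))"
        by (intro integrable_mult_right integrable_abs_power)
      fix y
      have "\<bar>y\<bar> ^ k * \<bar>cos (?z y + h * y) - cos (?z y) + (h * y) * sin (?z y)\<bar> \<le> \<bar>y\<bar> ^ k * ((h * y)\<^sup>2 / 2)"
        by (intro mult_left_mono cos_second_order) simp
      also have "\<dots> = h\<^sup>2 / 2 * \<bar>y\<bar> ^ (k + 2)"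
        unfolding power_mult_distrib power_add power2_abs by simp
      finally show "\<bar>y ^ k * (cos (?z y + h * y) - cos (?z y) + (h * y) * sin (?z y))\<bar> \<le> h\<^sup>2 / 2 * \<bar>y\<bar> ^ (k + 2)"
        by (simp add: abs_mult power_abs)
    qed
    finally show ?thesis by (simp add: c_def)
  qed
  have "(\<lambda>h. (cos_deriv k (x + h) - cos_deriv k x) / h - cos_deriv (Suc k) x) \<midarrow>0\<rightarrow> 0"
  proof (rule Lim_null_comparison)
    show "\<forall>\<^sub>F h in at 0. norm ((cos_deriv k (x + h) - cos_deriv k x) / h - cos_deriv (Suc k) x) \<le> \<bar>h\<bar> / 2 * c"
    proof (rule eventually_at_filter[THEN iffD2, OF always_eventually], intro allI impI)
      fix h :: real assume "h \<noteq> 0"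
      then have "norm ((cos_deriv k (x + h) - cos_deriv k x) / h - cos_deriv (Suc k) x)
        = \<bar>cos_deriv k (x + h) - cos_deriv k x - h * cos_deriv (Suc k) x\<bar> / \<bar>h\<bar>"
        by (simp add: abs_divide[symmetric] diff_divide_distrib)
      also have "\<dots> \<le> (h\<^sup>2 / 2 * c) / \<bar>h\<bar>"
        by (intro divide_right_mono est) simp
      also have "\<dots> = \<bar>h\<bar> / 2 * c"
      proof -
        have "h\<^sup>2 = \<bar>h\<bar> * \<bar>h\<bar>" by (simp add: power2_eq_square)
        moreover have "a * a / 2 * c / a = a / 2 * c" if "a \<noteq> 0" for a :: real
          using that by (simp add: field_simps)
        ultimately show ?thesis using \<open>h \<noteq> 0\<close> by (metis abs_0_eq)
      qed
      finally show "norm ((cos_deriv k (x + h) - cos_deriv k x) / h - cos_deriv (Suc k) x) \<le> \<bar>h\<bar> / 2 * c" .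
    qed
    show "((\<lambda>h. \<bar>h\<bar> / 2 * c) \<longlongrightarrow> 0) (at (0::real))"
      by (auto intro!: tendsto_eq_intros)
  qed
  then show ?thesis
    unfolding DERIV_def by (simp add: LIM_zero_iff)
qed

lemma cos_deriv_0: "cos_deriv k 0 = cos (real k * (pi / 2)) * (\<integral>y. y ^ k \<partial>M)"
  by (simp add: cos_deriv_def)

end

text \<open>
  The difference \<open>F 0\<close> of the two transforms is flat at \<open>0\<close>: its even derivatives there are differences of
  moments, and the odd ones vanish by symmetry.  The bounds \<open>m k\<close> of its derivatives are twice the
  moments for even \<open>k\<close> and geometric means of their neighbours for odd \<open>k\<close>, which makes them logarithmically
  convex; half of the quotients \<open>m k / m (k + 1)\<close> are the terms of the divergent series.
\<close>

theorem cos_transform_eq_if_even_moments_eq: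
  assumes M: "even_moments M" and N: "even_moments N"
    and tM: "\<And>n. (\<integral>y. y ^ (2 * n) \<partial>M) = t n" and tN: "\<And>n. (\<integral>y. y ^ (2 * n) \<partial>N) = t n"
    and pos: "\<And>n. 0 < t n" and diverge: "\<not> summable (\<lambda>n. sqrt (t n / t (Suc n)))"
  shows "(\<integral>y. cos (x * y) \<partial>M) = (\<integral>y. cos (x * y) \<partial>N)"
proof -
  interpret M: even_moments M by fact
  interpret N: even_moments N by fact
  define F where "F k x = M.cos_deriv k x - N.cos_deriv k x" for k x
  define m where "m k = (if even k then 2 * t (k div 2) else 2 * sqrt (t (k div 2) * t (Suc (k div 2))))" for k
  have m_even: "m (2 * n) = 2 * t n" and m_odd: "m (Suc (2 * n)) = 2 * sqrt (t n * t (Suc n))" for n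
    by (simp_all add: m_def)
  have mpos: "0 < m k" for k using pos by (simp add: m_def)
  have abs_even: "\<bar>y\<bar> ^ (2 * n) = y ^ (2 * n)" for y :: real and n
    by (simp add: power_mult)
  have odd_le: "(\<integral>y. \<bar>y\<bar> ^ Suc (2 * n) \<partial>L) \<le> sqrt (t n * t (Suc n))"
    if "even_moments L" "\<And>n. (\<integral>y. y ^ (2 * n) \<partial>L) = t n" for L n
  proof -
    interpret L: even_moments L by fact
    have "(\<integral>y. \<bar>y\<bar> ^ Suc (2 * n) \<partial>L) \<le> sqrt ((\<integral>y. y ^ (2 * n) \<partial>L) * (\<integral>y. y ^ (2 * Suc n) \<partial>L))"
    proof (rule integral_geometric_mean)
      show "(\<bar>y\<bar> ^ Suc (2 * n))\<^sup>2 \<le> y ^ (2 * n) * y ^ (2 * Suc n)" for y :: real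
      proof -
        have "(\<bar>y\<bar> ^ Suc (2 * n))\<^sup>2 = \<bar>y\<bar> ^ (2 * n) * \<bar>y\<bar> ^ (2 * Suc n)"
          by (simp add: power2_eq_square flip: power_add power_Suc)
        then show ?thesis by (simp only: abs_even order_refl)
      qed
    qed (use that pos L.even_integrable L.integrable_abs_power in \<open>auto simp del: power_Suc mult_Suc_right\<close>)
    then show ?thesis by (simp only: that(2))
  qed
  have logconvex_t: "t (Suc n) \<le> sqrt (t n * t (Suc (Suc n)))" for n
  proof -
    have "(\<integral>y. y ^ (2 * Suc n) \<partial>M) \<le> sqrt ((\<integral>y. y ^ (2 * n) \<partial>M) * (\<integral>y. y ^ (2 * Suc (Suc n)) \<partial>M))"
    proof (rule integral_geometric_mean)
      show "(y ^ (2 * Suc n))\<^sup>2 \<le> y ^ (2 * n) * y ^ (2 * Suc (Suc n))" for y :: real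
        by (simp add: power2_eq_square flip: power_add power_Suc)
    qed (use tM pos M.even_integrable in \<open>auto simp del: power_Suc mult_Suc_right\<close>)
    then show ?thesis by (simp only: tM)
  qed
  have logconvex: "(m (Suc k))\<^sup>2 \<le> m k * m (Suc (Suc k))" for k
  proof (cases "even k")
    case True
    then obtain n where k: "k = 2 * n" by blast
    have "m (Suc (Suc (2 * n))) = 2 * t (Suc n)"
      using m_even[of "Suc n"] by simp
    then show ?thesis
      using pos[of n] pos[of "Suc n"] by (simp add: k m_even m_odd power_mult_distrib)
  next
    case False
    then obtain n where k: "k = Suc (2 * n)" by (metis oddE Suc_eq_plus1)
    have "m (Suc (Suc (2 * n))) = 2 * t (Suc n)" "m (Suc (Suc (Suc (2 * n)))) = 2 * sqrt (t (Suc n) * t (Suc (Suc n)))"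
      using m_even[of "Suc n"] m_odd[of "Suc n"] by simp_all
    moreover have "(t (Suc n))\<^sup>2 \<le> sqrt (t n * t (Suc n)) * sqrt (t (Suc n) * t (Suc (Suc n)))"
    proof -
      have "(t (Suc n))\<^sup>2 \<le> t (Suc n) * sqrt (t n * t (Suc (Suc n)))"
        unfolding power2_eq_square using logconvex_t pos[of "Suc n"] by (intro mult_left_mono) auto
      also have "\<dots> = sqrt (t n * t (Suc n)) * sqrt (t (Suc n) * t (Suc (Suc n)))"
        using pos[of "Suc n"] by (simp add: real_sqrt_mult)
      finally show ?thesis .
    qed
    ultimately show ?thesis
      by (simp add: k m_odd power_mult_distrib)
  qed
  have bound: "\<bar>F k x\<bar> \<le> m k" for k x
  proof -
    have "\<bar>F k x\<bar> \<le> (\<integral>y. \<bar>y\<bar> ^ k \<partial>M) + (\<integral>y. \<bar>y\<bar> ^ k \<partial>N)"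
      unfolding F_def using M.cos_deriv_bound[of k x] N.cos_deriv_bound[of k x] by linarith
    also have "\<dots> \<le> m k"
    proof (cases "even k")
      case True
      then obtain n where "k = 2 * n" by blast
      then show ?thesis using tM tN by (simp add: m_even abs_even)
    next
      case False
      then obtain n where k: "k = Suc (2 * n)" by (metis oddE Suc_eq_plus1)
      show ?thesis
        using odd_le[OF M tM, of n] odd_le[OF N tN, of n] unfolding k m_odd by linarith
    qed
    finally show ?thesis .
  qed
  have zero: "F k 0 = 0" for k
  proof (cases "even k")
    case True
    then obtain n where "k = 2 * n" by blast
    then show ?thesis by (simp add: F_def M.cos_deriv_0 N.cos_deriv_0 tM tN)
  next
    case False
    then obtain n where k: "k = Suc (2 * n)" by (metis oddE Suc_eq_plus1)
    have "cos (real k * (pi / 2)) = 0"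
      unfolding cos_zero_iff using False by (intro disjI1 exI[of _ k]) simp
    then show ?thesis by (simp add: F_def M.cos_deriv_0 N.cos_deriv_0)
  qed
  have div: "\<not> summable (\<lambda>k. m k / m (Suc k))"
  proof
    assume "summable (\<lambda>k. m k / m (Suc k))"
    then have "summable ((\<lambda>k. m k / m (Suc k)) \<circ> (\<lambda>n. 2 * n))"
      by (rule summable_reindex) (use mpos in \<open>auto simp: inj_on_def less_imp_le\<close>)
    also have "(\<lambda>k. m k / m (Suc k)) \<circ> (\<lambda>n. 2 * n) = (\<lambda>n. sqrt (t n / t (Suc n)))"
    proof
      fix n
      have "((\<lambda>k. m k / m (Suc k)) \<circ> (\<lambda>n. 2 * n)) n = t n / sqrt (t n) / sqrt (t (Suc n))"
        by (simp add: m_even m_odd real_sqrt_mult del: real_div_sqrt)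
      then show "((\<lambda>k. m k / m (Suc k)) \<circ> (\<lambda>n. 2 * n)) n = sqrt (t n / t (Suc n))"
        using pos[of n] by (simp only: real_div_sqrt less_imp_le real_sqrt_divide)
    qed
    finally show False using diverge by simp
  qed
  have deriv: "(F k has_real_derivative F (Suc k) x) (at x)" for k x
    unfolding F_def[abs_def] by (intro DERIV_diff M.cos_deriv_has_derivative N.cos_deriv_has_derivative)
  have "F 0 \<bar>x\<bar> = 0"
    by (rule denjoy_carleman[of F m, OF deriv bound mpos logconvex zero div]) simp
  moreover have "cos (\<bar>x\<bar> * y) = cos (x * y)" for y
    by (simp add: abs_if)
  ultimately show ?thesis
    by (simp add: F_def M.cos_deriv_def N.cos_deriv_def)
qed

text \<open>
  The law of the square root of \<open>s\<close> with a random sign.  Its characteristic function is the cosine transform, so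
  the uniqueness theorem for characteristic functions applies to it.
\<close>

definition symmetrized_root :: "real measure \<Rightarrow> real measure"
  where "symmetrized_root M = distr (M \<Otimes>\<^sub>M measure_pmf (bernoulli_pmf (1/2))) borel
    (\<lambda>(s, b). if b then sqrt s else - sqrt s)"

lemma measurable_signed_root:
  assumes [measurable_cong]: "sets M = sets borel_nonneg"
  shows "(\<lambda>(s, b). if b then sqrt s else - sqrt s) \<in> borel_measurable (M \<Otimes>\<^sub>M measure_pmf (bernoulli_pmf (1/2)))"
proof -
  have [measurable]: "(\<lambda>s. s) \<in> borel_measurable M"
    using measurable_restrict_space1[of "\<lambda>s. s" borel borel "{0..}"] by (simp cong: measurable_cong_sets add: assms)
  have [measurable]: "sqrt \<in> borel_measurable M"
    by measurable
  show ?thesis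
    unfolding split_beta by measurable
qed

lemma real_distribution_symmetrized_root:
  assumes "prob_space M" and sets: "sets M = sets borel_nonneg"
  shows "real_distribution (symmetrized_root M)"
proof -
  interpret pair_prob_space M "measure_pmf (bernoulli_pmf (1/2))"
    using assms by (simp add: pair_prob_space_def pair_sigma_finite_def prob_space_imp_sigma_finite measure_pmf.prob_space_axioms)
  have "prob_space (symmetrized_root M)"
    unfolding symmetrized_root_def by (rule prob_space_distr[OF measurable_signed_root[OF sets]])
  then show ?thesis
    by (simp add: real_distribution_def real_distribution_axioms_def symmetrized_root_def)
qed

lemma char_symmetrized_root:
  assumes "prob_space M" and sets: "sets M = sets borel_nonneg"
  shows "char (symmetrized_root M) t = of_real (\<integral>s. cos (t * sqrt s) \<partial>M)"
proof -
  interpret pair_prob_space M "measure_pmf (bernoulli_pmf (1/2))"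
    using assms by (simp add: pair_prob_space_def pair_sigma_finite_def prob_space_imp_sigma_finite measure_pmf.prob_space_axioms)
  let ?f = "\<lambda>(s, b). if b then sqrt s else - sqrt s"
  note meas [measurable] = measurable_signed_root[OF sets]
  have "char (symmetrized_root M) t = (\<integral>p. iexp (t * ?f p) \<partial>(M \<Otimes>\<^sub>M measure_pmf (bernoulli_pmf (1/2))))"
    unfolding char_def symmetrized_root_def by (subst integral_distr) measurable
  also have "\<dots> = (\<integral>s. (\<integral>b. iexp (t * ?f (s, b)) \<partial>measure_pmf (bernoulli_pmf (1/2))) \<partial>M)"
    by (rule integral_fst'[symmetric], rule integrable_const_bound[of _ 1]) auto
  also have "\<dots> = (\<integral>s. of_real (cos (t * sqrt s)) \<partial>M)"
  proof (intro Bochner_Integration.integral_cong refl)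
    fix s
    show "(\<integral>b. iexp (t * ?f (s, b)) \<partial>measure_pmf (bernoulli_pmf (1/2))) = of_real (cos (t * sqrt s))"
      by (subst integral_measure_pmf[of UNIV])
        (auto simp: UNIV_bool complex_eq_iff Re_exp Im_exp)
  qed
  also have "\<dots> = of_real (\<integral>s. cos (t * sqrt s) \<partial>M)"
    by (rule integral_complex_of_real)
  finally show ?thesis .
qed

lemma distr_square_symmetrized_root:
  assumes "prob_space M" and sets: "sets M = sets borel_nonneg"
  shows "distr (symmetrized_root M) borel_nonneg (\<lambda>x. x\<^sup>2) = M"
proof -
  interpret M: prob_space M by fact
  let ?P = "M \<Otimes>\<^sub>M measure_pmf (bernoulli_pmf (1/2))"
  have sp: "space M = {0..}"
    using sets_eq_imp_space_eq[OF sets] by (simp add: space_restrict_space)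
  have square: "(\<lambda>x::real. x\<^sup>2) \<in> measurable borel borel_nonneg"
    by (rule measurable_restrict_space2) auto
  have "distr (symmetrized_root M) borel_nonneg (\<lambda>x. x\<^sup>2)
    = distr ?P borel_nonneg ((\<lambda>x. x\<^sup>2) \<circ> (\<lambda>(s, b). if b then sqrt s else - sqrt s))"
    unfolding symmetrized_root_def by (rule distr_distr[OF square measurable_signed_root[OF sets]])
  also have "\<dots> = distr ?P M fst"
  proof (rule distr_cong[OF refl sets[symmetric]])
    fix p assume "p \<in> space ?P"
    then have "0 \<le> fst p" by (simp add: space_pair_measure sp mem_Times_iff)
    then show "((\<lambda>x. x\<^sup>2) \<circ> (\<lambda>(s, b). if b then sqrt s else - sqrt s)) p = fst p"
      by (simp add: split_beta)
  qed
  also have "\<dots> = M"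
    by (rule measure_pmf.distr_pair_fst)
  finally show ?thesis .
qed

text \<open>
  The value at \<open>0\<close> of the transform is the total mass; after normalization both measures can be recovered from
  their symmetrized roots by squaring.
\<close>

lemma cos_transform_determines:
  assumes fin: "finite_measure M" "finite_measure N"
    and sets: "sets M = sets borel_nonneg" "sets N = sets borel_nonneg"
    and eq: "\<And>x. (\<integral>s. cos (x * sqrt s) \<partial>M) = (\<integral>s. cos (x * sqrt s) \<partial>N)"
  shows "M = N"
proof -
  interpret M: finite_measure M by fact
  interpret N: finite_measure N by fact
  have space: "space M = space N"
    using sets by (intro sets_eq_imp_space_eq) simp
  define c where "c = measure M (space M)"
  have c: "c = measure N (space N)"
    using eq[of 0] by (simp add: c_def)
  have sqrt_meas: "(\<lambda>s. cos (x * sqrt s)) \<in> borel_measurable L" if "sets L = sets borel_nonneg" for L :: "real measure" and x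
  proof -
    have "(\<lambda>s. cos (x * sqrt s)) \<in> borel_measurable borel_nonneg"
      by (rule measurable_restrict_space1) measurable
    then show ?thesis by (simp add: that cong: measurable_cong_sets)
  qed
  show ?thesis
  proof (cases "c = 0")
    case True
    have "emeasure M (space M) = 0" "emeasure N (space N) = 0"
      using True c unfolding M.emeasure_eq_measure N.emeasure_eq_measure c_def by simp_all
    then have "emeasure M A = 0" "emeasure N A = 0" for A
      using emeasure_space[of M A] emeasure_space[of N A] by simp_all
    then show ?thesis
      using sets by (intro measure_eqI) auto
  next
    case False
    then have cpos: "0 < c"
      using measure_nonneg[of M "space M"] unfolding c_def by linarith
    have norm: "prob_space (density L (\<lambda>_. ennreal (1 / c)))"
      "(\<integral>s. cos (x * sqrt s) \<partial>density L (\<lambda>_. ennreal (1 / c))) = (\<integral>s. cos (x * sqrt s) \<partial>L) / c"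
      if L: "finite_measure L" "measure L (space L) = c" "sets L = sets borel_nonneg" for L x
    proof -
      interpret L: finite_measure L by fact
      show "prob_space (density L (\<lambda>_. ennreal (1 / c)))"
      proof
        have "emeasure (density L (\<lambda>_. ennreal (1 / c))) (space L) = ennreal (1 / c) * emeasure L (space L)"
          by (simp add: emeasure_density_const)
        also have "\<dots> = 1"
          using cpos L(2) by (simp add: L.emeasure_eq_measure flip: ennreal_mult)
        finally show "emeasure (density L (\<lambda>_. ennreal (1 / c))) (space (density L (\<lambda>_. ennreal (1 / c)))) = 1"
          by simp
      qed
      show "(\<integral>s. cos (x * sqrt s) \<partial>density L (\<lambda>_. ennreal (1 / c))) = (\<integral>s. cos (x * sqrt s) \<partial>L) / c"
        using cpos sqrt_meas[OF L(3)] by (subst integral_density) auto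
    qed
    let ?M = "density M (\<lambda>_. ennreal (1 / c))" and ?N = "density N (\<lambda>_. ennreal (1 / c))"
    have P: "prob_space ?M" "prob_space ?N" "sets ?M = sets borel_nonneg" "sets ?N = sets borel_nonneg"
      using norm(1)[OF fin(1) c_def[symmetric] sets(1)] norm(1)[OF fin(2) c[symmetric] sets(2)] sets by auto
    have "char (symmetrized_root ?M) = char (symmetrized_root ?N)"
    proof
      fix t
      show "char (symmetrized_root ?M) t = char (symmetrized_root ?N) t"
        using norm(2)[OF fin(1) c_def[symmetric] sets(1), of t] norm(2)[OF fin(2) c[symmetric] sets(2), of t] eq[of t]
        unfolding char_symmetrized_root[OF P(1,3)] char_symmetrized_root[OF P(2,4)] by simp
    qed
    then have "symmetrized_root ?M = symmetrized_root ?N"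
      by (intro Levy_uniqueness real_distribution_symmetrized_root P)
    then have dens: "?M = ?N"
      using distr_square_symmetrized_root[OF P(1,3)] distr_square_symmetrized_root[OF P(2,4)] by metis
    show ?thesis
    proof (rule measure_eqI)
      fix A assume A: "A \<in> sets M"
      have "ennreal (1 / c) * emeasure M A = ennreal (1 / c) * emeasure N A"
        using arg_cong[OF dens, of "\<lambda>L. emeasure L A"] A sets(1) sets(2)[symmetric]
        by (simp only: emeasure_density_const)
      then show "emeasure M A = emeasure N A"
        using cpos by (simp add: ennreal_mult_cancel_left)
    qed (simp add: sets)
  qed
qed

text \<open>
  The substitution \<open>y = sqrt s\<close> turns the moments into even moments.
\<close>

theorem stieltjes_carleman_determinate:
  assumes fin: "finite_measure M" "finite_measure N"
    and sets: "sets M = sets borel_nonneg" "sets N = sets borel_nonneg"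
    and M: "\<And>n. has_bochner_integral M (\<lambda>s. s ^ n) (t n)" and N: "\<And>n. has_bochner_integral N (\<lambda>s. s ^ n) (t n)"
    and pos: "\<And>n. 0 < t n" and diverge: "\<not> summable (\<lambda>n. sqrt (t n / t (Suc n)))"
  shows "M = N"
proof (rule cos_transform_determines[OF fin sets])
  fix x
  have root: "even_moments (distr L borel sqrt)" "(\<integral>y. y ^ (2 * n) \<partial>distr L borel sqrt) = t n"
    "(\<integral>y. cos (x * y) \<partial>distr L borel sqrt) = (\<integral>s. cos (x * sqrt s) \<partial>L)"
    if L: "finite_measure L" "sets L = sets borel_nonneg" "\<And>n. has_bochner_integral L (\<lambda>s. s ^ n) (t n)" for L :: "real measure" and n
  proof -
    interpret L: finite_measure L by fact
    have [measurable]: "sqrt \<in> borel_measurable L"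
    proof -
      have "sqrt \<in> borel_measurable borel_nonneg"
        by (rule measurable_restrict_space1) measurable
      then show ?thesis by (simp add: L(2) cong: measurable_cong_sets)
    qed
    have sp: "space L = {0..}"
      using sets_eq_imp_space_eq[OF L(2)] by (simp add: space_restrict_space)
    have pow: "sqrt s ^ (2 * n) = s ^ n" if "s \<in> space L" for s n
      using that by (simp add: sp power_mult)
    have "has_bochner_integral L (\<lambda>s. sqrt s ^ (2 * n)) (t n)" for n
      using L(3)[of n] by (rule has_bochner_integral_cong[THEN iffD1, rotated -1]) (auto simp: pow)
    then have int: "integrable L (\<lambda>s. sqrt s ^ (2 * n))" "(\<integral>s. sqrt s ^ (2 * n) \<partial>L) = t n" for n
      by (simp_all add: has_bochner_integral_iff)
    show "even_moments (distr L borel sqrt)"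
      using int(1) by (simp add: even_moments_def even_moments_axioms_def L.finite_measure_distr integrable_distr_eq)
    show "(\<integral>y. y ^ (2 * n) \<partial>distr L borel sqrt) = t n"
      using int(2)[of n] by (simp add: integral_distr)
    show "(\<integral>y. cos (x * y) \<partial>distr L borel sqrt) = (\<integral>s. cos (x * sqrt s) \<partial>L)"
      by (simp add: integral_distr)
  qed
  show "(\<integral>s. cos (x * sqrt s) \<partial>M) = (\<integral>s. cos (x * sqrt s) \<partial>N)"
    using cos_transform_eq_if_even_moments_eq[OF root(1)[OF fin(1) sets(1) M] root(1)[OF fin(2) sets(2) N]
        root(2)[OF fin(1) sets(1) M] root(2)[OF fin(2) sets(2) N] pos diverge, of x]
    by (simp add: root(3)[OF fin(1) sets(1) M] root(3)[OF fin(2) sets(2) N])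
qed

text \<open>
  If some moment vanishes, both measures are concentrated at \<open>0\<close> and are determined by their mass.
\<close>

lemma stieltjes_determinate:
  assumes fin: "finite_measure M" "finite_measure N"
    and sets: "sets M = sets borel_nonneg" "sets N = sets borel_nonneg"
    and M: "\<And>n. has_bochner_integral M (\<lambda>s. s ^ n) (t n)" and N: "\<And>n. has_bochner_integral N (\<lambda>s. s ^ n) (t n)"
    and diverge: "(\<And>n. 0 < t n) \<Longrightarrow> \<not> summable (\<lambda>n. sqrt (t n / t (Suc n)))"
  shows "M = N"
proof (cases "\<forall>n. 0 < t n")
  case True
  then show ?thesis
    using stieltjes_carleman_determinate[OF fin sets M N] diverge by blast
next
  case False
  then obtain n where n: "t n \<le> 0" by (auto simp: not_less)
  have conc: "AE s in L. s = 0" "emeasure L (space L) = ennreal (t 0)"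
    if L: "finite_measure L" "sets L = sets borel_nonneg" "\<And>n. has_bochner_integral L (\<lambda>s. s ^ n) (t n)" for L
  proof -
    interpret L: finite_measure L by fact
    have sp: "space L = {0..}"
      using sets_eq_imp_space_eq[OF L(2)] by (simp add: space_restrict_space)
    have int: "integrable L (\<lambda>s. s ^ n)" "(\<integral>s. s ^ n \<partial>L) = t n" for n
      using L(3)[of n] by (auto simp: has_bochner_integral_iff)
    have nonneg: "AE s in L. 0 \<le> s ^ n"
      by (rule AE_I2) (simp add: sp)
    have "(\<integral>s. s ^ n \<partial>L) = 0"
      using integral_nonneg_AE[OF nonneg] n int(2)[of n] by linarith
    then have "AE s in L. s ^ n = 0"
      using integral_nonneg_eq_0_iff_AE[OF int(1) nonneg] by blast
    then show "AE s in L. s = 0"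
      by eventually_elim auto
    show "emeasure L (space L) = ennreal (t 0)"
      using int(2)[of 0] by (simp add: L.emeasure_eq_measure)
  qed
  show ?thesis
  proof (rule measure_eqI)
    fix A assume A: "A \<in> sets M"
    have "emeasure L A = (if 0 \<in> A then ennreal (t 0) else 0)"
      if L: "finite_measure L" "sets L = sets borel_nonneg" "\<And>n. has_bochner_integral L (\<lambda>s. s ^ n) (t n)" for L
    proof -
      have AL: "A \<in> sets L" using A sets L(2) by simp
      have "emeasure L A = emeasure L (if 0 \<in> A then space L else {})"
        by (rule emeasure_eq_AE) (use conc(1)[OF L] AL in \<open>auto elim!: eventually_mono dest: sets.sets_into_space\<close>)
      then show ?thesis using conc(2)[OF L] by auto
    qed
    from this[OF fin(1) sets(1) M] this[OF fin(2) sets(2) N] show "emeasure M A = emeasure N A"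
      by simp
  qed (simp add: sets)
qed

section \<open>The Hausdorff moment problem\<close>

lemma sum_binomial_Suc:
  fixes f :: "nat \<Rightarrow> real"
  shows "(\<Sum>j\<le>Suc m. real (Suc m choose j) * f j) = (\<Sum>j\<le>m. real (m choose j) * (f j + f (Suc j)))"
proof -
  have "(\<Sum>j\<le>m. real (m choose j) * f j) = (\<Sum>j\<le>Suc m. real (m choose j) * f j)"
    by simp
  also have "\<dots> = f 0 + (\<Sum>j\<le>m. real (m choose Suc j) * f (Suc j))"
    by (subst sum.atMost_Suc_shift) simp
  finally show ?thesis
    by (subst sum.atMost_Suc_shift) (simp add: distrib_left distrib_right sum.distrib)
qed

text \<open>
  \<open>D k l\<close> stands for the integral of \<open>r\<^sup>k (1 - r)\<^sup>l\<close>; the second law is the integral of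
  \<open>r + (1 - r) = 1\<close> times such a function.
\<close>

locale hausdorff_array =
  fixes D :: "nat \<Rightarrow> nat \<Rightarrow> real"
  assumes nonneg: "0 \<le> D k l" and split: "D k l = D (Suc k) l + D k (Suc l)"
begin

text \<open>
  The integral of \<open>r\<^sup>a (1 - r)\<^sup>b (r + (1 - r))\<^sup>m\<close>, expanded by the binomial theorem.
\<close>

lemma binomial_sum: "(\<Sum>j\<le>m. real (m choose j) * D (a + j) (b + (m - j))) = D a b"
proof (induction m arbitrary: b)
  case (Suc m)
  have "(\<Sum>j\<le>Suc m. real (Suc m choose j) * D (a + j) (b + (Suc m - j)))
    = (\<Sum>j\<le>m. real (m choose j) * (D (a + j) (b + (Suc m - j)) + D (a + Suc j) (b + (Suc m - Suc j))))"
    by (rule sum_binomial_Suc)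
  also have "\<dots> = (\<Sum>j\<le>m. real (m choose j) * D (a + j) (b + (m - j)))"
  proof (intro sum.cong refl)
    fix j assume "j \<in> {..m}"
    then have "b + (Suc m - j) = Suc (b + (m - j))" by auto
    then show "real (m choose j) * (D (a + j) (b + (Suc m - j)) + D (a + Suc j) (b + (Suc m - Suc j)))
      = real (m choose j) * D (a + j) (b + (m - j))"
      using split[of "a + j" "b + (m - j)"] by simp
  qed
  finally show ?case using Suc.IH by simp
qed simp

text \<open>
  In terms of the Bernstein weights \<open>(n choose j) D j (n - j)\<close>, binomial moments are exact for every \<open>n\<close>,
  whereas power moments are correct only in the limit.
\<close>

lemma binomial_moment:
  "(\<Sum>j\<le>n. real (n choose j) * D j (n - j) * real (j choose k)) = real (n choose k) * D k 0"
proof (cases "k \<le> n")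
  case True
  have "(\<Sum>j\<le>n. real (n choose j) * D j (n - j) * real (j choose k))
    = (\<Sum>j\<in>{k..n}. real (n choose j) * D j (n - j) * real (j choose k))"
    by (rule sum.mono_neutral_right) auto
  also have "\<dots> = (\<Sum>i\<le>n - k. real (n choose (k + i)) * D (k + i) (n - (k + i)) * real ((k + i) choose k))"
    by (rule sum.reindex_bij_witness[of _ "\<lambda>i. k + i" "\<lambda>j. j - k"]) (use True in auto)
  also have "\<dots> = (\<Sum>i\<le>n - k. real (n choose k) * (real ((n - k) choose i) * D (k + i) (0 + ((n - k) - i))))"
  proof (intro sum.cong refl)
    fix i assume i: "i \<in> {..n - k}"
    have "(n choose (k + i)) * ((k + i) choose k) = (n choose k) * ((n - k) choose i)"
      using choose_mult[of k "k + i" n] i True by auto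
    then have "real (n choose (k + i)) * real ((k + i) choose k) = real (n choose k) * real ((n - k) choose i)"
      by (metis of_nat_mult)
    then show "real (n choose (k + i)) * D (k + i) (n - (k + i)) * real ((k + i) choose k)
      = real (n choose k) * (real ((n - k) choose i) * D (k + i) (0 + ((n - k) - i)))"
      by (simp add: mult_ac)
  qed
  also have "\<dots> = real (n choose k) * D k 0"
    unfolding sum_distrib_left[symmetric] by (simp only: binomial_sum)
  finally show ?thesis .
qed (simp add: binomial_eq_0)

lemma D_le: "D k l \<le> D 0 0"
proof -
  have "D k l \<le> D 0 l"
  proof (induction k)
    case (Suc k)
    then show ?case using split[of k l] nonneg[of k "Suc l"] by linarith
  qed simp
  also have "D 0 l \<le> D 0 0"
  proof (induction l)
    case (Suc l)
    then show ?case using split[of 0 l] nonneg[of "Suc 0" l] by linarith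
  qed simp
  finally show ?thesis .
qed

end

lemma choose_times_self: "real (j choose k) * real j = real (Suc k) * real (j choose Suc k) + real k * real (j choose k)"
proof (cases "k < j")
  case True
  then obtain b where j: "j = Suc (k + b)"
    using less_imp_Suc_add by blast
  have "real (Suc k) * real (j choose Suc k) = real (Suc b) * real (j choose k)"
    unfolding j of_nat_mult[symmetric] of_nat_eq_iff by (rule Suc_times_binomial_add)
  then show ?thesis by (simp add: j algebra_simps)
qed (auto simp: binomial_eq_0 not_less le_less)

lemma tendsto_choose_power:
  "(\<lambda>n. real (n choose k) / real n ^ k) \<longlonglongrightarrow> 1 / fact k"
proof (induction k)
  case (Suc k)
  have "(\<lambda>n. (real (n choose k) / real n ^ k) * ((1 - real k / real n) / real (Suc k))) \<longlonglongrightarrow> 1 / fact k * ((1 - 0) / real (Suc k))"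
    by (intro tendsto_intros Suc tendsto_divide_0[OF tendsto_const] filterlim_real_at_infinity_sequentially) auto
  moreover have "\<forall>\<^sub>F n in sequentially. (real (n choose k) / real n ^ k) * ((1 - real k / real n) / real (Suc k))
      = real (n choose Suc k) / real n ^ Suc k"
    using eventually_gt_at_top[of k]
  proof eventually_elim
    case (elim n)
    then have "real (n choose Suc k) = real (n choose k) * (real n - real k) / real (Suc k)"
      using choose_times_self[of n k] by (simp add: field_simps)
    moreover have "1 - real k / real n = (real n - real k) / real n"
      using elim by (simp add: field_simps)
    ultimately show ?case
      by (simp add: mult.commute)
  qed
  ultimately show ?case
    by (simp add: Lim_transform_eventually mult.commute)
qed simp

text \<open>
  The probability measures with the Bernstein weights \<open>q n j\<close> at the points \<open>j / n\<close> live on \<open>[0, 1]\<close>, so a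
  subsequence converges weakly by Helly's theorem.  Their power moments converge to those of \<open>D\<close>, hence the
  limit, multiplied by the mass \<open>D 0 0\<close>, has the moments \<open>D k 0\<close>.
\<close>

theorem hausdorff_measure:
  fixes D :: "nat \<Rightarrow> nat \<Rightarrow> real"
  assumes "hausdorff_array D"
  shows "\<exists>\<mu>. finite_measure \<mu> \<and> sets \<mu> = sets borel_nonneg \<and> (AE r in \<mu>. r \<le> 1) \<and>
    (\<forall>k. has_bochner_integral \<mu> (\<lambda>r. r ^ k) (D k 0))"
proof (cases "D 0 0 = 0")
  case True
  interpret hausdorff_array D by fact
  have "D k 0 = 0" for k
    using D_le[of k 0] nonneg[of k 0] True by simp
  moreover have "AE r in null_measure borel_nonneg. r \<le> 1"
    by (rule AE_I[where N = "space borel_nonneg"]) (auto simp only: sets_null_measure sets.top space_null_measure emeasure_null_measure)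
  moreover have "has_bochner_integral (null_measure borel_nonneg) (\<lambda>r. r ^ k) 0" for k :: nat
    by (auto simp: has_bochner_integral_iff intro: measurable_restrict_space1)
  ultimately show ?thesis
    by (intro exI[of _ "null_measure borel_nonneg"]) (auto intro!: finite_measureI)
next
  case False
  interpret hausdorff_array D by fact
  define c where "c = D 0 0"
  have c: "0 < c" using False nonneg[of 0 0] by (simp add: c_def)
  define q where "q n j = (if j \<le> n then real (n choose j) * D j (n - j) / c else 0)" for n j
  have q_nonneg: "0 \<le> q n j" for n j
    using c nonneg by (simp add: q_def)
  have q_sum: "(\<Sum>j\<le>n. q n j) = 1" for n
    using binomial_moment[of n 0] c by (simp add: q_def c_def flip: sum_divide_distrib)
  define p where "p n = embed_pmf (q n)" for n
  have pmf_p: "pmf (p n) j = q n j" for n j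
    unfolding p_def
  proof (rule pmf_embed_pmf)
    have "(\<integral>\<^sup>+j. ennreal (q n j) \<partial>count_space UNIV) = (\<Sum>j\<le>n. ennreal (q n j))"
      by (rule nn_integral_count_space'[of "{..n}"]) (auto simp: q_def)
    also have "\<dots> = ennreal (\<Sum>j\<le>n. q n j)"
      by (rule sum_ennreal) (rule q_nonneg)
    finally show "(\<integral>\<^sup>+j. ennreal (q n j) \<partial>count_space UNIV) = 1"
      by (simp add: q_sum)
  qed (rule q_nonneg)
  have p_int: "(\<integral>j. f j \<partial>measure_pmf (p n)) = (\<Sum>j\<le>n. q n j * f j)" for n and f :: "nat \<Rightarrow> real"
    by (subst integral_measure_pmf[of "{..n}"]) (auto simp: pmf_p q_def set_pmf_iff split: if_splits)
  \<comment> \<open>Powers are exchanged for binomial coefficients one factor at a time, by \<open>(j choose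
    k) j = (k + 1) (j choose (k + 1)) + k (j choose k)\<close>; the last term is of lower order in
    \<open>n\<close>.\<close>
  have moment: "(\<lambda>n. \<Sum>j\<le>n. q n j * (real (j choose k) * real j ^ m / real n ^ (k + m))) \<longlonglongrightarrow> D (k + m) 0 / (fact k * c)" for k m
  proof (induction m arbitrary: k)
    case 0
    have "(\<Sum>j\<le>n. q n j * (real (j choose k) * real j ^ 0 / real n ^ (k + 0)))
      = (D k 0 / c) * (real (n choose k) / real n ^ k)" for n
    proof -
      have "(\<Sum>j\<le>n. q n j * (real (j choose k) * real j ^ 0 / real n ^ (k + 0)))
        = (\<Sum>j\<le>n. real (n choose j) * D j (n - j) * real (j choose k)) / (c * real n ^ k)"
        unfolding sum_divide_distrib by (intro sum.cong refl) (simp add: q_def)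
      then show ?thesis unfolding binomial_moment by simp
    qed
    moreover have "(\<lambda>n. (D k 0 / c) * (real (n choose k) / real n ^ k)) \<longlonglongrightarrow> (D k 0 / c) * (1 / fact k)"
      by (intro tendsto_intros tendsto_choose_power)
    ultimately show ?case by (simp add: mult.commute)
  next
    case (Suc m)
    let ?h = "\<lambda>k m n. \<Sum>j\<le>n. q n j * (real (j choose k) * real j ^ m / real n ^ (k + m))"
    have rec: "?h k (Suc m) n = real (Suc k) * ?h (Suc k) m n + (real k / real n) * ?h k m n" for n
      unfolding sum_distrib_left sum.distrib[symmetric]
    proof (intro sum.cong refl)
      fix j
      have "real (j choose k) * real j ^ Suc m = (real (j choose k) * real j) * real j ^ m"
        by simp
      also have "\<dots> = real (Suc k) * real (j choose Suc k) * real j ^ m + real k * real (j choose k) * real j ^ m"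
        unfolding choose_times_self by (rule distrib_right)
      finally have *: "real (j choose k) * real j ^ Suc m / real n ^ (k + Suc m)
        = real (Suc k) * (real (j choose Suc k) * real j ^ m / real n ^ (Suc k + m))
          + real k / real n * (real (j choose k) * real j ^ m / real n ^ (k + m))"
        by (simp add: add_divide_distrib mult.assoc)
      show "q n j * (real (j choose k) * real j ^ Suc m / real n ^ (k + Suc m))
        = real (Suc k) * (q n j * (real (j choose Suc k) * real j ^ m / real n ^ (Suc k + m)))
          + real k / real n * (q n j * (real (j choose k) * real j ^ m / real n ^ (k + m)))"
        unfolding * by (simp only: distrib_left mult.left_commute)
    qed
    have "(\<lambda>n. real (Suc k) * ?h (Suc k) m n + (real k / real n) * ?h k m n)
      \<longlonglongrightarrow> real (Suc k) * (D (Suc k + m) 0 / (fact (Suc k) * c)) + 0 * (D (k + m) 0 / (fact k * c))"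
      by (intro tendsto_intros Suc.IH tendsto_divide_0[OF tendsto_const] filterlim_real_at_infinity_sequentially)
    also have "real (Suc k) * (D (Suc k + m) 0 / (fact (Suc k) * c)) + 0 * (D (k + m) 0 / (fact k * c)) = D (k + Suc m) 0 / (fact k * c)"
      by (simp del: of_nat_Suc)
    finally show ?case unfolding rec .
  qed
  define \<mu> where "\<mu> n = distr (measure_pmf (p n)) borel (\<lambda>j. real j / real n)" for n
  have \<mu>: "real_distribution (\<mu> n)" for n
    unfolding \<mu>_def real_distribution_def real_distribution_axioms_def
    by (auto intro!: measure_pmf.prob_space_distr)
  have "tight \<mu>"
    unfolding tight_def
  proof (intro conjI allI impI)
    fix \<epsilon> :: real assume "0 < \<epsilon>"
    have "measure (\<mu> n) {-1<..1} = 1" for n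
    proof -
    have "measure (\<mu> n) {-1<..1} = measure (measure_pmf (p n)) ((\<lambda>j. real j / real n) -` {-1<..1})"
      unfolding \<mu>_def by (subst measure_distr) auto
    also have "\<dots> = 1"
    proof (rule measure_pmf.prob_eq_1[THEN iffD2])
      show "AE j in measure_pmf (p n). j \<in> (\<lambda>j. real j / real n) -` {-1<..1}"
        by (auto simp: AE_measure_pmf_iff set_pmf_iff pmf_p q_def divide_le_eq_1 split: if_splits
            intro: order_less_le_trans[of _ 0])
    qed simp
    finally show ?thesis .
    qed
    then show "\<exists>a b. a < b \<and> (\<forall>n. 1 - \<epsilon> < measure (\<mu> n) {a<..b})"
      using \<open>0 < \<epsilon>\<close> by (intro exI[of _ "-1"] exI[of _ 1]) auto
  qed (rule \<mu>)
  then obtain r M where r: "strict_mono r" and M: "real_distribution M" and weak: "weak_conv_m (\<mu> \<circ> id \<circ> r) M"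
    using tight_imp_convergent_subsubsequence[of \<mu> id] strict_mono_id by blast
  interpret M: real_distribution M by fact
  \<comment> \<open>The weak limit is a measure on the real line. Pushing it forward along the retraction to
    \<open>[0, 1]\<close> is easier than showing that it lives there, and changes nothing for the
    approximating measures.\<close>
  define cl where "cl x = max 0 (min 1 x)" for x :: real
  have cl_meas [measurable]: "cl \<in> borel_measurable borel"
    unfolding cl_def by measurable
  have cl_bd: "0 \<le> cl x" "cl x \<le> 1" for x by (auto simp: cl_def)
  have lim: "(\<integral>x. cl x ^ k \<partial>M) = D k 0 / c" for k
  proof (rule LIMSEQ_unique)
    show "(\<lambda>n. \<integral>x. cl x ^ k \<partial>(\<mu> \<circ> id \<circ> r) n) \<longlonglongrightarrow> (\<integral>x. cl x ^ k \<partial>M)"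
    proof (rule weak_conv_imp_integral_bdd_continuous_conv[OF _ M weak, where B = 1])
      show "real_distribution ((\<mu> \<circ> id \<circ> r) n)" for n
        using \<mu> by simp
      show "isCont (\<lambda>x. cl x ^ k) x" for x
        unfolding cl_def by (intro continuous_intros)
      show "norm (cl x ^ k) \<le> 1" for x
        using cl_bd[of x] by (simp add: power_abs[symmetric] power_le_one)
    qed
    have "(\<integral>x. cl x ^ k \<partial>\<mu> n) = (\<Sum>j\<le>n. q n j * (real (j choose 0) * real j ^ k / real n ^ (0 + k)))" for n
    proof -
      have "(\<integral>x. cl x ^ k \<partial>\<mu> n) = (\<integral>j. cl (real j / real n) ^ k \<partial>measure_pmf (p n))"
        unfolding \<mu>_def by (subst integral_distr) auto
      also have "\<dots> = (\<Sum>j\<le>n. q n j * cl (real j / real n) ^ k)"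
        by (rule p_int)
      also have "\<dots> = (\<Sum>j\<le>n. q n j * (real (j choose 0) * real j ^ k / real n ^ (0 + k)))"
      proof (intro sum.cong refl)
        fix j assume "j \<in> {..n}"
        then have "cl (real j / real n) = real j / real n"
          by (cases "n = 0") (auto simp: cl_def min_absorb2 max_absorb2)
        then show "q n j * cl (real j / real n) ^ k = q n j * (real (j choose 0) * real j ^ k / real n ^ (0 + k))"
          by (simp add: power_divide)
      qed
      finally show ?thesis .
    qed
    then have "(\<lambda>n. \<integral>x. cl x ^ k \<partial>\<mu> n) \<longlonglongrightarrow> D k 0 / c"
      using moment[of 0 k] by simp
    then show "(\<lambda>n. \<integral>x. cl x ^ k \<partial>(\<mu> \<circ> id \<circ> r) n) \<longlonglongrightarrow> D k 0 / c"
      using LIMSEQ_subseq_LIMSEQ[OF _ r] by (simp add: o_def)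
  qed
  have cl_nonneg: "cl \<in> measurable M borel_nonneg"
    by (rule measurable_restrict_space2) (use cl_bd in auto)
  define \<mu>' where "\<mu>' = density (distr M borel_nonneg cl) (\<lambda>_. ennreal c)"
  have nn: "(\<integral>\<^sup>+x. f x \<partial>\<mu>') = ennreal c * (\<integral>\<^sup>+x. f (cl x) \<partial>M)" if "f \<in> borel_measurable borel" for f
  proof -
    have [measurable]: "f \<in> borel_measurable borel_nonneg"
      by (rule measurable_restrict_space1[OF that])
    have [measurable]: "(\<lambda>x. f (cl x)) \<in> borel_measurable M"
      using that by measurable
    show ?thesis
      unfolding \<mu>'_def
      by (simp add: nn_integral_density nn_integral_distr[OF cl_nonneg] nn_integral_cmult)
  qed
  show ?thesis
  proof (intro exI[of _ \<mu>'] conjI allI)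
    have "emeasure \<mu>' (space \<mu>') = ennreal c"
      using nn[of "\<lambda>_. 1"] M.emeasure_space_1 by simp
    then show "finite_measure \<mu>'"
      by (intro finite_measureI) simp
    show "sets \<mu>' = sets borel_nonneg"
      by (simp add: \<mu>'_def)
    show "AE r in \<mu>'. r \<le> 1"
    proof -
      have "{x \<in> space borel_nonneg. x \<le> (1::real)} = {0..1}"
        by (auto simp: space_restrict_space)
      then have "{x \<in> space borel_nonneg. x \<le> (1::real)} \<in> sets borel_nonneg"
        by (simp add: sets_restrict_space_iff)
      then have "AE r in distr M borel_nonneg cl. r \<le> 1"
        using cl_bd(2) by (simp add: AE_distr_iff[OF cl_nonneg])
      then show ?thesis
        unfolding \<mu>'_def by (subst AE_density) auto
    qed
    fix k
    show "has_bochner_integral \<mu>' (\<lambda>r. r ^ k) (D k 0)"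
    proof (rule has_bochner_integral_nn_integral)
      show "(\<lambda>r. r ^ k) \<in> borel_measurable \<mu>'"
        unfolding \<mu>'_def by (simp add: measurable_restrict_space1)
      show "AE r in \<mu>'. 0 \<le> r ^ k"
        by (rule AE_I2) (simp add: \<mu>'_def space_restrict_space)
      have "(\<integral>\<^sup>+x. ennreal (cl x ^ k) \<partial>M) = ennreal (D k 0 / c)"
        unfolding lim[symmetric]
        by (rule nn_integral_eq_integral, rule M.integrable_const_bound[of _ 1])
          (use cl_bd in \<open>auto simp: power_le_one\<close>)
      then show "(\<integral>\<^sup>+r. ennreal (r ^ k) \<partial>\<mu>') = ennreal (D k 0)"
        using nn[of "\<lambda>r. ennreal (r ^ k)"] c nonneg[of k 0] by (simp flip: ennreal_mult)
    qed (rule nonneg)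
  qed
qed

section \<open>Moments of normal operators\<close>

text \<open>
  The equation \<open>a + N\<^sup>* N a = h\<close> is solved by the projection \<open>(a, N a)\<close> of \<open>(h, 0)\<close> to the graph of \<open>N\<close>:
  the orthogonality relations are the statement that \<open>N a\<close> is in the domain of \<open>N\<^sup>*\<close> and is mapped to \<open>h - a\<close>.
\<close>

lemma normal_resolvent_exists:
  fixes N :: "'a::chilbert_space operator"
  assumes "normal_operator N"
  shows "\<exists>a b. (a, b) \<in> N \<and> (b, h - a) \<in> adjoint_op N"
proof -
  have lin: "linear_operator N" and cl: "closed N"
    using assms by (auto simp: normal_operator_def)
  have N0: "0 \<in> N" and add: "\<And>p q. p \<in> N \<Longrightarrow> q \<in> N \<Longrightarrow> p + q \<in> N"
    and scaleC: "\<And>c f f'. (f, f') \<in> N \<Longrightarrow> (c *\<^sub>C f, c *\<^sub>C f') \<in> N"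
    using lin by (auto simp: linear_operator_def zero_prod_def)
  have scale: "c *\<^sub>R p \<in> N" if "p \<in> N" for c p
    using scaleC[of "fst p" "snd p" "complex_of_real c"] that by (simp add: scaleC_of_real scaleR_prod_def)
  obtain X p where X: "\<And>n. X n \<in> N" "X \<longlonglongrightarrow> p" and orth: "\<And>m. m \<in> N \<Longrightarrow> inner ((h, 0) - p) m = 0"
    using orthogonal_projection[of N "(h, 0)"] N0 add scale by metis
  have p: "p \<in> N"
    using closed_sequentially[OF cl] X by blast
  obtain a b where ab: "p = (a, b)" by fastforce
  have re: "inner f' b = inner f (h - a)" if "(f, f') \<in> N" for f f'
    using orth[OF that] by (simp add: ab inner_commute inner_diff_left)
  have "cinner f' b = cinner f (h - a)" if "(f, f') \<in> N" for f f'
    using re[OF that] re[OF scaleC[OF that, of \<i>]]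
    by (simp add: inner_eq_Re_cinner cinner_scaleC_left complex_eq_iff)
  then have "(b, h - a) \<in> adjoint_op N"
    by (auto simp: adjoint_op_def)
  then show ?thesis using p ab by blast
qed

locale normal_op =
  fixes N :: "'a::chilbert_space operator"
  assumes normal: "normal_operator N"
begin

text \<open>
  \<open>R = (1 + N\<^sup>* N)\<^sup>-\<^sup>1\<close>, \<open>T = N R\<close> and \<open>Q = 1 - R = N\<^sup>* N R\<close>.
\<close>

definition R :: "'a \<Rightarrow> 'a" where "R h = (SOME a. \<exists>b. (a, b) \<in> N \<and> (b, h - a) \<in> adjoint_op N)"
definition T :: "'a \<Rightarrow> 'a" where "T h = (SOME b. (R h, b) \<in> N \<and> (b, h - R h) \<in> adjoint_op N)"
definition Q :: "'a \<Rightarrow> 'a" where "Q h = h - R h"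

lemma lin: "(f, f') \<in> N \<Longrightarrow> (g, g') \<in> N \<Longrightarrow> (f - g, f' - g') \<in> N"
proof -
  assume "(f, f') \<in> N" "(g, g') \<in> N"
  moreover have "linear_operator N" using normal by (simp add: normal_operator_def)
  ultimately have "(f + (-1) *\<^sub>C g, f' + (-1) *\<^sub>C g') \<in> N"
    unfolding linear_operator_def by blast
  then show ?thesis by (simp add: scaleC_minus1)
qed

lemma adjD: "(f, f') \<in> N \<Longrightarrow> (g, g') \<in> adjoint_op N \<Longrightarrow> inner f' g = inner f g'"
  by (auto simp: adjoint_op_def inner_eq_Re_cinner)

lemma RT: "(R h, T h) \<in> N" "(T h, Q h) \<in> adjoint_op N"
proof -
  have "\<exists>b. (R h, b) \<in> N \<and> (b, h - R h) \<in> adjoint_op N"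
    unfolding R_def using normal_resolvent_exists[OF normal, of h] by (rule someI_ex)
  from someI_ex[OF this] show "(R h, T h) \<in> N" "(T h, Q h) \<in> adjoint_op N"
    by (auto simp: T_def Q_def)
qed

lemma adj_diff:
  assumes "(g, g') \<in> adjoint_op N" "(h, h') \<in> adjoint_op N"
  shows "(g - h, g' - h') \<in> adjoint_op N"
  using assms by (fastforce simp: adjoint_op_def cinner_simps)

lemma R_unique:
  assumes "(a, b) \<in> N" "(b, h - a) \<in> adjoint_op N"
  shows "R h = a"
proof -
  have "(R h - a, T h - b) \<in> N" "(T h - b, Q h - (h - a)) \<in> adjoint_op N"
    by (intro lin adj_diff RT assms)+
  then have "inner (T h - b) (T h - b) = inner (R h - a) (Q h - (h - a))"
    by (rule adjD)
  also have "Q h - (h - a) = - (R h - a)" by (simp add: Q_def)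
  finally have "inner (T h - b) (T h - b) + inner (R h - a) (R h - a) = 0"
    by (simp only: inner_minus_right)
  then have "inner (R h - a) (R h - a) = 0"
    using inner_ge_zero[of "T h - b"] inner_ge_zero[of "R h - a"] by linarith
  then show ?thesis by simp
qed

lemma inner_R: "inner (R h) g = inner (R h) (R g) + inner (T h) (T g)"
  using adjD[OF RT(1)[of h] RT(2)[of g]] by (simp add: Q_def inner_diff_right)

lemma R_self_adjoint: "inner (R h) g = inner h (R g)"
  using inner_R[of h g] inner_R[of g h] by (simp add: inner_commute)

lemma R_additive: "R (x + y) = R x + R y"
proof -
  have "inner (R (x + y) - (R x + R y)) z = 0" for z
    by (simp add: inner_diff_left inner_add_left R_self_adjoint)
  from this[of "R (x + y) - (R x + R y)"] show ?thesis by simp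
qed

lemma R_diff: "R (x - y) = R x - R y"
  using R_additive[of "x - y" y] by simp

lemma R_pow_additive: "(R ^^ k) (x + y) = (R ^^ k) x + (R ^^ k) y"
  by (induction k) (simp_all add: R_additive)

definition D :: "'a \<Rightarrow> nat \<Rightarrow> nat \<Rightarrow> real"
  where "D y k l = inner ((R ^^ k) ((Q ^^ l) y)) y"

lemma Q_self_adjoint: "inner (Q h) g = inner h (Q g)"
  by (simp add: Q_def inner_diff_left inner_diff_right R_self_adjoint)

lemma QR: "Q (R h) = R (Q h)"
  by (simp add: Q_def R_diff)

lemma R_pow_Q: "(R ^^ k) (Q h) = Q ((R ^^ k) h)"
  by (induction k) (simp_all add: QR)

lemma Q_pow_R: "(Q ^^ l) (R h) = R ((Q ^^ l) h)"
  by (induction l) (simp_all add: QR)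

text \<open>
  Both \<open>R\<close> and \<open>Q\<close> are positive, self-adjoint and commute.  Moving one factor of a square to the other
  side of the inner product reduces an exponent by two, which eventually leaves the forms of \<open>1\<close>, \<open>R\<close>, \<open>Q\<close> and
  \<open>Q R\<close>; the last one is \<open>\<parallel>T z\<parallel>\<^sup>2\<close>.
\<close>

lemma D_nonneg: "0 \<le> D y k l"
proof -
  have RR: "0 \<le> inner (R z) z" for z
    using inner_R[of z z] by simp
  have QRT: "inner (Q z) (R z) = inner (T z) (T z)" for z
    using adjD[OF RT(1)[of z] RT(2)[of z]] by (simp add: inner_commute)
  have QQ: "0 \<le> inner (Q z) z" for z
  proof -
    have "inner (Q z) z = inner (Q z) (R z) + inner (Q z) (Q z)"
      unfolding inner_add_right[symmetric] by (simp add: Q_def)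
    then show ?thesis
      unfolding QRT using inner_ge_zero[of "Q z"] inner_ge_zero[of "T z"] by linarith
  qed
  have Q: "0 \<le> inner ((Q ^^ l) (R z)) z \<and> 0 \<le> inner ((Q ^^ l) z) z" for l z
  proof (induction l arbitrary: z rule: induct_nat_012)
    case 1
    have "inner (Q (R z)) z = inner (Q z) (R z)"
      unfolding QR by (rule R_self_adjoint)
    then show ?case using QQ[of z] QRT[of z] by simp
  next
    case (ge2 n)
    have "(Q ^^ Suc (Suc n)) z = Q ((Q ^^ n) (Q z))" for z
      by (simp only: funpow.simps o_apply funpow_swap1[of Q n z])
    then have "inner ((Q ^^ Suc (Suc n)) z') z = inner ((Q ^^ n) (Q z')) (Q z)" for z' z
      by (simp only: Q_self_adjoint)
    then show ?case using ge2(1)[of "Q z"] by (simp only: QR simp_thms)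
  qed (simp_all add: RR)
  show ?thesis
    unfolding D_def
  proof (induction k arbitrary: y rule: induct_nat_012)
    case 0
    then show ?case using Q[of l y] by simp
  next
    case 1
    then show ?case using Q[of l y] by (simp add: Q_pow_R)
  next
    case (ge2 n)
    have "inner ((R ^^ Suc (Suc n)) ((Q ^^ l) y)) y = inner ((R ^^ n) ((Q ^^ l) (R y))) (R y)"
    proof -
      have "(R ^^ Suc (Suc n)) u = R ((R ^^ n) (R u))" for u
        by (simp only: funpow.simps o_apply funpow_swap1[of R n u])
      then show ?thesis
        by (simp only: Q_pow_R R_self_adjoint)
    qed
    then show ?case using ge2(1)[of "R y"] by simp
  qed
qed

lemma hausdorff_D: "hausdorff_array (D y)"
proof
  show "0 \<le> D y k l" for k l by (rule D_nonneg)
  show "D y k l = D y (Suc k) l + D y k (Suc l)" for k l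
  proof -
    let ?z = "(Q ^^ l) y"
    have "D y k l = inner ((R ^^ k) (R ?z + Q ?z)) y" by (simp add: D_def Q_def)
    also have "\<dots> = inner ((R ^^ k) (R ?z)) y + inner ((R ^^ k) (Q ?z)) y"
      by (simp only: R_pow_additive inner_add_left)
    also have "\<dots> = D y (Suc k) l + D y k (Suc l)"
      by (simp only: D_def funpow.simps o_apply funpow_swap1[of R k])
    finally show ?thesis .
  qed
qed

text \<open>
  Here normality enters.  For \<open>x' = N x\<close>, the pair \<open>(T x, x' - T x)\<close> belongs to \<open>N N\<^sup>*\<close>, because \<open>N\<^sup>*\<close> maps
  \<open>T x = N R x\<close> to \<open>Q x = x - R x\<close>, which \<open>N\<close> maps to \<open>x' - T x\<close>.  In terms of \<open>N\<^sup>* N\<close> this is the equation that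
  characterizes \<open>T x\<close> as \<open>R x'\<close>.
\<close>

lemma R_intertwines:
  assumes "(x, x') \<in> N" shows "(R x, R x') \<in> N"
proof -
  have c: "(T x, Q x) \<in> adjoint_op N" by (rule RT)
  have "(Q x, x' - T x) \<in> N"
    unfolding Q_def by (rule lin[OF assms RT(1)])
  then have "(T x, x' - T x) \<in> adjoint_op N O N"
    using c by blast
  then have "(T x, x' - T x) \<in> N O adjoint_op N"
    using normal by (simp add: normal_operator_def)
  then obtain z where "(T x, z) \<in> N" "(z, x' - T x) \<in> adjoint_op N" by blast
  then have "R x' = T x" by (rule R_unique)
  then show ?thesis using RT(1)[of x] by simp
qed

lemma D_shift:
  assumes "(x, x') \<in> N" shows "D x k 1 = D x' (Suc k) 0"
proof -
  have pow: "((R ^^ k) x, (R ^^ k) x') \<in> N"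
    by (induction k) (use assms R_intertwines in auto)
  have "single_valued N" using normal by (simp add: normal_operator_def linear_operator_def)
  then have T: "T ((R ^^ k) x) = R ((R ^^ k) x')"
    using RT(1)[of "(R ^^ k) x"] R_intertwines[OF pow] by (auto dest: single_valuedD)
  have "D x k 1 = inner x (Q ((R ^^ k) x))"
    by (simp add: D_def R_pow_Q inner_commute del: funpow.simps(2) add: funpow_Suc_right)
  also have "\<dots> = inner x' (T ((R ^^ k) x))"
    by (rule adjD[OF assms RT(2), symmetric])
  also have "\<dots> = D x' (Suc k) 0"
    by (simp add: T D_def inner_commute)
  finally show ?thesis .
qed

text \<open>
  The measures \<open>(1 - r) d\<mu>\<close> and \<open>r d\<mu>'\<close> have the same moments by \<open>D_shift\<close>.  As these measures live on \<open>[0, 1]\<close>, their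
  moments decrease, so the terms of Carleman's series are at least \<open>1\<close>.
\<close>

lemma spectral_step:
  assumes x: "(x, x') \<in> N"
    and \<mu>: "finite_measure \<mu>" "sets \<mu> = sets borel_nonneg" "AE r in \<mu>. r \<le> 1" "\<And>k. has_bochner_integral \<mu> (\<lambda>r. r ^ k) (D x k 0)"
    and \<mu>': "finite_measure \<mu>'" "sets \<mu>' = sets borel_nonneg" "AE r in \<mu>'. r \<le> 1" "\<And>k. has_bochner_integral \<mu>' (\<lambda>r. r ^ k) (D x' k 0)"
  shows "density \<mu> (\<lambda>r. ennreal (1 - r)) = density \<mu>' (\<lambda>r. ennreal r)"
proof (rule stieltjes_determinate[where t = "\<lambda>k. D x k 1"])
  interpret X: hausdorff_array "D x" by (rule hausdorff_D)
  have meas: "f \<in> borel_measurable L" if "sets L = sets borel_nonneg" "f \<in> borel_measurable borel" for f :: "real \<Rightarrow> real" and L :: "real measure"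
    using measurable_restrict_space1[OF that(2), of "{0..}"] that(1) by (simp cong: measurable_cong_sets)
  have nonneg: "AE r in L. 0 \<le> r" if "sets L = sets borel_nonneg" for L :: "real measure"
    using sets_eq_imp_space_eq[OF that] by (intro AE_I2) (simp add: space_restrict_space)
  have 1: "has_bochner_integral (density \<mu> (\<lambda>r. ennreal (1 - r))) (\<lambda>r. r ^ k) (D x k 1)" for k
  proof (rule has_bochner_integral_density)
    show "has_bochner_integral \<mu> (\<lambda>r. (1 - r) *\<^sub>R r ^ k) (D x k 1)"
      using has_bochner_integral_diff[OF \<mu>(4)[of k] \<mu>(4)[of "Suc k"]] X.split[of k 0]
      by (simp add: left_diff_distrib)
  qed (use \<mu>(3) in \<open>auto intro!: meas[OF \<mu>(2)]\<close>)
  have 2: "has_bochner_integral (density \<mu>' (\<lambda>r. ennreal r)) (\<lambda>r. r ^ k) (D x k 1)" for k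
  proof (rule has_bochner_integral_density)
    show "has_bochner_integral \<mu>' (\<lambda>r. r *\<^sub>R r ^ k) (D x k 1)"
      using \<mu>'(4)[of "Suc k"] D_shift[OF x, of k] by simp
  qed (use nonneg[OF \<mu>'(2)] in \<open>auto intro!: meas[OF \<mu>'(2)]\<close>)
  show "has_bochner_integral (density \<mu> (\<lambda>r. ennreal (1 - r))) (\<lambda>r. r ^ k) (D x k 1)"
    "has_bochner_integral (density \<mu>' (\<lambda>r. ennreal r)) (\<lambda>r. r ^ k) (D x k 1)" for k
    by (rule 1 2)+
  have fin: "finite_measure L" if "has_bochner_integral L (\<lambda>r. r ^ 0) c" for L :: "real measure" and c :: real
    using that by (intro finite_measureI) (auto simp: has_bochner_integral_iff integrable_iff_bounded)
  show "finite_measure (density \<mu> (\<lambda>r. ennreal (1 - r)))" "finite_measure (density \<mu>' (\<lambda>r. ennreal r))"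
    using fin[OF 1[of 0]] fin[OF 2[of 0]] by auto
  show "sets (density \<mu> (\<lambda>r. ennreal (1 - r))) = sets borel_nonneg" "sets (density \<mu>' (\<lambda>r. ennreal r)) = sets borel_nonneg"
    by (simp_all add: \<mu>(2) \<mu>'(2))
  assume pos: "\<And>n. 0 < D x n 1"
  have "1 \<le> sqrt (D x n 1 / D x (Suc n) 1)" for n
    using pos[of n] pos[of "Suc n"] X.split[of n 1] X.nonneg[of n "Suc 1"] by (simp add: le_divide_eq)
  then have "\<not> (\<lambda>n. sqrt (D x n 1 / D x (Suc n) 1)) \<longlonglongrightarrow> 0"
    using LIMSEQ_le_const[of "\<lambda>n. sqrt (D x n 1 / D x (Suc n) 1)" 0 1] by auto
  then show "\<not> summable (\<lambda>n. sqrt (D x n 1 / D x (Suc n) 1))"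
    using summable_LIMSEQ_zero by blast
qed

end

text \<open>
  The \<open>n\<close>-fold use of \<open>(1 - r) d\<mu>\<^bsub>x\<^esub> = r d\<mu>\<^bsub>N x\<^esub>\<close> shows that the integral of \<open>((1 - r) / r)\<^sup>n\<close> with
  respect to \<open>\<mu>\<^bsub>x\<^esub>\<close> is the mass of \<open>\<mu>\<^bsub>N\<^sup>n x\<^esub>\<close>, which is \<open>\<parallel>N\<^sup>n x\<parallel>\<^sup>2\<close>.
\<close>

theorem normal_operator_moments:
  fixes N :: "'a::chilbert_space operator" and x :: "nat \<Rightarrow> 'a"
  assumes "normal_operator N" and x: "\<And>n. (x n, x (Suc n)) \<in> N"
  shows "stieltjes_moment_seq (\<lambda>n. (norm (x n))\<^sup>2)"
proof -
  interpret normal_op N by standard fact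
  have "\<forall>n. \<exists>\<mu>. finite_measure \<mu> \<and> sets \<mu> = sets borel_nonneg \<and> (AE r in \<mu>. r \<le> 1) \<and>
      (\<forall>k. has_bochner_integral \<mu> (\<lambda>r. r ^ k) (D (x n) k 0))"
    using hausdorff_measure[OF hausdorff_D] by blast
  then obtain \<mu> where fin: "\<And>n. finite_measure (\<mu> n)" and sets: "\<And>n. sets (\<mu> n) = sets borel_nonneg"
    and le1: "\<And>n. AE r in \<mu> n. r \<le> 1" and mom: "\<And>n k. has_bochner_integral (\<mu> n) (\<lambda>r. r ^ k) (D (x n) k 0)"
    by metis
  note [measurable_cong] = sets
  have step: "density (\<mu> n) (\<lambda>r. ennreal (1 - r)) = density (\<mu> (Suc n)) (\<lambda>r. ennreal r)" for n
    by (rule spectral_step[OF x fin sets le1 mom fin sets le1 mom])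
  have sp: "space (\<mu> n) = {0..}" for n
    using sets_eq_imp_space_eq[OF sets] by (simp add: space_restrict_space)
  have meas: "f \<in> borel_measurable (\<mu> n)" if "f \<in> borel_measurable borel" for f :: "real \<Rightarrow> ennreal" and n
    using measurable_restrict_space1[OF that, of "{0..}"] sets by (simp cong: measurable_cong_sets)
  have eq: "(\<integral>\<^sup>+r. ennreal (1 - r) * f r \<partial>\<mu> n) = (\<integral>\<^sup>+r. ennreal r * f r \<partial>\<mu> (Suc n))" if "f \<in> borel_measurable borel" for f n
    using arg_cong[OF step[of n], of "\<lambda>L. integral\<^sup>N L f"] that
    by (simp add: nn_integral_density meas)
  \<comment> \<open>At \<open>r = 0\<close> the right-hand side of \<open>step\<close> has no mass and the
    density on the left is \<open>1\<close>, so division by \<open>r\<close> is harmless.\<close>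
  have null: "AE r in \<mu> n. r \<noteq> 0" for n
  proof -
    have "(\<integral>\<^sup>+r. ennreal (1 - r) * indicator {0} r \<partial>\<mu> n) = (\<integral>\<^sup>+r. ennreal r * indicator {0} r \<partial>\<mu> (Suc n))"
      by (rule eq) measurable
    also have "\<dots> = (\<integral>\<^sup>+r. 0 \<partial>\<mu> (Suc n))"
      by (intro nn_integral_cong) (auto simp: indicator_def)
    finally have zero: "(\<integral>\<^sup>+r. ennreal (1 - r) * indicator {0} r \<partial>\<mu> n) = 0"
      by simp
    have "AE r in \<mu> n. ennreal (1 - r) * indicator {0} r = 0"
      by (rule nn_integral_0_iff_AE[THEN iffD1, OF meas zero]) measurable
    then show ?thesis
      by eventually_elim (auto simp: indicator_def split: if_splits)
  qed
  define s where "s r = max 0 ((1 - r) / r)" for r :: real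
  have s_eq: "ennreal (s r) = ennreal (1 - r) * ennreal (1 / r)" if "0 \<le> r" "r \<le> 1" for r
    using that by (simp add: s_def max_absorb2 flip: ennreal_mult)
  have chain: "(\<integral>\<^sup>+r. ennreal (s r ^ k) \<partial>\<mu> n) = emeasure (\<mu> (n + k)) (space (\<mu> (n + k)))" for k n
  proof (induction k arbitrary: n)
    case (Suc k)
    have "(\<integral>\<^sup>+r. ennreal (s r ^ Suc k) \<partial>\<mu> n) = (\<integral>\<^sup>+r. ennreal (1 - r) * (ennreal (1 / r) * ennreal (s r ^ k)) \<partial>\<mu> n)"
    proof (rule nn_integral_cong_AE)
      show "AE r in \<mu> n. ennreal (s r ^ Suc k) = ennreal (1 - r) * (ennreal (1 / r) * ennreal (s r ^ k))"
        using le1[of n]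
      proof (rule AE_mp, intro AE_I2 impI)
        fix r assume "r \<in> space (\<mu> n)" "r \<le> 1"
        then have r: "0 \<le> r" "r \<le> 1" by (auto simp: sp)
        have "ennreal (s r ^ Suc k) = ennreal (s r) * ennreal (s r ^ k)"
          by (simp add: s_def ennreal_mult)
        then show "ennreal (s r ^ Suc k) = ennreal (1 - r) * (ennreal (1 / r) * ennreal (s r ^ k))"
          by (simp only: s_eq[OF r] mult.assoc)
      qed
    qed
    also have "\<dots> = (\<integral>\<^sup>+r. ennreal r * (ennreal (1 / r) * ennreal (s r ^ k)) \<partial>\<mu> (Suc n))"
      by (rule eq) (simp add: s_def)
    also have "\<dots> = (\<integral>\<^sup>+r. ennreal (s r ^ k) \<partial>\<mu> (Suc n))"
    proof (rule nn_integral_cong_AE)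
      show "AE r in \<mu> (Suc n). ennreal r * (ennreal (1 / r) * ennreal (s r ^ k)) = ennreal (s r ^ k)"
        using null[of "Suc n"]
      proof (rule AE_mp, intro AE_I2 impI)
        fix r assume "r \<in> space (\<mu> (Suc n))" "r \<noteq> 0"
        then have "ennreal r * ennreal (1 / r) = 1" by (simp add: sp flip: ennreal_mult)
        then show "ennreal r * (ennreal (1 / r) * ennreal (s r ^ k)) = ennreal (s r ^ k)"
          by (simp flip: mult.assoc)
      qed
    qed
    finally show ?case using Suc.IH[of "Suc n"] by simp
  qed simp
  have total: "emeasure (\<mu> n) (space (\<mu> n)) = ennreal ((norm (x n))\<^sup>2)" for n
  proof -
    interpret finite_measure "\<mu> n" by (rule fin)
    show ?thesis
      using mom[of n 0] by (simp add: has_bochner_integral_iff D_def power2_norm_eq_inner emeasure_eq_measure)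
  qed
  have s_meas: "s \<in> measurable (\<mu> 0) borel_nonneg"
  proof (rule measurable_restrict_space2)
    have "s \<in> borel_measurable borel" unfolding s_def by measurable
    then show "s \<in> borel_measurable (\<mu> 0)"
      unfolding measurable_cong_sets[OF sets refl] by (rule measurable_restrict_space1)
  qed (simp add: s_def)
  show ?thesis
    unfolding stieltjes_moment_seq_def
  proof (intro exI[of _ "distr (\<mu> 0) borel_nonneg s"] conjI allI)
    fix n
    show "has_bochner_integral (distr (\<mu> 0) borel_nonneg s) (\<lambda>s. s ^ n) ((norm (x n))\<^sup>2)"
    proof (rule has_bochner_integral_nn_integral)
      show "(\<lambda>s. s ^ n) \<in> borel_measurable (distr (\<mu> 0) borel_nonneg s)"
        by (simp add: measurable_restrict_space1)
      show "AE t in distr (\<mu> 0) borel_nonneg s. 0 \<le> t ^ n"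
        by (rule AE_I2) (simp add: space_restrict_space)
      show "(\<integral>\<^sup>+t. ennreal (t ^ n) \<partial>distr (\<mu> 0) borel_nonneg s) = ennreal ((norm (x n))\<^sup>2)"
      proof (subst nn_integral_distr[OF s_meas])
        show "(\<integral>\<^sup>+r. ennreal (s r ^ n) \<partial>\<mu> 0) = ennreal ((norm (x n))\<^sup>2)"
          unfolding chain add_0 by (rule total)
      qed (simp add: measurable_restrict_space1)
    qed simp
  qed simp
qed

section \<open>Sums over vertices and mixtures of measures\<close>

text \<open>
  Vertices may be uncountable in number and have uncountably many children.  Unordered sums are
  therefore treated as integrals over a counting measure, for which monotone
  convergence and Fubini's theorem are at hand.
\<close>

lemma nn_integral_count_space_eq_infsum:
  fixes f :: "'a \<Rightarrow> ennreal"
  shows "(\<integral>\<^sup>+x. f x \<partial>count_space A) = infsum f A"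
proof (rule antisym)
  have sup: "infsum f B = (SUP F\<in>{F. finite F \<and> F \<subseteq> B}. sum f F)" for B
    by (rule nonneg_infsum_complete) simp
  have sub: "sum f F \<le> infsum f A" if "finite F" "F \<subseteq> A" for F
    unfolding sup by (rule SUP_upper) (use that in auto)
  show "infsum f A \<le> (\<integral>\<^sup>+x. f x \<partial>count_space A)"
    unfolding sup
  proof (rule SUP_least, clarify)
    fix F assume F: "finite F" "F \<subseteq> A"
    have "sum f F = (\<integral>\<^sup>+x. f x * indicator F x \<partial>count_space A)"
      using F by (subst nn_integral_count_space'[of F]) (auto intro!: sum.cong simp: indicator_def)
    also have "\<dots> \<le> (\<integral>\<^sup>+x. f x \<partial>count_space A)"
      by (intro nn_integral_mono) (auto simp: indicator_def)
    finally show "sum f F \<le> (\<integral>\<^sup>+x. f x \<partial>count_space A)" .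
  qed
  \<comment> \<open>If some \<open>F n\<close> is infinite, both sides are infinite; otherwise
    \<open>f\<close> is the increasing limit of its restrictions to the finite sets \<open>F
    n\<close>.\<close>
  define F where "F n = {x \<in> A. ennreal (1 / real (Suc n)) \<le> f x}" for n
  show "(\<integral>\<^sup>+x. f x \<partial>count_space A) \<le> infsum f A"
  proof (cases "\<forall>n. finite (F n)")
    case False
    then obtain n where "infinite (F n)" by blast
    then have "infsum f (F n) = \<infinity>"
      by (intro infsum_superconst_infinite_ennreal[where b = "ennreal (1 / real (Suc n))"]) (auto simp: F_def)
    moreover have "infsum f (F n) \<le> infsum f A"
      unfolding sup by (rule SUP_subset_mono) (auto simp: F_def)
    ultimately show ?thesis by (simp add: top_unique)
  next
    case True
    have mono: "incseq (\<lambda>n x. f x * indicator (F n) x)"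
    proof (rule incseq_SucI, rule le_funI)
      fix n x
      have "F n \<subseteq> F (Suc n)"
        by (auto simp: F_def intro: order_trans[rotated] intro!: ennreal_leI divide_left_mono)
      then show "f x * indicator (F n) x \<le> f x * indicator (F (Suc n)) x"
        by (auto simp: indicator_def)
    qed
    have limit: "(SUP n. f x * indicator (F n) x) = f x" if "x \<in> A" for x
    proof (cases "f x = 0")
      case False
      then have "0 < f x" by (simp add: zero_less_iff_neq_zero)
      have "(\<lambda>n. ennreal (1 / real (Suc n))) \<longlonglongrightarrow> ennreal 0"
        by (intro tendsto_ennrealI LIMSEQ_inverse_real_of_nat[unfolded inverse_eq_divide])
      then have "\<forall>\<^sub>F n in sequentially. ennreal (1 / real (Suc n)) < f x"
        using \<open>0 < f x\<close> by (intro order_tendstoD(2)[where y = 0]) auto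
      then obtain n where "ennreal (1 / real (Suc n)) < f x"
        by (auto simp: eventually_sequentially)
      then have "x \<in> F n" using that by (simp add: F_def less_imp_le)
      show ?thesis
      proof (rule antisym)
        show "(SUP n. f x * indicator (F n) x) \<le> f x"
          by (rule SUP_least) (auto simp: indicator_def)
        show "f x \<le> (SUP n. f x * indicator (F n) x)"
          using \<open>x \<in> F n\<close> by (intro SUP_upper2[of n]) auto
      qed
    qed simp
    have "(\<integral>\<^sup>+x. f x \<partial>count_space A) = (\<integral>\<^sup>+x. (SUP n. f x * indicator (F n) x) \<partial>count_space A)"
      by (intro nn_integral_cong) (simp add: limit)
    also have "\<dots> = (SUP n. \<integral>\<^sup>+x. f x * indicator (F n) x \<partial>count_space A)"
      by (rule nn_integral_monotone_convergence_SUP[OF mono]) simp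
    also have "\<dots> \<le> infsum f A"
    proof (rule SUP_least)
      fix n
      have "(\<integral>\<^sup>+x. f x * indicator (F n) x \<partial>count_space A) = sum f (F n)"
        using True by (subst nn_integral_count_space'[of "F n"]) (auto intro!: sum.cong simp: indicator_def F_def)
      also have "\<dots> \<le> infsum f A"
        using True by (intro sub) (auto simp: F_def)
      finally show "(\<integral>\<^sup>+x. f x * indicator (F n) x \<partial>count_space A) \<le> infsum f A" .
    qed
    finally show ?thesis .
  qed
qed

lemma ennreal_infsum_eq_nn_integral:
  assumes "g summable_on A" "\<And>x. x \<in> A \<Longrightarrow> 0 \<le> g x"
  shows "ennreal (infsum g A) = (\<integral>\<^sup>+x. ennreal (g x) \<partial>count_space A)"
proof -
  have "ennreal (infsum g A) = (SUP F\<in>{F. finite F \<and> F \<subseteq> A}. ennreal (sum g F))"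
    by (rule infsum_nonneg_is_SUPREMUM_ennreal[OF assms])
  also have "\<dots> = (SUP F\<in>{F. finite F \<and> F \<subseteq> A}. \<Sum>x\<in>F. ennreal (g x))"
    using assms(2) by (intro SUP_cong refl) (auto intro!: sum_ennreal[symmetric])
  also have "\<dots> = infsum (\<lambda>x. ennreal (g x)) A"
    by (rule nonneg_infsum_complete[symmetric]) simp
  finally show ?thesis
    by (simp add: nn_integral_count_space_eq_infsum)
qed

lemma has_sum_if_nn_integral_count_space:
  fixes g :: "'a \<Rightarrow> real"
  assumes eq: "(\<integral>\<^sup>+x. ennreal (g x) \<partial>count_space A) = ennreal r" and nonneg: "\<And>x. x \<in> A \<Longrightarrow> 0 \<le> g x" "0 \<le> r"
  shows "(g has_sum r) A"
proof -
  have "sum g F \<le> r" if "finite F" "F \<subseteq> A" for F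
  proof -
    have "ennreal (sum g F) = (\<Sum>x\<in>F. ennreal (g x))"
      using nonneg that by (intro sum_ennreal[symmetric]) auto
    also have "\<dots> = (\<integral>\<^sup>+x. ennreal (g x) \<partial>count_space F)"
      using that by (simp add: nn_integral_count_space_finite)
    also have "\<dots> \<le> (\<integral>\<^sup>+x. ennreal (g x) \<partial>count_space A)"
      unfolding nn_integral_count_space_eq_infsum using that
      by (intro infsum_mono_neutral nonneg_summable_on_complete) auto
    finally show ?thesis
      using nonneg by (simp add: eq ennreal_le_iff)
  qed
  then have sum: "g summable_on A"
    using nonneg by (intro nonneg_bdd_above_summable_on) (auto intro!: bdd_aboveI2[where M = r])
  have "ennreal (infsum g A) = ennreal r"
    using ennreal_infsum_eq_nn_integral[OF sum nonneg(1)] eq by simp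
  then have "infsum g A = r"
    using nonneg by (subst (asm) ennreal_inj) (auto intro: infsum_nonneg)
  then show ?thesis using sum by (simp add: has_sum_iff)
qed

lemma norm_ell2_eq_nn_integral:
  "ennreal ((norm f)\<^sup>2) = (\<integral>\<^sup>+v. ennreal ((cmod (ell2_fun f v))\<^sup>2) \<partial>count_space UNIV)"
  unfolding norm_ell2_square by (rule ennreal_infsum_eq_nn_integral[OF square_summable]) simp

text \<open>
  The sum of the measures \<open>c v \<cdot> \<mu> v\<close>.  Defining it as a monadic composition with a counting measure
  covers uncountable index sets and provides the formula for integrals at once.
\<close>

definition mixture :: "('v \<Rightarrow> ennreal) \<Rightarrow> ('v \<Rightarrow> real measure) \<Rightarrow> real measure"
  where "mixture c \<mu> = density (count_space UNIV) c \<bind> \<mu>"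

context
  fixes \<mu> :: "'v \<Rightarrow> real measure"
  assumes prob: "\<And>v. prob_space (\<mu> v)" and sets: "\<And>v. sets (\<mu> v) = sets borel_nonneg"
begin

lemma sets_mixture: "sets (mixture c \<mu>) = sets borel_nonneg"
  unfolding mixture_def by (rule sets_bind) (simp_all add: sets)

lemma nn_integral_mixture:
  assumes "f \<in> borel_measurable borel_nonneg"
  shows "(\<integral>\<^sup>+s. f s \<partial>mixture c \<mu>) = (\<integral>\<^sup>+v. c v * (\<integral>\<^sup>+s. f s \<partial>\<mu> v) \<partial>count_space UNIV)"
proof -
  have "\<mu> \<in> measurable (density (count_space UNIV) c) (subprob_algebra borel_nonneg)"
    using prob sets by (auto simp: measurable_def space_subprob_algebra prob_space_imp_subprob_space)
  then show ?thesis
    unfolding mixture_def by (subst nn_integral_bind[OF assms]) (simp_all add: nn_integral_density)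
qed

end

lemma measurable_nonneg:
  assumes "sets M = sets borel_nonneg" "f \<in> borel_measurable borel"
  shows "f \<in> borel_measurable M"
  unfolding measurable_cong_sets[OF assms(1) refl] by (rule measurable_restrict_space1[OF assms(2)])

definition child_weight :: "('v \<times> 'v) set \<Rightarrow> ('v \<Rightarrow> complex) \<Rightarrow> 'v \<Rightarrow> 'v \<Rightarrow> ennreal"
  where "child_weight E w u v = (if v \<in> Chi E u then ennreal ((cmod (w v))\<^sup>2) else 0)"

lemma nn_integral_child_weight:
  "(\<integral>\<^sup>+v. child_weight E w u v * f v \<partial>count_space UNIV) = (\<Sum>\<^sub>\<infinity>v\<in>Chi E u. ennreal ((cmod (w v))\<^sup>2) * f v)"
  unfolding nn_integral_count_space_eq_infsum
  by (rule infsum_cong_neutral) (auto simp: child_weight_def)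

lemma consistent_system_iff_mixture:
  assumes prob: "\<And>v. prob_space (\<mu> v)" and sets: "\<And>v. sets (\<mu> v) = sets borel_nonneg"
  shows "consistent_system E w \<mu> \<epsilon> \<longleftrightarrow> (\<forall>u. \<forall>\<sigma>\<in>sets borel_nonneg. emeasure (\<mu> u) \<sigma> =
    emeasure (density (mixture (child_weight E w u) \<mu>) (\<lambda>s. 1 / ennreal s)) \<sigma> + ennreal (\<epsilon> u) * indicator \<sigma> 0)"
proof -
  have "(\<Sum>\<^sub>\<infinity>v\<in>Chi E u. ennreal ((cmod (w v))\<^sup>2) * (\<integral>\<^sup>+s\<in>\<sigma>. 1 / ennreal s \<partial>\<mu> v))
    = emeasure (density (mixture (child_weight E w u) \<mu>) (\<lambda>s. 1 / ennreal s)) \<sigma>"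
    if \<sigma>: "\<sigma> \<in> sets borel_nonneg" for u \<sigma>
  proof -
    note S = sets_mixture[OF prob sets, of "child_weight E w u"]
    have m: "(\<lambda>s. 1 / ennreal s) \<in> borel_measurable borel" by measurable
    have "(\<lambda>s. 1 / ennreal s * indicator \<sigma> s) \<in> borel_measurable borel_nonneg"
      using \<sigma> measurable_restrict_space1[OF m] by (intro borel_measurable_times_ennreal borel_measurable_indicator) auto
    then show ?thesis
      using \<sigma> measurable_nonneg[OF S m] S
      by (simp add: emeasure_density nn_integral_mixture[OF prob sets] nn_integral_child_weight)
  qed
  moreover have "emeasure (return borel_nonneg 0) \<sigma> = indicator \<sigma> 0" if "\<sigma> \<in> sets borel_nonneg" for \<sigma> :: "real set"
    using that by simp
  ultimately show ?thesis
    unfolding consistent_system_def by (auto cong: ball_cong)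
qed

lemma ennreal_inverse_cancel: "0 < s \<Longrightarrow> 1 / ennreal s * ennreal s = 1"
  using divide_ennreal[of 1 s] by (simp flip: ennreal_mult)

text \<open>
  The Dirac measure and the factor \<open>1/s\<close> concern the point \<open>0\<close> only.  The mixture
  has no mass there: its mass is multiplied by \<open>1/0 = \<infinity>\<close> in the consistency condition, whose left-hand
  side is finite; and in the density equation the left-hand side vanishes at \<open>0\<close>.  Off \<open>0\<close> the two conditions
  differ by multiplication with \<open>s\<close>.
\<close>

theorem consistent_system_iff_density:
  fixes \<mu> :: "'v \<Rightarrow> real measure"
  assumes prob: "\<And>v. prob_space (\<mu> v)" and sets: "\<And>v. sets (\<mu> v) = sets borel_nonneg"
  shows "(\<exists>\<epsilon>. (\<forall>v. 0 \<le> \<epsilon> v) \<and> consistent_system E w \<mu> \<epsilon>) \<longleftrightarrow>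
    (\<forall>u. density (\<mu> u) (\<lambda>s. ennreal s) = mixture (child_weight E w u) \<mu>)"
proof -
  note setsM = sets_mixture[OF prob sets]
  have m: "(\<lambda>s. 1 / ennreal s) \<in> borel_measurable borel" "(\<lambda>s. ennreal s) \<in> borel_measurable borel"
    "indicator {0<..} \<in> borel_measurable (borel :: real measure)"
    by measurable
  note [measurable] = measurable_nonneg[OF sets m(1)] measurable_nonneg[OF sets m(2)] measurable_nonneg[OF sets m(3)]
    measurable_nonneg[OF setsM m(1)] measurable_nonneg[OF setsM m(2)] measurable_nonneg[OF setsM m(3)]
  have pos_sets: "{0<..} \<in> sets borel_nonneg" "{0} \<in> sets borel_nonneg"
    by (auto simp: sets_restrict_space_iff)
  have space: "space M = {0..}" if "sets M = sets borel_nonneg" for M :: "real measure"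
    using sets_eq_imp_space_eq[OF that] by (simp add: space_restrict_space)
  show ?thesis
  proof (intro iffI allI)
    fix u
    assume "\<exists>\<epsilon>. (\<forall>v. 0 \<le> \<epsilon> v) \<and> consistent_system E w \<mu> \<epsilon>"
    then obtain \<epsilon> where eq: "\<And>\<sigma>. \<sigma> \<in> sets borel_nonneg \<Longrightarrow> emeasure (\<mu> u) \<sigma> =
      emeasure (density (mixture (child_weight E w u) \<mu>) (\<lambda>s. 1 / ennreal s)) \<sigma> + ennreal (\<epsilon> u) * indicator \<sigma> 0"
      unfolding consistent_system_iff_mixture[OF prob sets] by blast
    define \<beta> where "\<beta> = mixture (child_weight E w u) \<mu>"
    define \<kappa> where "\<kappa> = density \<beta> (\<lambda>s. 1 / ennreal s)"
    have S: "sets \<beta> = sets borel_nonneg" "sets \<kappa> = sets borel_nonneg"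
      by (simp_all add: \<beta>_def \<kappa>_def setsM)
    note [measurable] = measurable_nonneg[OF S(1) m(1)] measurable_nonneg[OF S(1) m(2)] measurable_nonneg[OF S(1) m(3)]
      measurable_nonneg[OF S(2) m(2)] measurable_nonneg[OF S(2) m(3)]
    have "emeasure \<beta> {0} = 0"
    proof (rule ccontr)
      assume ne: "emeasure \<beta> {0} \<noteq> 0"
      have "emeasure \<kappa> {0} = (\<integral>\<^sup>+s. \<infinity> * indicator {0} s \<partial>\<beta>)"
        unfolding \<kappa>_def using pos_sets S
        by (subst emeasure_density) (auto intro!: nn_integral_cong simp: indicator_def)
      also have "\<dots> = \<infinity> * emeasure \<beta> {0}"
        using pos_sets S by (intro nn_integral_cmult_indicator) simp
      also have "\<dots> = \<infinity>" using ne by (simp add: ennreal_top_mult)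
      finally have "emeasure (\<mu> u) {0} = \<infinity>"
        using eq[OF pos_sets(2)] by (simp add: \<beta>_def \<kappa>_def)
      moreover have "emeasure (\<mu> u) {0} \<le> 1"
        by (rule prob_space.emeasure_le_1[OF prob])
      ultimately show False by (simp add: top_unique)
    qed
    then have null: "AE s in \<beta>. s \<in> {0<..}"
      using pos_sets S by (intro AE_I[of _ _ "{0}"]) (auto simp: space)
    have restr: "density (\<mu> u) (indicator {0<..}) = density \<kappa> (indicator {0<..})"
    proof (rule measure_eqI)
      fix \<sigma> assume "\<sigma> \<in> sets (density (\<mu> u) (indicator {0<..}))"
      then have \<sigma>: "\<sigma> \<in> sets borel_nonneg" "\<sigma> \<inter> {0<..} \<in> sets borel_nonneg"
        using pos_sets by (auto simp: sets)
      have "emeasure (density M (indicator {0<..})) \<sigma> = emeasure M (\<sigma> \<inter> {0<..})" if "sets M = sets borel_nonneg" for M :: "real measure"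
        using \<sigma> that pos_sets measurable_nonneg[OF that m(3)]
        by (simp add: emeasure_restricted Int_commute)
      from this[OF sets] this[OF S(2)] show "emeasure (density (\<mu> u) (indicator {0<..})) \<sigma> = emeasure (density \<kappa> (indicator {0<..})) \<sigma>"
        using eq[OF \<sigma>(2)] by (simp add: \<beta>_def \<kappa>_def)
    qed (simp add: sets S)
    have "density (\<mu> u) (\<lambda>s. ennreal s) = density (\<mu> u) (\<lambda>s. indicator {0<..} s * ennreal s)"
    proof (rule density_cong[OF _ _ AE_I2])
      fix s assume "s \<in> space (\<mu> u)"
      then show "ennreal s = indicator {0<..} s * ennreal s"
        by (cases "s = 0") (auto simp: space[OF sets])
    qed measurable
    also have "\<dots> = density (density (\<mu> u) (indicator {0<..})) (\<lambda>s. ennreal s)"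
      by (rule density_density_eq[symmetric]) measurable
    also have "\<dots> = density (density \<kappa> (indicator {0<..})) (\<lambda>s. ennreal s)"
      unfolding restr ..
    also have "\<dots> = density \<kappa> (\<lambda>s. indicator {0<..} s * ennreal s)"
      by (rule density_density_eq) measurable
    also have "\<dots> = density \<beta> (\<lambda>s. 1 / ennreal s * (indicator {0<..} s * ennreal s))"
      unfolding \<kappa>_def by (rule density_density_eq) measurable
    also have "\<dots> = density \<beta> (\<lambda>_. 1)"
    proof (rule density_cong)
      show "AE s in \<beta>. 1 / ennreal s * (indicator {0<..} s * ennreal s) = 1"
        using null by eventually_elim (simp add: ennreal_inverse_cancel)
    qed measurable
    also have "\<dots> = \<beta>" by (rule density_1)
    finally show "density (\<mu> u) (\<lambda>s. ennreal s) = mixture (child_weight E w u) \<mu>"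
      by (simp add: \<beta>_def)
  next
    assume dens: "\<forall>u. density (\<mu> u) (\<lambda>s. ennreal s) = mixture (child_weight E w u) \<mu>"
    define \<epsilon> where "\<epsilon> u = measure (\<mu> u) {0}" for u
    have "emeasure (\<mu> u) \<sigma> = emeasure (density (mixture (child_weight E w u) \<mu>) (\<lambda>s. 1 / ennreal s)) \<sigma> + ennreal (\<epsilon> u) * indicator \<sigma> 0"
      if \<sigma>: "\<sigma> \<in> sets borel_nonneg" for u \<sigma>
    proof -
      interpret prob_space "\<mu> u" by (rule prob)
      have "density (mixture (child_weight E w u) \<mu>) (\<lambda>s. 1 / ennreal s) = density (\<mu> u) (\<lambda>s. ennreal s * (1 / ennreal s))"
        unfolding dens[rule_format, symmetric] by (rule density_density_eq) measurable
      also have "\<dots> = density (\<mu> u) (indicator {0<..})"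
      proof (rule density_cong[OF _ _ AE_I2])
        fix s assume "s \<in> space (\<mu> u)"
        then show "ennreal s * (1 / ennreal s) = indicator {0<..} s"
          by (cases "s = 0") (auto simp: space[OF sets] divide_ennreal simp flip: ennreal_1 ennreal_mult)
      qed measurable
      finally have "emeasure (density (mixture (child_weight E w u) \<mu>) (\<lambda>s. 1 / ennreal s)) \<sigma> = emeasure (\<mu> u) (\<sigma> \<inter> {0<..})"
        using \<sigma> pos_sets sets by (simp add: emeasure_restricted Int_commute)
      moreover have "ennreal (\<epsilon> u) * indicator \<sigma> 0 = emeasure (\<mu> u) (\<sigma> \<inter> {0})"
        by (auto simp: \<epsilon>_def emeasure_eq_measure indicator_def)
      moreover have "emeasure (\<mu> u) (\<sigma> \<inter> {0<..}) + emeasure (\<mu> u) (\<sigma> \<inter> {0}) = emeasure (\<mu> u) ((\<sigma> \<inter> {0<..}) \<union> (\<sigma> \<inter> {0}))"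
        using \<sigma> pos_sets sets by (intro plus_emeasure) auto
      moreover have "(\<sigma> \<inter> {0<..}) \<union> (\<sigma> \<inter> {0}) = \<sigma>"
        using sets.sets_into_space[OF \<sigma>] by (auto simp: space_restrict_space)
      ultimately show ?thesis by simp
    qed
    then have "consistent_system E w \<mu> \<epsilon>"
      unfolding consistent_system_iff_mixture[OF prob sets] by blast
    then show "\<exists>\<epsilon>. (\<forall>v. 0 \<le> \<epsilon> v) \<and> consistent_system E w \<mu> \<epsilon>"
      by (intro exI[of _ \<epsilon>]) (simp add: \<epsilon>_def)
  qed
qed

section \<open>Powers of the shift\<close>

lemma unit_vec_in_span: "unit_vec u \<in> unit_vec_span"
proof -
  interpret vector_space "scaleC :: complex \<Rightarrow> 'v ell2 \<Rightarrow> 'v ell2" by (rule vector_space_scaleC)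
  show ?thesis
    unfolding unit_vec_span_def by (intro span_base) auto
qed

lemma smooth_orbit:
  assumes S: "single_valued S" and f: "f \<in> smooth_vectors S"
  shows "(f, op_apply (S ^^ n) f) \<in> S ^^ n" "(op_apply (S ^^ n) f, op_apply (S ^^ Suc n) f) \<in> S" "op_apply (S ^^ 0) f = f"
proof -
  have sv: "single_valued (S ^^ n)" for n
    by (induction n) (auto intro: single_valued_relcomp S single_valued_Id)
  have eq: "op_apply (S ^^ n) f = g" if "(f, g) \<in> S ^^ n" for n g
    unfolding op_apply_def using that sv[of n] by (blast dest: single_valuedD)
  have mem: "(f, op_apply (S ^^ n) f) \<in> S ^^ n" for n
    using f eq unfolding smooth_vectors_def by blast
  then show "(f, op_apply (S ^^ n) f) \<in> S ^^ n" .
  have "(f, op_apply (S ^^ Suc n) f) \<in> S ^^ n O S"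
    using mem[of "Suc n"] by simp
  then show "(op_apply (S ^^ n) f, op_apply (S ^^ Suc n) f) \<in> S"
    using eq by blast
  show "op_apply (S ^^ 0) f = f"
    by (rule eq) simp
qed

text \<open>
  The product of the weights along the path of length \<open>n\<close> that ends at \<open>v\<close>, and \<open>0\<close> if the
  path would have to start above the root.
\<close>

primrec ancestor_weight :: "('v \<times> 'v) set \<Rightarrow> ('v \<Rightarrow> complex) \<Rightarrow> nat \<Rightarrow> 'v \<Rightarrow> complex"
  where "ancestor_weight E w 0 v = 1"
  | "ancestor_weight E w (Suc n) v = (if is_root E v then 0 else w v * ancestor_weight E w n (par E v))"

lemma shift_power_fun:
  assumes "(f, g) \<in> weighted_shift E w ^^ n"
  shows "ell2_fun g v = ancestor_weight E w n v * ell2_fun f ((par E ^^ n) v)"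
  using assms
proof (induction n arbitrary: g v)
  case (Suc n)
  then obtain h where h: "(f, h) \<in> weighted_shift E w ^^ n" "(h, g) \<in> weighted_shift E w"
    by auto
  then show ?case
    using Suc.IH[OF h(1)] by (simp add: weighted_shift_def shift_map_def funpow_swap1)
qed simp

text \<open>
  The recursion splits off the last edge of the path, here it is the first edge.
\<close>

lemma ancestor_weight_Suc_top:
  "ancestor_weight E w (Suc n) v = ancestor_weight E w n v * (if is_root E ((par E ^^ n) v) then 0 else w ((par E ^^ n) v))"
proof (induction n arbitrary: v)
  case (Suc n)
  show ?case
    by (subst ancestor_weight.simps(2), subst Suc.IH) (simp add: funpow_swap1)
qed simp

text \<open>
  The vertices \<open>v\<close> that contribute to \<open>S\<^sup>n\<^sup>+\<^sup>1 e\<^sub>u\<close> are grouped by the child \<open>z\<close> of \<open>u\<close> that is their \<open>n\<close>-th ancestor; the sums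
  over \<open>v\<close> and \<open>z\<close> are exchanged by Fubini's theorem.
\<close>

lemma norm_shift_power_unit_vec_Suc:
  assumes par: "unique_parents E"
    and x: "\<And>u n. (unit_vec u, x n u) \<in> weighted_shift E w ^^ n"
  shows "ennreal ((norm (x (Suc n) u))\<^sup>2) = (\<integral>\<^sup>+z. child_weight E w u z * ennreal ((norm (x n z))\<^sup>2) \<partial>count_space UNIV)"
proof -
  let ?G = "\<lambda>(v, z). ennreal ((cmod (ancestor_weight E w n v))\<^sup>2) * child_weight E w u z * indicator {z} ((par E ^^ n) v)"
  let ?a = "\<lambda>n v. ennreal ((cmod (ancestor_weight E w n v))\<^sup>2)"
  have norm: "ennreal ((norm (x n u))\<^sup>2) = (\<integral>\<^sup>+v. ?a n v * indicator {u} ((par E ^^ n) v) \<partial>count_space UNIV)" for n u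
    unfolding norm_ell2_eq_nn_integral
    by (intro nn_integral_cong) (auto simp: shift_power_fun[OF x] unit_vec_fun)
  have "ennreal ((norm (x (Suc n) u))\<^sup>2) = (\<integral>\<^sup>+v. ?a n v * child_weight E w u ((par E ^^ n) v) \<partial>count_space UNIV)"
    unfolding norm
  proof (intro nn_integral_cong)
    fix v
    show "?a (Suc n) v * indicator {u} ((par E ^^ Suc n) v) = ?a n v * child_weight E w u ((par E ^^ n) v)"
      unfolding ancestor_weight_Suc_top child_weight_def
      by (auto simp: Chi_iff_par[OF par] norm_mult power_mult_distrib ennreal_mult)
  qed
  also have "\<dots> = (\<integral>\<^sup>+v. (\<integral>\<^sup>+z. ?G (v, z) \<partial>count_space UNIV) \<partial>count_space UNIV)"
  proof (intro nn_integral_cong)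
    fix v
    have "(\<integral>\<^sup>+z. ?a n v * child_weight E w u z * indicator {z} ((par E ^^ n) v) \<partial>count_space UNIV)
      = (\<Sum>z\<in>{(par E ^^ n) v}. ?a n v * child_weight E w u z * indicator {z} ((par E ^^ n) v))"
      by (rule nn_integral_count_space') (auto simp: indicator_def)
    then show "?a n v * child_weight E w u ((par E ^^ n) v) = (\<integral>\<^sup>+z. ?G (v, z) \<partial>count_space UNIV)"
      by simp
  qed
  also have "\<dots> = (\<integral>\<^sup>+z. (\<integral>\<^sup>+v. ?G (v, z) \<partial>count_space UNIV) \<partial>count_space UNIV)"
    unfolding nn_integral_fst_count_space nn_integral_snd_count_space ..
  also have "\<dots> = (\<integral>\<^sup>+z. child_weight E w u z * ennreal ((norm (x n z))\<^sup>2) \<partial>count_space UNIV)"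
  proof (intro nn_integral_cong)
    fix z
    have "(\<integral>\<^sup>+v. ?a n v * child_weight E w u z * indicator {z} ((par E ^^ n) v) \<partial>count_space UNIV)
      = (\<integral>\<^sup>+v. child_weight E w u z * (?a n v * indicator {z} ((par E ^^ n) v)) \<partial>count_space UNIV)"
      by (intro nn_integral_cong) (simp add: mult_ac)
    also have "\<dots> = child_weight E w u z * ennreal ((norm (x n z))\<^sup>2)"
      unfolding norm by (rule nn_integral_cmult) simp
    finally show "(\<integral>\<^sup>+v. ?G (v, z) \<partial>count_space UNIV)
      = child_weight E w u z * ennreal ((norm (x n z))\<^sup>2)" by simp
  qed
  finally show ?thesis .
qed

lemma has_bochner_integral_power_iff:
  assumes "sets M = sets borel_nonneg" "0 \<le> a"
  shows "has_bochner_integral M (\<lambda>s. s ^ n) a \<longleftrightarrow> (\<integral>\<^sup>+s. ennreal (s ^ n) \<partial>M) = ennreal a"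
proof -
  have "space M = {0..}"
    using sets_eq_imp_space_eq[OF assms(1)] by (simp add: space_restrict_space)
  then have nonneg: "AE s in M. 0 \<le> s ^ n"
    by (intro AE_I2) simp
  have meas: "(\<lambda>s. s ^ n) \<in> borel_measurable M"
    by (rule measurable_nonneg[OF assms(1)]) measurable
  show ?thesis
  proof
    assume "has_bochner_integral M (\<lambda>s. s ^ n) a"
    then have "integrable M (\<lambda>s. s ^ n)" "(\<integral>s. s ^ n \<partial>M) = a"
      by (auto simp: has_bochner_integral_iff)
    then show "(\<integral>\<^sup>+s. ennreal (s ^ n) \<partial>M) = ennreal a"
      using nn_integral_eq_integral[OF _ nonneg] by simp
  next
    assume "(\<integral>\<^sup>+s. ennreal (s ^ n) \<partial>M) = ennreal a"
    then show "has_bochner_integral M (\<lambda>s. s ^ n) a"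
      using meas nonneg assms(2) by (intro has_bochner_integral_nn_integral)
  qed
qed

lemma finite_measure_moment_0:
  assumes "(\<integral>\<^sup>+s. ennreal (s ^ 0) \<partial>M) = ennreal a"
  shows "finite_measure M" "emeasure M (space M) = ennreal a"
  using assms by (auto intro!: finite_measureI)

locale smooth_tree_shift =
  fixes E :: "('v \<times> 'v) set" and w :: "'v \<Rightarrow> complex"
  assumes par: "unique_parents E"
    and smooth: "\<And>u. unit_vec u \<in> smooth_vectors (weighted_shift E w)"
begin

definition orbit :: "nat \<Rightarrow> 'v \<Rightarrow> 'v ell2"
  where "orbit n u = op_apply (weighted_shift E w ^^ n) (unit_vec u)"

lemma orbit: "(unit_vec u, orbit n u) \<in> weighted_shift E w ^^ n" "(orbit n u, orbit (Suc n) u) \<in> weighted_shift E w"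
  "orbit 0 u = unit_vec u"
proof -
  have "single_valued (weighted_shift E w)"
    using linear_operator_weighted_shift[of E w] by (simp add: linear_operator_def)
  note smooth_orbit[OF this smooth]
  then show "(unit_vec u, orbit n u) \<in> weighted_shift E w ^^ n" "(orbit n u, orbit (Suc n) u) \<in> weighted_shift E w"
    "orbit 0 u = unit_vec u"
    unfolding orbit_def by blast+
qed

lemma norm_orbit_0: "norm (orbit 0 u) = 1"
proof -
  have "cinner (unit_vec u) (unit_vec u) = (1 :: complex)" for u :: 'v
    by (simp add: cinner_unit_vec unit_vec_fun)
  then have "(norm (unit_vec u))\<^sup>2 = 1\<^sup>2" for u :: 'v
    unfolding cinner_self by (metis of_real_eq_1_iff one_power2)
  then show ?thesis
    unfolding orbit(3) by (simp only: power2_eq_iff_nonneg norm_ge_zero zero_le_one)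
qed

lemma norm_orbit_Suc:
  "ennreal ((norm (orbit (Suc n) u))\<^sup>2) = (\<integral>\<^sup>+z. child_weight E w u z * ennreal ((norm (orbit n z))\<^sup>2) \<partial>count_space UNIV)"
  by (rule norm_shift_power_unit_vec_Suc[OF par orbit(1)])

lemma moments_if_mixture:
  assumes prob: "\<And>v. prob_space (\<mu> v)" and sets: "\<And>v. sets (\<mu> v) = sets borel_nonneg"
    and dens: "\<And>u. density (\<mu> u) (\<lambda>s. ennreal s) = mixture (child_weight E w u) \<mu>"
  shows "(\<integral>\<^sup>+s. ennreal (s ^ n) \<partial>\<mu> u) = ennreal ((norm (orbit n u))\<^sup>2)"
proof (induction n arbitrary: u)
  case 0
  show ?case
    using prob_space.emeasure_space_1[OF prob, of u] by (simp add: norm_orbit_0)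
next
  case (Suc n)
  have m: "(\<lambda>s. ennreal (s ^ n)) \<in> borel_measurable borel" "(\<lambda>s. ennreal s) \<in> borel_measurable borel"
    by measurable
  have "(\<integral>\<^sup>+s. ennreal (s ^ Suc n) \<partial>\<mu> u) = (\<integral>\<^sup>+s. ennreal s * ennreal (s ^ n) \<partial>\<mu> u)"
    using sets_eq_imp_space_eq[OF sets[of u]]
    by (intro nn_integral_cong) (simp add: space_restrict_space ennreal_mult)
  also have "\<dots> = (\<integral>\<^sup>+s. ennreal (s ^ n) \<partial>density (\<mu> u) (\<lambda>s. ennreal s))"
    by (subst nn_integral_density) (auto intro!: measurable_nonneg[OF sets] m)
  also have "\<dots> = (\<integral>\<^sup>+z. child_weight E w u z * (\<integral>\<^sup>+s. ennreal (s ^ n) \<partial>\<mu> z) \<partial>count_space UNIV)"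
    unfolding dens by (rule nn_integral_mixture[OF prob sets measurable_restrict_space1[OF m(1)]])
  also have "\<dots> = ennreal ((norm (orbit (Suc n) u))\<^sup>2)"
    unfolding Suc.IH norm_orbit_Suc ..
  finally show ?case .
qed

text \<open>
  Both sides have the moments \<open>t n = \<parallel>S\<^sup>n\<^sup>+\<^sup>1 e\<^sub>u\<parallel>\<^sup>2\<close>.  Put \<open>b n = \<parallel>S\<^sup>n e\<^sub>u\<parallel>\<close>.  The geometric means of the
  quotients \<open>b k / b (k + 1)\<close> telescope to \<open>b (n + 1) powr (- 1 / (n + 1))\<close>, the terms of the series that
  diverges for a quasi-analytic vector.  By Carleman's inequality the series of the
  quotients diverges as well, and up to its first term it is the Carleman series of \<open>t\<close>.
\<close>

lemma mixture_if_moments: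
  assumes sets: "\<And>v. sets (\<mu> v) = sets borel_nonneg"
    and mom: "\<And>u n. (\<integral>\<^sup>+s. ennreal (s ^ n) \<partial>\<mu> u) = ennreal ((norm (orbit n u))\<^sup>2)"
    and quasi: "unit_vec u \<in> quasi_analytic_vectors (weighted_shift E w)"
  shows "density (\<mu> u) (\<lambda>s. ennreal s) = mixture (child_weight E w u) \<mu>"
proof -
  have prob: "prob_space (\<mu> v)" for v
    using mom[where u = v and n = 0] by (intro prob_spaceI) (simp add: norm_orbit_0)
  define t where "t n = (norm (orbit (Suc n) u))\<^sup>2" for n
  have m: "(\<lambda>s. ennreal (s ^ n)) \<in> borel_measurable borel" "(\<lambda>s. ennreal s) \<in> borel_measurable borel" for n
    by measurable
  have S: "sets (density (\<mu> u) (\<lambda>s. ennreal s)) = sets borel_nonneg" "sets (mixture (child_weight E w u) \<mu>) = sets borel_nonneg"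
    by (simp_all add: sets sets_mixture[OF prob sets])
  have 1: "(\<integral>\<^sup>+s. ennreal (s ^ n) \<partial>density (\<mu> u) (\<lambda>s. ennreal s)) = ennreal (t n)" for n
  proof -
    have "(\<integral>\<^sup>+s. ennreal (s ^ n) \<partial>density (\<mu> u) (\<lambda>s. ennreal s)) = (\<integral>\<^sup>+s. ennreal s * ennreal (s ^ n) \<partial>\<mu> u)"
      by (subst nn_integral_density) (auto intro!: measurable_nonneg[OF sets] m)
    also have "\<dots> = (\<integral>\<^sup>+s. ennreal (s ^ Suc n) \<partial>\<mu> u)"
      using sets_eq_imp_space_eq[OF sets[of u]]
      by (intro nn_integral_cong) (simp add: space_restrict_space ennreal_mult)
    finally show ?thesis by (simp only: mom t_def)
  qed
  have 2: "(\<integral>\<^sup>+s. ennreal (s ^ n) \<partial>mixture (child_weight E w u) \<mu>) = ennreal (t n)" for n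
    unfolding nn_integral_mixture[OF prob sets measurable_restrict_space1[OF m(1)]] mom t_def norm_orbit_Suc ..
  have t0: "0 \<le> t n" for n by (simp add: t_def)
  show ?thesis
  proof (rule stieltjes_determinate[OF finite_measure_moment_0(1)[OF 1] finite_measure_moment_0(1)[OF 2] S])
    show "has_bochner_integral (density (\<mu> u) (\<lambda>s. ennreal s)) (\<lambda>s. s ^ n) (t n)" for n
      using 1 t0 by (simp add: has_bochner_integral_power_iff[OF S(1)])
    show "has_bochner_integral (mixture (child_weight E w u) \<mu>) (\<lambda>s. s ^ n) (t n)" for n
      using 2 t0 by (simp add: has_bochner_integral_power_iff[OF S(2)])
    assume pos: "\<And>n. 0 < t n"
    define b where "b n = norm (orbit n u)" for n
    have bpos: "0 < b n" for n
      using pos[of "n - 1"] norm_orbit_0[of u] by (cases n) (auto simp: b_def t_def)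
    show "\<not> summable (\<lambda>n. sqrt (t n / t (Suc n)))"
    proof
      assume "summable (\<lambda>n. sqrt (t n / t (Suc n)))"
      moreover have "sqrt (t n / t (Suc n)) = b (Suc n) / b (Suc (Suc n))" for n
        by (simp add: t_def b_def real_sqrt_divide)
      ultimately have "summable (\<lambda>n. b (Suc n) / b (Suc (Suc n)))" by simp
      then have "summable (\<lambda>n. b n / b (Suc n))"
        by (rule summable_Suc_iff[THEN iffD1])
      then have "summable (\<lambda>n. root (Suc n) (\<Prod>k\<le>n. b k / b (Suc k)))"
        using bpos by (intro carleman_inequality) auto
      moreover have "(\<Prod>k\<le>n. b k / b (Suc k)) = 1 / b (Suc n)" for n
      proof (induction n)
        case 0
        show ?case using norm_orbit_0[of u] by (simp add: b_def)
      next
        case (Suc n)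
        have "b (Suc n) \<noteq> 0" using bpos[of "Suc n"] by simp
        then show ?case unfolding prod.atMost_Suc Suc by simp
      qed
      ultimately have sum: "summable (\<lambda>n. 1 / root (Suc n) (b (Suc n)))"
        by (simp add: real_root_divide)
      have root_pos: "0 < root (Suc n) (b (Suc n))" for n
        using bpos by simp
      have "1 / ennreal (root (Suc n) (b (Suc n))) = ennreal (1 / root (Suc n) (b (Suc n)))" for n
        using divide_ennreal[OF _ root_pos[of n], of 1] by simp
      moreover have "(\<Sum>n. 1 / ennreal (root (Suc n) (b (Suc n)))) = \<infinity>"
        using quasi by (simp only: quasi_analytic_vectors_def b_def orbit_def mem_Collect_eq)
      ultimately have "(\<Sum>n. ennreal (1 / root (Suc n) (b (Suc n)))) = \<infinity>"
        by (simp only:)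
      moreover have "(\<Sum>n. ennreal (1 / root (Suc n) (b (Suc n)))) = ennreal (\<Sum>n. 1 / root (Suc n) (b (Suc n)))"
        by (rule suminf_ennreal2[OF _ sum]) (use root_pos in \<open>simp add: less_imp_le\<close>)
      ultimately show False by simp
    qed
  qed
qed

end

text \<open>
  For nonnegative functions this is the formula for the integral of a mixture.  A bounded real function becomes
  nonnegative by adding \<open>1\<close>, and this is harmless since the measures are finite.
\<close>

lemma has_sum_integral_mixture:
  fixes \<mu> :: "'v \<Rightarrow> real measure" and f :: "real \<Rightarrow> complex"
  assumes prob: "\<And>v. prob_space (\<mu> v)" and sets: "\<And>v. sets (\<mu> v) = sets borel_nonneg"
    and fin: "finite_measure (mixture (child_weight E w u) \<mu>)"
    and f: "f \<in> borel_measurable borel" "\<And>s. cmod (f s) \<le> 1"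
  shows "((\<lambda>v. of_real ((cmod (w v))\<^sup>2) * (\<integral>s. f s \<partial>\<mu> v)) has_sum (\<integral>s. f s \<partial>mixture (child_weight E w u) \<mu>)) (Chi E u)"
proof -
  let ?\<beta> = "mixture (child_weight E w u) \<mu>"
  interpret B: finite_measure ?\<beta> by (rule fin)
  note S = sets_mixture[OF prob sets, of "child_weight E w u"]
  have int\<mu>: "integrable (\<mu> v) h" if "h \<in> borel_measurable borel" "\<And>s. norm (h s) \<le> c" for h :: "real \<Rightarrow> 'b::{banach, second_countable_topology}" and v c
    by (rule integrable_bounded_prob[OF prob measurable_nonneg[OF sets that(1)]]) (rule that(2))
  have int\<beta>: "integrable ?\<beta> h" if "h \<in> borel_measurable borel" "\<And>s. norm (h s) \<le> c" for h :: "real \<Rightarrow> 'b::{banach, second_countable_topology}" and c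
    by (rule B.integrable_const_bound[of _ c]) (use that measurable_nonneg[OF S that(1)] in auto)
  have pos: "((\<lambda>v. (cmod (w v))\<^sup>2 * (\<integral>s. h s \<partial>\<mu> v)) has_sum (\<integral>s. h s \<partial>?\<beta>)) (Chi E u)"
    if h: "h \<in> borel_measurable borel" "\<And>s. 0 \<le> h s" "\<And>s. h s \<le> 2" for h :: "real \<Rightarrow> real"
  proof (rule has_sum_if_nn_integral_count_space)
    have bd: "norm (h s) \<le> 2" for s using h by simp
    have "ennreal (\<integral>s. h s \<partial>?\<beta>) = (\<integral>\<^sup>+s. ennreal (h s) \<partial>?\<beta>)"
      using h by (intro nn_integral_eq_integral[symmetric] int\<beta>[OF h(1) bd]) auto
    also have "\<dots> = (\<integral>\<^sup>+v. child_weight E w u v * (\<integral>\<^sup>+s. ennreal (h s) \<partial>\<mu> v) \<partial>count_space UNIV)"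
    proof (rule nn_integral_mixture[OF prob sets])
      show "(\<lambda>s. ennreal (h s)) \<in> borel_measurable borel_nonneg"
        using h(1) by (intro measurable_restrict_space1) measurable
    qed
    also have "\<dots> = (\<integral>\<^sup>+v. child_weight E w u v * ennreal (\<integral>s. h s \<partial>\<mu> v) \<partial>count_space UNIV)"
      using h by (subst nn_integral_eq_integral[OF int\<mu>[OF h(1) bd]]) auto
    also have "\<dots> = (\<Sum>\<^sub>\<infinity>v\<in>Chi E u. ennreal ((cmod (w v))\<^sup>2) * ennreal (\<integral>s. h s \<partial>\<mu> v))"
      by (rule nn_integral_child_weight)
    also have "\<dots> = (\<integral>\<^sup>+v. ennreal ((cmod (w v))\<^sup>2 * (\<integral>s. h s \<partial>\<mu> v)) \<partial>count_space (Chi E u))"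
      unfolding nn_integral_count_space_eq_infsum
      by (intro infsum_cong ennreal_mult[symmetric]) (auto intro: Bochner_Integration.integral_nonneg h(2))
    finally show "(\<integral>\<^sup>+v. ennreal ((cmod (w v))\<^sup>2 * (\<integral>s. h s \<partial>\<mu> v)) \<partial>count_space (Chi E u)) = ennreal (\<integral>s. h s \<partial>?\<beta>)" ..
  qed (auto intro!: mult_nonneg_nonneg Bochner_Integration.integral_nonneg h(2))
  have real: "((\<lambda>v. (cmod (w v))\<^sup>2 * (\<integral>s. h s \<partial>\<mu> v)) has_sum (\<integral>s. h s \<partial>?\<beta>)) (Chi E u)"
    if h: "h \<in> borel_measurable borel" "\<And>s. \<bar>h s\<bar> \<le> 1" for h :: "real \<Rightarrow> real"
  proof -
    have bd: "- 1 \<le> h s" "h s \<le> 1" for s using h(2)[of s] by (auto simp: abs_le_iff)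
    have h1: "(\<lambda>s. h s + 1) \<in> borel_measurable borel" using h(1) by measurable
    have h1_bd: "0 \<le> h s + 1" "h s + 1 \<le> 2" "norm (h s + 1) \<le> 2" for s
      using bd[of s] by auto
    have "((\<lambda>v. (cmod (w v))\<^sup>2 * (\<integral>s. h s + 1 \<partial>\<mu> v) + (-1) * ((cmod (w v))\<^sup>2 * (\<integral>s. 1 \<partial>\<mu> v))) has_sum
      (\<integral>s. h s + 1 \<partial>?\<beta>) + (-1) * (\<integral>s. 1 \<partial>?\<beta>)) (Chi E u)"
      by (intro has_sum_add has_sum_cmult_right pos h1 h1_bd) auto
    moreover have "(\<integral>s. h s + 1 \<partial>\<mu> v) - (\<integral>s. 1 \<partial>\<mu> v) = (\<integral>s. h s \<partial>\<mu> v)" for v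
      using int\<mu>[OF h1 h1_bd(3)] int\<mu>[of "\<lambda>_. 1 :: real" 1]
      by (subst Bochner_Integration.integral_diff[symmetric]) auto
    moreover have "(\<integral>s. h s + 1 \<partial>?\<beta>) - (\<integral>s. 1 \<partial>?\<beta>) = (\<integral>s. h s \<partial>?\<beta>)"
      using int\<beta>[OF h1 h1_bd(3)] int\<beta>[of "\<lambda>_. 1 :: real" 1]
      by (subst Bochner_Integration.integral_diff[symmetric]) auto
    ultimately show ?thesis
      by (simp only: mult_minus1 minus_mult_right[symmetric] add_uminus_conv_diff right_diff_distrib[symmetric])
  qed
  have re: "(\<lambda>s. Re (f s)) \<in> borel_measurable borel" "\<bar>Re (f s)\<bar> \<le> 1" and im: "(\<lambda>s. Im (f s)) \<in> borel_measurable borel" "\<bar>Im (f s)\<bar> \<le> 1" for s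
    using f abs_Re_le_cmod[of "f s"] abs_Im_le_cmod[of "f s"] by (auto intro: order_trans)
  have parts: "(\<integral>s. f s \<partial>M) = of_real (\<integral>s. Re (f s) \<partial>M) + \<i> * of_real (\<integral>s. Im (f s) \<partial>M)" if "integrable M f" for M
    using that by (simp add: complex_eq_iff)
  have eq: "of_real ((cmod (w v))\<^sup>2) * (\<integral>s. f s \<partial>\<mu> v)
    = of_real ((cmod (w v))\<^sup>2 * (\<integral>s. Re (f s) \<partial>\<mu> v)) + \<i> * of_real ((cmod (w v))\<^sup>2 * (\<integral>s. Im (f s) \<partial>\<mu> v))" for v
    unfolding parts[OF int\<mu>[OF f]] by (simp only: of_real_mult distrib_left mult.left_commute)
  show ?thesis
    unfolding eq parts[OF int\<beta>[OF f]]
    by (intro has_sum_add has_sum_cmult_right has_sum_of_real real re im)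
qed

section \<open>The equivalence\<close>

text \<open>
  Under \<open>\<theta> = arctan (sqrt s)\<close>, the function \<open>sin\<^sup>2 \<theta>\<close> becomes \<open>s\<close> times \<open>cos\<^sup>2 \<theta>\<close>, so the
  relation between the measures on the circle is the density equation integrated against
  \<open>h = cos\<^sup>2 \<theta> e\<^sup>i\<^sup>n\<^sup>\<theta>\<close>.
\<close>

lemma subnormal_if_mixture:
  fixes E :: "('v \<times> 'v) set" and w :: "'v \<Rightarrow> complex" and \<mu> :: "'v \<Rightarrow> real measure"
  assumes par: "unique_parents E"
    and dom: "\<And>u. unit_vec u \<in> Domain (weighted_shift E w)"
    and prob: "\<And>v. prob_space (\<mu> v)" and sets: "\<And>v. sets (\<mu> v) = sets borel_nonneg"
    and dens: "\<And>u. density (\<mu> u) (\<lambda>s. ennreal s) = mixture (child_weight E w u) \<mu>"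
    and fin: "\<And>u. finite_measure (mixture (child_weight E w u) \<mu>)"
  shows "subnormal_in TYPE(('v \<times> nat) ell2) (weighted_shift E w)"
proof -
  define \<theta> where "\<theta> s = arctan (sqrt s)" for s
  have \<theta>_borel: "\<theta> \<in> borel_measurable borel"
    unfolding \<theta>_def by measurable
  have \<theta>_meas: "\<theta> \<in> measurable (\<mu> u) borel" for u
    by (rule measurable_nonneg[OF sets \<theta>_borel])
  define \<nu> where "\<nu> u = distr (\<mu> u) borel \<theta>" for u
  have space: "space (\<mu> u) = {0..}" for u
    using sets_eq_imp_space_eq[OF sets[of u]] by (simp add: space_restrict_space)
  have cos2: "(cos (\<theta> s))\<^sup>2 = 1 / (1 + s)" and sin2: "(sin (\<theta> s))\<^sup>2 = s / (1 + s)" if "0 \<le> s" for s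
    using that by (simp_all add: \<theta>_def cos_arctan sin_arctan power_divide)
  have cis_meas [measurable]: "(\<lambda>x. cis (f x)) \<in> borel_measurable borel" if "f \<in> borel_measurable borel" for f :: "real \<Rightarrow> real"
    using that unfolding cis_conv_exp by measurable
  show ?thesis
  proof (rule subnormal_if_angular_measures[OF par dom])
    fix u
    show "prob_space (\<nu> u)"
      unfolding \<nu>_def by (rule prob_space.prob_space_distr[OF prob \<theta>_meas])
    show "sets (\<nu> u) = sets borel"
      by (simp add: \<nu>_def)
    show "AE t in \<nu> u. 0 < cos t"
      unfolding \<nu>_def by (subst AE_distr_iff[OF \<theta>_meas]) (auto simp: \<theta>_def cos_arctan add_pos_nonneg)
    fix n :: int
    define h where "h s = of_real ((cos (\<theta> s))\<^sup>2) * cis (of_int n * \<theta> s)" for s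
    have h: "h \<in> borel_measurable borel"
      unfolding h_def using \<theta>_borel by measurable
    have h1: "cmod (h s) \<le> 1" for s
      by (simp add: h_def norm_mult norm_power abs_square_le_1)
    have "(\<integral>t. of_real ((sin t)\<^sup>2) * cis (of_int n * t) \<partial>\<nu> u) = (\<integral>s. of_real ((sin (\<theta> s))\<^sup>2) * cis (of_int n * \<theta> s) \<partial>\<mu> u)"
      unfolding \<nu>_def by (rule integral_distr[OF \<theta>_meas]) measurable
    also have "\<dots> = (\<integral>s. s *\<^sub>R h s \<partial>\<mu> u)"
      by (intro Bochner_Integration.integral_cong refl)
        (simp add: space h_def cos2 sin2 scaleR_conv_of_real)
    also have "\<dots> = (\<integral>s. h s \<partial>density (\<mu> u) (\<lambda>s. ennreal s))"
      by (rule integral_density[symmetric]) (auto simp: space intro!: measurable_nonneg[OF sets] h AE_I2)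
    also have "\<dots> = (\<Sum>\<^sub>\<infinity>v\<in>Chi E u. of_real ((cmod (w v))\<^sup>2) * (\<integral>s. h s \<partial>\<mu> v))"
      unfolding dens by (rule infsumI[symmetric, OF has_sum_integral_mixture[OF prob sets fin h h1]])
    also have "(\<lambda>v. \<integral>s. h s \<partial>\<mu> v) = (\<lambda>v. \<integral>t. of_real ((cos t)\<^sup>2) * cis (of_int n * t) \<partial>\<nu> v)"
      unfolding \<nu>_def h_def by (subst integral_distr[OF \<theta>_meas]) measurable
    finally show "(\<integral>t. of_real ((sin t)\<^sup>2) * cis (of_int n * t) \<partial>\<nu> u)
      = (\<Sum>\<^sub>\<infinity>v\<in>Chi E u. of_real ((cmod (w v))\<^sup>2) * (\<integral>t. of_real ((cos t)\<^sup>2) * cis (of_int n * t) \<partial>\<nu> v))" .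
  qed
qed

context smooth_tree_shift
begin

lemma moments_if_subnormal:
  assumes "subnormal_in TYPE('k::chilbert_space) (weighted_shift E w)"
  shows "stieltjes_moment_seq (\<lambda>n. (norm (orbit n u))\<^sup>2)"
proof -
  obtain J :: "'v ell2 \<Rightarrow> 'k" and N where norm: "\<forall>h. norm (J h) = norm h" and N: "normal_operator N"
    and ext: "\<forall>(h, h') \<in> weighted_shift E w. (J h, J h') \<in> N"
    using assms unfolding subnormal_in_def by blast
  have "stieltjes_moment_seq (\<lambda>n. (norm (J (orbit n u)))\<^sup>2)"
    by (rule normal_operator_moments[OF N]) (use ext orbit(2) in blast)
  then show ?thesis by (simp add: norm)
qed

lemma moments_iff_consistent:
  assumes quasi: "\<And>u. unit_vec u \<in> quasi_analytic_vectors (weighted_shift E w)"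
  shows "(\<forall>u. stieltjes_moment_seq (\<lambda>n. (norm (orbit n u))\<^sup>2)) \<longleftrightarrow>
    (\<exists>\<mu> \<epsilon>. (\<forall>v. prob_space (\<mu> v) \<and> sets (\<mu> v) = sets borel_nonneg) \<and> (\<forall>v. 0 \<le> \<epsilon> v) \<and> consistent_system E w \<mu> \<epsilon>)"
proof
  assume "\<forall>u. stieltjes_moment_seq (\<lambda>n. (norm (orbit n u))\<^sup>2)"
  from choice[OF this[unfolded stieltjes_moment_seq_def]]
  obtain \<mu> where sets: "\<And>u. sets (\<mu> u) = sets borel_nonneg"
    and mom: "\<And>u n. has_bochner_integral (\<mu> u) (\<lambda>s. s ^ n) ((norm (orbit n u))\<^sup>2)"
    by blast
  have mom': "(\<integral>\<^sup>+s. ennreal (s ^ n) \<partial>\<mu> u) = ennreal ((norm (orbit n u))\<^sup>2)" for u n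
    using mom[of u n] by (simp add: has_bochner_integral_power_iff[OF sets])
  have prob: "prob_space (\<mu> v)" for v
    using mom'[where u = v and n = 0] by (intro prob_spaceI) (simp add: norm_orbit_0)
  have "\<exists>\<epsilon>. (\<forall>v. 0 \<le> \<epsilon> v) \<and> consistent_system E w \<mu> \<epsilon>"
    unfolding consistent_system_iff_density[OF prob sets]
    using mixture_if_moments[OF sets mom' quasi] by blast
  then show "\<exists>\<mu> \<epsilon>. (\<forall>v. prob_space (\<mu> v) \<and> sets (\<mu> v) = sets borel_nonneg) \<and> (\<forall>v. 0 \<le> \<epsilon> v) \<and> consistent_system E w \<mu> \<epsilon>"
    using prob sets by blast
next
  assume "\<exists>\<mu> \<epsilon>. (\<forall>v. prob_space (\<mu> v) \<and> sets (\<mu> v) = sets borel_nonneg) \<and> (\<forall>v. 0 \<le> \<epsilon> v) \<and> consistent_system E w \<mu> \<epsilon>"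
  then obtain \<mu> \<epsilon> where prob: "\<And>v. prob_space (\<mu> v)" and sets: "\<And>v. sets (\<mu> v) = sets borel_nonneg"
    and "\<forall>v. 0 \<le> \<epsilon> v" "consistent_system E w \<mu> \<epsilon>" by blast
  then have "density (\<mu> u) (\<lambda>s. ennreal s) = mixture (child_weight E w u) \<mu>" for u
    using consistent_system_iff_density[where \<mu> = \<mu> and E = E and w = w, OF prob sets] by blast
  then have "(\<integral>\<^sup>+s. ennreal (s ^ n) \<partial>\<mu> u) = ennreal ((norm (orbit n u))\<^sup>2)" for u n
    by (rule moments_if_mixture[where \<mu> = \<mu>, OF prob sets])
  then have "has_bochner_integral (\<mu> u) (\<lambda>s. s ^ n) ((norm (orbit n u))\<^sup>2)" for u n
    by (simp add: has_bochner_integral_power_iff[OF sets])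
  then show "\<forall>u. stieltjes_moment_seq (\<lambda>n. (norm (orbit n u))\<^sup>2)"
    unfolding stieltjes_moment_seq_def using sets by blast
qed

lemma subnormal_if_consistent:
  assumes "\<And>v. prob_space (\<mu> v)" "\<And>v. sets (\<mu> v) = sets borel_nonneg" "\<forall>v. 0 \<le> \<epsilon> v" "consistent_system E w \<mu> \<epsilon>"
  shows "subnormal_in TYPE(('v \<times> nat) ell2) (weighted_shift E w)"
proof -
  have dens: "density (\<mu> u) (\<lambda>s. ennreal s) = mixture (child_weight E w u) \<mu>" for u
    using consistent_system_iff_density[where \<mu> = \<mu> and E = E and w = w, OF assms(1,2)] assms(3,4) by blast
  have mom0: "(\<integral>\<^sup>+s. ennreal (s ^ 0) \<partial>\<mu> z) = ennreal ((norm (orbit 0 z))\<^sup>2)" for z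
    by (rule moments_if_mixture[where \<mu> = \<mu>]) (rule assms dens)+
  have "(\<integral>\<^sup>+s. ennreal (s ^ 0) \<partial>mixture (child_weight E w u) \<mu>) = ennreal ((norm (orbit 1 u))\<^sup>2)" for u
  proof -
    have "(\<integral>\<^sup>+s. ennreal (s ^ 0) \<partial>mixture (child_weight E w u) \<mu>)
      = (\<integral>\<^sup>+z. child_weight E w u z * (\<integral>\<^sup>+s. ennreal (s ^ 0) \<partial>\<mu> z) \<partial>count_space UNIV)"
      by (rule nn_integral_mixture[where \<mu> = \<mu>, OF assms(1,2)]) simp
    also have "\<dots> = (\<integral>\<^sup>+z. child_weight E w u z * ennreal ((norm (orbit 0 z))\<^sup>2) \<partial>count_space UNIV)"
      by (simp only: mom0)
    also have "\<dots> = ennreal ((norm (orbit 1 u))\<^sup>2)"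
      unfolding One_nat_def by (rule norm_orbit_Suc[symmetric])
    finally show ?thesis .
  qed
  then have fin: "finite_measure (mixture (child_weight E w u) \<mu>)" for u
    by (rule finite_measure_moment_0(1))
  have dom: "unit_vec u \<in> Domain (weighted_shift E w)" for u
    using orbit(2)[of 0 u] unfolding orbit(3) by blast
  show ?thesis
    by (rule subnormal_if_mixture[where \<mu> = \<mu>, OF par dom assms(1,2) dens fin])
qed

end

theorem theorem5p4p1:
  fixes E :: "('v \<times> 'v) set" and w :: "'v \<Rightarrow> complex"
  assumes "directed_tree E"
    and "unit_vec_span \<subseteq> quasi_analytic_vectors (weighted_shift E w)"
  shows
    "(subnormal_in TYPE('k::chilbert_space) (weighted_shift E w) \<longrightarrow>
        subnormal_in TYPE(('v \<times> nat) ell2) (weighted_shift E w)) \<and>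
     (subnormal_in TYPE(('v \<times> nat) ell2) (weighted_shift E w) \<longleftrightarrow>
        (\<forall>u. stieltjes_moment_seq
          (\<lambda>n. (norm (op_apply (weighted_shift E w ^^ n) (unit_vec u)))\<^sup>2))) \<and>
     ((\<forall>u. stieltjes_moment_seq
          (\<lambda>n. (norm (op_apply (weighted_shift E w ^^ n) (unit_vec u)))\<^sup>2)) \<longleftrightarrow>
        (\<exists>(\<mu> :: 'v \<Rightarrow> real measure) (\<epsilon> :: 'v \<Rightarrow> real).
          (\<forall>v. prob_space (\<mu> v) \<and> sets (\<mu> v) = sets borel_nonneg) \<and>
          (\<forall>v. 0 \<le> \<epsilon> v) \<and>
          consistent_system E w \<mu> \<epsilon>))"
proof -
  have quasi: "unit_vec u \<in> quasi_analytic_vectors (weighted_shift E w)" for u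
    using assms(2) unit_vec_in_span[of u] by (rule subsetD)
  have "unique_parents E"
    using assms(1) by (simp add: directed_tree_def unique_parents_def)
  then interpret smooth_tree_shift E w
  proof unfold_locales
    show "unit_vec u \<in> smooth_vectors (weighted_shift E w)" for u
      using quasi[of u] by (simp only: quasi_analytic_vectors_def mem_Collect_eq)
  qed
  have subnormal: "subnormal_in TYPE(('v \<times> nat) ell2) (weighted_shift E w)"
    if "\<forall>u. stieltjes_moment_seq (\<lambda>n. (norm (orbit n u))\<^sup>2)"
    using that subnormal_if_consistent unfolding moments_iff_consistent[OF quasi] by blast
  show ?thesis
    unfolding orbit_def[symmetric]
    using moments_if_subnormal[where 'k = 'k] moments_if_subnormal[where 'k = "('v \<times> nat) ell2"]
      subnormal moments_iff_consistent[OF quasi]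
    by blast
qed

end
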